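(* Let $E,A\in\mathbb{R}^{m\times n}$, $B,C\in\mathbb{R}^{l\times n}$, $d\in\mathbb{R}^l$, $T>0$, and let $f:[0,T]\to\mathbb{R}^m$ be $C^1$ on $(0,T)$. Let $W\in\mathbb{R}^{m\times m}$ and $V\in\mathbb{R}^{n\times n}$ be invertible matrices transforming $(E,A)$ into the quasi-Kronecker form $$WEV=\operatorname{diag}(I_{n_0},N_\alpha,L_\beta,L_\gamma^\top),\qquad WAV=\operatorname{diag}(A_0,I_{|\alpha|},K_\beta,K_\gamma^\top),$$ with $n_0+|\beta|-n_\beta>0$, and suppose that the components $f_0,f_1,f_2,f_3$ of $Wf$ satisfy the regularity assumptions (A0)–(A3) listed in the context. Then, for any $\widetilde\varphi\in C([0,T],\mathbb{R}^{n_\beta})$, the boundary value problem $$E\dot x(t)=Ax(t)+f(t),\ t\in(0,T),\qquad Bx(0)+Cx(T)=d$$ has a solution $x\in C^1([0,T],\mathbb{R}^n)$ if and only if the following conditions hold: (a) $\sum_{i=1}^{\gamma_k} f_{\gamma_k,i}^{(\gamma_k-i)}(t)=0$, $k=1,\dots,n_\gamma$ (for all $t$); (b) $\widehat d\in\operatorname{ran}Q$. Any solution $x$ is given by $x(t)=V\,(x_0(t)^\top,x_1(t)^\top,x_2(t)^\top,x_3(t)^\top)^\top$, where $$x_0(t)=e^{A_0t}P_0\big(Q^g\widehat d+(I_{n_0+|\beta|-n_\beta}-Q^gQ)z\big)+\int_0^t e^{A_0(t-s)}f_0(s)\,ds,$$ $$x_1(t)=-\sum_{i=0}^{\nu_\alpha-1}N_\alpha^i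 f_1^{(i)}(t),$$ $$x_2(t)=\begin{cases}e^{N_\beta t}L_\beta^\top P_2\big(Q^g\widehat d+(I_{n_0+|\beta|-n_\beta}-Q^gQ)z\big)+\widetilde h_\beta(t;\widetilde\varphi(t)),&|\beta|-n_\beta>0,\\ \widetilde\varphi(t),&|\beta|-n_\beta=0,\end{cases}$$ $$x_3(t)=-K_\gamma\sum_{i=0}^{\nu_\gamma-1}N_\gamma^i f_3^{(i)}(t)\quad\text{if }|\gamma|>n_\gamma.$$ Here $z\in\mathbb{R}^{n_0+|\beta|-n_\beta}$ is an arbitrary vector and $Q^g$ is any generalized inverse of $Q$. If $|\gamma|=n_\gamma$, then $x_3$ is absent from the representation and the solution consists only of the first three components: $x(t)=V(x_0(t)^\top,x_1(t)^\top,x_2(t)^\top)^\top$.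
   Context: A solution of the boundary value problem is a function $x\in C^1([0,T],\mathbb{R}^n)$ satisfying the equation on $(0,T)$ and the boundary condition. A generalized inverse of a matrix $M$ is any matrix $M^g$ with $MM^gM=M$; $\operatorname{ran}$ denotes the range (column space). Canonical blocks. For $k\in\mathbb{N}$, $k\ge1$: $N_k\in\mathbb{R}^{k\times k}$ is the nilpotent matrix with ones on the first subdiagonal and zeros elsewhere; $K_k=[I_{k-1}\ \ 0]$ and $L_k=[0\ \ I_{k-1}]$ in $\mathbb{R}^{(k-1)\times k}$ (for $k=1$ these are $0\times1$ matrices: in a block diagonal matrix they contribute a zero column and no row, and their transposes contribute a zero row and no column). For a multi-index $\alpha=(\alpha_1,\dots,\alpha_{n_\alpha})$ of positive integers, $|\alpha|=\sum_i\alpha_i$, $N_\alpha=\operatorname{diag}(N_{\alpha_1},\dots,N_{\alpha_{n_\alpha}})$, $K_\alpha=\operatorname{diag}(K_{\alpha_1},\dots,K_{\alpha_{n_\alpha}})$, $L_\alpha=\operatorname{diag}(L_{\alpha_1},\dots,L_{\alpha_{n_\alpha}})$. In the quasi-Kronecker form, $A_0\in\mathbb{R}^{n_0\times n_0}$ and $\alpha,\beta,\gamma$ are multi-indices of lengths $n_\alpha,n_\beta,n_\gamma$; any of $n_0,n_\alpha,n_\beta,n_\gamma$ may be $0$, in which case the corresponding block is absent, and all components and terms below belonging to an absent block are omitted (zero). Splitting. $V^{-1}x=(x_0^\top,x_1^\top,x_2^\top,x_3^\top)^\top$ with sizes $n_0,|\alpha|,|\beta|,|\gamma|-n_\gamma$;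 $Wf=(f_0^\top,f_1^\top,f_2^\top,f_3^\top)^\top$ with sizes $n_0,|\alpha|,|\beta|-n_\beta,|\gamma|$; $BV=[B_0,B_1,B_2,B_3]$ and $CV=[C_0,C_1,C_2,C_3]$ with column blocks of sizes $n_0,|\alpha|,|\beta|,|\gamma|-n_\gamma$. Further $f_1=(f_{\alpha_1}^\top,\dots,f_{\alpha_{n_\alpha}}^\top)^\top$ with $f_{\alpha_k}$ valued in $\mathbb{R}^{\alpha_k}$, $f_3=(f_{\gamma_1}^\top,\dots,f_{\gamma_{n_\gamma}}^\top)^\top$ with $f_{\gamma_k}$ valued in $\mathbb{R}^{\gamma_k}$ (the index $k$ identifies the block), and $f_{\gamma_k,i}$ is the $i$-th component of $f_{\gamma_k}$. Regularity assumptions: (A0) $f_0\in C([0,T],\mathbb{R}^{n_0})$; (A1) $f_{\alpha_k}\in C^{\alpha_k}([0,T],\mathbb{R}^{\alpha_k})$ for $k=1,\dots,n_\alpha$; (A2) $f_2\in C([0,T],\mathbb{R}^{|\beta|-n_\beta})$; (A3) $f_{\gamma_k}\in C^{\gamma_k}([0,T],\mathbb{R}^{\gamma_k})$ for $k=1,\dots,n_\gamma$. Put $\nu_\alpha=\max_k\alpha_k$, $\nu_\gamma=\max_k\gamma_k$. Expressions such as $N_\alpha^if_1^{(i)}$ and $N_\gamma^i f_3^{(i)}$ are read blockwise, the block $N_{\alpha_k}^if_{\alpha_k}^{(i)}$ being $0$ for $i\ge\alpha_k$ (where $N_{\alpha_k}^i=0$), and similarly for $\gamma$. $M_\beta=\operatorname{diag}(e_{\beta_1,1},\dots,e_{\beta_{n_\beta},1})\in\mathbb{R}^{|\beta|\times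 n_\beta}$, where $e_{j,1}=(1,0,\dots,0)^\top\in\mathbb{R}^j$; $M_{\overline\beta}=\operatorname{diag}(e_{\beta_1-1,1},\dots,e_{\beta_{n_\beta}-1,1})\in\mathbb{R}^{(|\beta|-n_\beta)\times n_\beta}$, where an index $k$ with $\beta_k=1$ contributes a zero column and no rows. For $\widetilde\varphi\in C([0,T],\mathbb{R}^{n_\beta})$ and $|\beta|>n_\beta$, $$\widetilde h_\beta(t;\widetilde\varphi(t))=M_\beta\widetilde\varphi(t)+\int_0^t e^{N_\beta(t-s)}L_\beta^\top\big[f_2(s)+M_{\overline\beta}\widetilde\varphi(s)\big]ds .$$ $Q\in\mathbb{R}^{l\times(n_0+|\beta|-n_\beta)}$ is $Q=[\,B_0+C_0e^{A_0T},\ (B_2+C_2e^{N_\beta T})L_\beta^\top\,]$ if $|\beta|>n_\beta$, and $Q=B_0+C_0e^{A_0T}$ if $|\beta|=n_\beta$. $\widehat d=d-\bar d_0-\bar d_1-\bar d_2-\bar d_3$, where $\bar d_0=C_0\int_0^Te^{A_0(T-s)}f_0(s)ds$; $\bar d_1=-\sum_{i=0}^{\nu_\alpha-1}\big(B_1N_\alpha^if_1^{(i)}(0)+C_1N_\alpha^if_1^{(i)}(T)\big)$; $\bar d_2=B_2M_\beta\widetilde\varphi(0)+C_2\widetilde h_\beta(T;\widetilde\varphi(T))$ if $|\beta|>n_\beta$, and $\bar d_2=B_2\widetilde\varphi(0)+C_2\widetilde\varphi(T)$ if $|\beta|=n_\beta$; $\bar d_3=-\sum_{i=0}^{\nu_\gamma-1}\big(B_3K_\gamma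 N_\gamma^if_3^{(i)}(0)+C_3K_\gamma N_\gamma^if_3^{(i)}(T)\big)$ if $|\gamma|>n_\gamma$, and $\bar d_3=0$ if $|\gamma|=n_\gamma$. $P_0=[\,I_{n_0}\ \ 0_{n_0\times(|\beta|-n_\beta)}\,]$, $P_2=[\,0_{(|\beta|-n_\beta)\times n_0}\ \ I_{|\beta|-n_\beta}\,]$.
   Formalization: Literally false for fixed φ̃, since (b) depends on φ̃; proved instead: a solution with free part φ̃ exists iff φ̃ is C¹ and (a), (b) hold; (a), (b) for any continuous φ̃ give solvability; every solution satisfies (a), and (b) and the formula for some φ̃. *)

theory Defs
  imports "HOL-Analysis.Analysis" "Jordan_Normal_Form.Matrix"
begin

(* Vectors and matrices are those of Jordan_Normal_Form.Matrix: their dimensions are values and may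
   be 0, so 0 x k blocks and absent blocks need no special treatment. *)

unbundle no vec_syntax
hide_type (open) Finite_Cartesian_Product.vec
hide_const (open) Finite_Cartesian_Product.vec Finite_Cartesian_Product.row
  Finite_Cartesian_Product.mat

section \<open>Calculus for vector-valued functions on a compact interval\<close>

(* i-th derivative on [0,T], one-sided at 0 and T; meaningful only for t in [0,T]. *)
definition nth_deriv :: "real \<Rightarrow> nat \<Rightarrow> (real \<Rightarrow> real) \<Rightarrow> real \<Rightarrow> real" where
  "nth_deriv T i g = ((\<lambda>h t. vector_derivative h (at t within {0..T})) ^^ i) g"

definition Ck :: "nat \<Rightarrow> real \<Rightarrow> (real \<Rightarrow> real) \<Rightarrow> bool" where
  "Ck k T g \<longleftrightarrow>
     (\<forall>i<k. \<forall>t\<in>{0..T}.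
        (nth_deriv T i g has_real_derivative nth_deriv T (Suc i) g t) (at t within {0..T})) \<and>
     continuous_on {0..T} (nth_deriv T k g)"

(* g is in C^k([0,T], R^p) *)
definition Ck_vec :: "nat \<Rightarrow> real \<Rightarrow> nat \<Rightarrow> (real \<Rightarrow> real vec) \<Rightarrow> bool" where
  "Ck_vec k T p g \<longleftrightarrow>
     (\<forall>t\<in>{0..T}. g t \<in> carrier_vec p) \<and> (\<forall>j<p. Ck k T (\<lambda>t. g t $ j))"

(* Total: where a component is not i times differentiable the entry is an unspecified real, which a
   zero entry of a matrix such as N_a^i still annihilates. So N_a^i g^(i) is read blockwise. *)
definition deriv_vec :: "real \<Rightarrow> nat \<Rightarrow> (real \<Rightarrow> real vec) \<Rightarrow> real \<Rightarrow> real vec" where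
  "deriv_vec T i g t = vec (dim_vec (g t)) (\<lambda>j. nth_deriv T i (\<lambda>s. g s $ j) t)"

definition integral_vec :: "nat \<Rightarrow> real \<Rightarrow> real \<Rightarrow> (real \<Rightarrow> real vec) \<Rightarrow> real vec" where
  "integral_vec p a b g = vec p (\<lambda>j. integral {a..b} (\<lambda>s. g s $ j))"

definition sum_vec :: "nat \<Rightarrow> (nat \<Rightarrow> real vec) \<Rightarrow> nat \<Rightarrow> real vec" where
  "sum_vec p v r = vec p (\<lambda>j. \<Sum>i<r. v i $ j)"

definition mat_exp :: "real mat \<Rightarrow> real mat" where
  "mat_exp M = mat (dim_row M) (dim_row M) (\<lambda>(i,j). \<Sum>k. (M ^\<^sub>m k) $$ (i,j) / fact k)"

section \<open>Blocks of vectors and matrices\<close>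

definition subvec :: "real vec \<Rightarrow> nat \<Rightarrow> nat \<Rightarrow> real vec" where
  "subvec v a p = vec p (\<lambda>i. v $ (a + i))"

definition col_block :: "real mat \<Rightarrow> nat \<Rightarrow> nat \<Rightarrow> real mat" where
  "col_block M a p = mat (dim_row M) p (\<lambda>(i,j). M $$ (i, a + j))"

definition append_cols :: "real mat \<Rightarrow> real mat \<Rightarrow> real mat" where
  "append_cols M N = four_block_mat M N (0\<^sub>m 0 (dim_col M)) (0\<^sub>m 0 (dim_col N))"

(* k-th block (counted from 0) of a vector partitioned according to the multi-index a *)
definition block :: "nat list \<Rightarrow> nat \<Rightarrow> real vec \<Rightarrow> real vec" where
  "block a k v = subvec v (sum_list (take k a)) (a ! k)"

section \<open>Canonical blocks of the quasi-Kronecker form\<close>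

definition N_block :: "nat \<Rightarrow> real mat" where
  "N_block k = mat k k (\<lambda>(i,j). if i = Suc j then 1 else 0)"

definition K_block :: "nat \<Rightarrow> real mat" where
  "K_block k = mat (k - 1) k (\<lambda>(i,j). if i = j then 1 else 0)"

definition L_block :: "nat \<Rightarrow> real mat" where
  "L_block k = mat (k - 1) k (\<lambda>(i,j). if j = Suc i then 1 else 0)"

(* the first unit vector of R^k as a column; a 0 x 1 matrix for k = 0 *)
definition e1_block :: "nat \<Rightarrow> real mat" where
  "e1_block k = mat k 1 (\<lambda>(i,j). if i = 0 then 1 else 0)"

(* diag_block_mat places rectangular blocks corner to corner, so a 0 x 1 block contributes a zero
   column and no row. *)
definition N_mat :: "nat list \<Rightarrow> real mat" where
  "N_mat a = diag_block_mat (map N_block a)"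

definition K_mat :: "nat list \<Rightarrow> real mat" where
  "K_mat a = diag_block_mat (map K_block a)"

definition L_mat :: "nat list \<Rightarrow> real mat" where
  "L_mat a = diag_block_mat (map L_block a)"

definition M_mat :: "nat list \<Rightarrow> real mat" where
  "M_mat a = diag_block_mat (map e1_block a)"

definition Mbar_mat :: "nat list \<Rightarrow> real mat" where
  "Mbar_mat a = diag_block_mat (map (\<lambda>k. e1_block (k - 1)) a)"

(* 0 for the empty multi-index *)
definition max_index :: "nat list \<Rightarrow> nat" where
  "max_index a = Max (insert 0 (set a))"

section \<open>Generalized inverses and ranges\<close>

definition gen_inverse :: "real mat \<Rightarrow> real mat \<Rightarrow> bool" where
  "gen_inverse M G \<longleftrightarrow> G \<in> carrier_mat (dim_col M) (dim_row M) \<and> M * G * M = M"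

definition mat_range :: "real mat \<Rightarrow> real vec set" where
  "mat_range M = {M *\<^sub>v v | v. v \<in> carrier_vec (dim_col M)}"

section \<open>The boundary value problem\<close>

definition bvp_solution :: "real mat \<Rightarrow> real mat \<Rightarrow> (real \<Rightarrow> real vec) \<Rightarrow> real mat \<Rightarrow> real mat \<Rightarrow>
    real vec \<Rightarrow> real \<Rightarrow> (real \<Rightarrow> real vec) \<Rightarrow> bool" where
  "bvp_solution E A f B C d T x \<longleftrightarrow>
     Ck_vec 1 T (dim_col E) x \<and>
     (\<forall>t\<in>{0<..<T}. E *\<^sub>v deriv_vec T 1 x t = A *\<^sub>v x t + f t) \<and>
     B *\<^sub>v x 0 + C *\<^sub>v x T = d"

(* The parameter phi of the solution formula is the underdetermined part of x: with
   V^{-1} x = (x0, x1, x2, x3), the differential equation leaves the leading entry of every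
   beta-block of x2 free, and x2 = M_beta phi + L_beta^T y with y = L_beta x2, so that these entries
   form the vector phi = M_beta^T x2. Since phi enters x2 undifferentiated, a C^1 solution can have the
   free part phi only if phi is itself C^1. *)
definition has_free_part :: "real mat \<Rightarrow> nat \<Rightarrow> nat list \<Rightarrow> nat list \<Rightarrow> nat list \<Rightarrow> real \<Rightarrow>
    (real \<Rightarrow> real vec) \<Rightarrow> (real \<Rightarrow> real vec) \<Rightarrow> bool" where
  "has_free_part V n0 \<alpha> \<beta> \<gamma> T \<phi> x \<longleftrightarrow>
     (\<forall>t\<in>{0..T}. \<exists>x0 x1 x2 x3.
        x0 \<in> carrier_vec n0 \<and> x1 \<in> carrier_vec (sum_list \<alpha>) \<and> x2 \<in> carrier_vec (sum_list \<beta>) \<and>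
        x3 \<in> carrier_vec (sum_list \<gamma> - length \<gamma>) \<and>
        x t = V *\<^sub>v (x0 @\<^sub>v x1 @\<^sub>v x2 @\<^sub>v x3) \<and>
        transpose_mat (M_mat \<beta>) *\<^sub>v x2 = \<phi> t)"

end

theory Submission
  imports Defs
begin

text \<open>
The quasi-Kronecker form decouples the equation into four blocks.

\<^item> The regular block $\dot x_0 = A_0 x_0 + f_0$ is solved by variation of constants.

\<^item> In the block $N_\alpha \dot x_1 = x_1 + f_1$ every component determines the next one by a
differentiation, so the solution is unique and involves derivatives of $f_1$ only.

\<^item> In the block $L_\beta \dot x_2 = K_\beta x_2 + f_2$ the leading entry of each sub-block is free.
With $x_2 = M_\beta \varphi + z$ and $z = L_\beta^T L_\beta x_2$, the identities
$L_\beta^T K_\beta = N_\beta$ and $K_\beta M_\beta = M_{\bar\beta}$ turn it into the ordinary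
differential equation $\dot z = N_\beta z + L_\beta^T (f_2 + M_{\bar\beta} \varphi)$.

\<^item> For the block $L_\gamma^T \dot x_3 = K_\gamma^T x_3 + f_3$, the vector $K_\gamma^T x_3$ solves an equation
of the second type, and the condition (a) says that the last entries of that solution vanish, i.e.
that it lies in the range of $K_\gamma^T$.

Inserting the four representations into the boundary condition gives $Q v = \hat d$ for the initial
values $v$ of the two differential equations. For a merely continuous $\varphi$ only the endpoint
values and finitely many moments of $\varphi$ enter $\hat d$, and a $C^1$ function with the same
data exists.
\<close>

section \<open>Calculus for vector-valued functions\<close>

text \<open>The vector \<open>dhat \<phi>\<close> depends on the free part, so a boundary value
  problem can be solvable although (b) fails for a prescribed \<open>\<phi>\<close>: a different
  free part may be the one that fits. The equivalence is therefore proved for solutions whose free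
  part is the given \<open>\<phi>\<close>, and for an arbitrary solution the matching
  \<open>\<phi>\<close> is read off from its third component. That \<open>\<phi>\<close> inherits
  C^1 regularity from the solution, so one that is only continuous never is a free part, and
  existence from (a) and (b) has to pass through a smooth substitute. A substitute exists because
  \<open>\<phi>\<close> reaches \<open>dhat\<close> only through \<open>h\<close> at 0 and T, that
  is, through its end values and its integrals against fixed smooth kernels. Linear interpolation
  reproduces the end values, and a correction with the factor s(T - s) adjusts the integrals without
  disturbing them. The differential equation is given on the open interval only, while the boundary
  condition sits at the end points; continuity of the derivative on [0,T] closes this gap. Absent
  blocks are vectors of length 0, so one uniform formula \<open>X\<close> covers all case
  distinctions of the representation.\<close>

text \<open>A relation that carries the derivative as an explicit function can be added, multiplied
  by matrices and rewritten pointwise, whereas \<open>deriv_vec\<close> rests on the choice operator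
  \<open>vector_derivative\<close>. \<open>Ck_vec_1_deriv\<close> and
  \<open>vec_deriv_Ck_vec_1\<close> translate between the two.\<close>

definition vec_deriv :: "real \<Rightarrow> nat \<Rightarrow> (real \<Rightarrow> real vec) \<Rightarrow> (real \<Rightarrow> real vec) \<Rightarrow> bool" where
  "vec_deriv T p x x' \<longleftrightarrow> (\<forall>t\<in>{0..T}. x t \<in> carrier_vec p \<and> x' t \<in> carrier_vec p \<and>
     (\<forall>j<p. ((\<lambda>s. x s $ j) has_real_derivative x' t $ j) (at t within {0..T})))"

lemma DERIV_transform_set:
  fixes f g :: "real \<Rightarrow> real"
  assumes "t \<in> S" "\<And>s. s \<in> S \<Longrightarrow> g s = f s" "(f has_real_derivative D) (at t within S)"
  shows "(g has_real_derivative D) (at t within S)"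
  using has_derivative_transform[OF assms(1,2)] assms(3) by (simp add: has_field_derivative_def)

lemma nth_deriv_0 [simp]: "nth_deriv T 0 g = g"
  by (simp add: nth_deriv_def)

lemma nth_deriv_Suc: "nth_deriv T (Suc i) g t = vector_derivative (nth_deriv T i g) (at t within {0..T})"
  by (simp add: nth_deriv_def)

text \<open>The chosen value of \<open>vector_derivative\<close> is \<open>D\<close> because
  \<open>T > 0\<close> makes every point of the interval a limit point of it, so that even the
  one-sided derivatives at the ends are unique.\<close>

lemma nth_deriv_SucI:
  assumes "T > 0" "t \<in> {0..T}" "(nth_deriv T i g has_real_derivative D) (at t within {0..T})"
  shows "nth_deriv T (Suc i) g t = D"
proof -
  have "at t within {0..T} \<noteq> bot"
    using assms by (simp add: trivial_limit_within islimpt_Icc)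
  then show ?thesis
    using assms(3) unfolding nth_deriv_Suc has_real_derivative_iff_has_vector_derivative
    by (rule vector_derivative_within)
qed

lemma Ck_vec_0_iff:
  "Ck_vec 0 T p g \<longleftrightarrow> (\<forall>t\<in>{0..T}. g t \<in> carrier_vec p) \<and> (\<forall>j<p. continuous_on {0..T} (\<lambda>t. g t $ j))"
  by (simp add: Ck_vec_def Ck_def)

lemma Ck_vec_carrier: "Ck_vec k T p g \<Longrightarrow> t \<in> {0..T} \<Longrightarrow> g t \<in> carrier_vec p"
  by (simp add: Ck_vec_def)

lemma Ck_continuous:
  assumes "Ck k T g" "i \<le> k" shows "continuous_on {0..T} (nth_deriv T i g)"
proof (cases "i < k")
  case True
  then show ?thesis using assms
    by (auto simp: Ck_def intro!: DERIV_continuous_on)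
qed (use assms in \<open>auto simp: Ck_def\<close>)

lemma Ck_deriv:
  "Ck k T g \<Longrightarrow> i < k \<Longrightarrow> t \<in> {0..T} \<Longrightarrow>
   (nth_deriv T i g has_real_derivative nth_deriv T (Suc i) g t) (at t within {0..T})"
  by (auto simp: Ck_def)

lemma vec_deriv_carrier:
  assumes "vec_deriv T p x x'" "t \<in> {0..T}"
  shows "x t \<in> carrier_vec p" "x' t \<in> carrier_vec p"
  using assms by (auto simp: vec_deriv_def)

lemma vec_deriv_entry:
  "vec_deriv T p x x' \<Longrightarrow> t \<in> {0..T} \<Longrightarrow> j < p \<Longrightarrow>
   ((\<lambda>s. x s $ j) has_real_derivative x' t $ j) (at t within {0..T})"
  by (auto simp: vec_deriv_def)

lemma vec_deriv_cont: "vec_deriv T p x x' \<Longrightarrow> Ck_vec 0 T p x"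
  unfolding Ck_vec_0_iff by (auto simp: vec_deriv_def intro!: DERIV_continuous_on)

lemma Ck_vec_1_deriv:
  assumes "Ck_vec 1 T p x"
  shows "vec_deriv T p x (deriv_vec T 1 x)" "Ck_vec 0 T p (deriv_vec T 1 x)"
proof -
  have c: "x t \<in> carrier_vec p" if "t \<in> {0..T}" for t using assms that by (auto simp: Ck_vec_def)
  have k: "Ck 1 T (\<lambda>t. x t $ j)" if "j < p" for j using assms that by (auto simp: Ck_vec_def)
  show "vec_deriv T p x (deriv_vec T 1 x)"
    unfolding vec_deriv_def
  proof (intro ballI conjI allI impI)
    fix t j assume t: "t \<in> {0..T}" and j: "j < p"
    show "((\<lambda>s. x s $ j) has_real_derivative deriv_vec T 1 x t $ j) (at t within {0..T})"
      using Ck_deriv[OF k[OF j], of 0, OF _ t] c[OF t] j by (simp add: deriv_vec_def)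
  qed (use c in \<open>auto simp: deriv_vec_def\<close>)
  have "continuous_on {0..T} (\<lambda>t. deriv_vec T 1 x t $ j)" if "j < p" for j
    using Ck_continuous[OF k[OF that] order_refl]
  proof (rule continuous_on_eq)
    fix s assume "s \<in> {0..T}"
    from carrier_vecD[OF c[OF this]] \<open>j < p\<close>
    show "nth_deriv T 1 (\<lambda>t. x t $ j) s = deriv_vec T 1 x s $ j" by (simp add: deriv_vec_def)
  qed
  then show "Ck_vec 0 T p (deriv_vec T 1 x)"
    unfolding Ck_vec_0_iff using c by (auto simp: deriv_vec_def)
qed

text \<open>Candidate solutions are built together with an explicit derivative; this turns such a
  pair into the regularity and the derivative that \<open>bvp_solution\<close> asks for.\<close>

lemma vec_deriv_Ck_vec_1:
  assumes T: "T > 0" and x: "vec_deriv T p x x'" and c: "Ck_vec 0 T p x'"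
  shows "Ck_vec 1 T p x" "t \<in> {0..T} \<Longrightarrow> deriv_vec T 1 x t = x' t"
proof -
  have e: "nth_deriv T 1 (\<lambda>s. x s $ j) t = x' t $ j" if "t \<in> {0..T}" "j < p" for t j
    using nth_deriv_SucI[OF T that(1), of 0] vec_deriv_entry[OF x that] by simp
  show "Ck_vec 1 T p x"
    unfolding Ck_vec_def
  proof (intro conjI ballI allI impI)
    fix j assume j: "j < p"
    have "continuous_on {0..T} (nth_deriv T 1 (\<lambda>s. x s $ j))"
      using c j e by (auto simp: Ck_vec_0_iff intro: continuous_on_eq)
    then show "Ck 1 T (\<lambda>t. x t $ j)"
      using vec_deriv_entry[OF x _ j] e[OF _ j] by (auto simp: Ck_def)
  qed (use vec_deriv_carrier[OF x] in auto)
  show "deriv_vec T 1 x t = x' t" if t: "t \<in> {0..T}"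
    using e[OF t] vec_deriv_carrier[OF x t] by (auto simp: deriv_vec_def)
qed

lemma Ck_vec_1_imp_0: "Ck_vec 1 T p x \<Longrightarrow> Ck_vec 0 T p x"
  using Ck_vec_1_deriv(1) vec_deriv_cont by blast

lemma mult_mat_vec_index:
  "A \<in> carrier_mat r p \<Longrightarrow> v \<in> carrier_vec p \<Longrightarrow> i < r \<Longrightarrow> (A *\<^sub>v v) $ i = (\<Sum>j<p. A $$ (i,j) * v $ j)"
  by (auto simp: scalar_prod_def atLeast0LessThan)

lemma vec_deriv_mult:
  assumes A: "A \<in> carrier_mat r p" and x: "vec_deriv T p x x'"
  shows "vec_deriv T r (\<lambda>t. A *\<^sub>v x t) (\<lambda>t. A *\<^sub>v x' t)"
  unfolding vec_deriv_def
proof (intro ballI conjI allI impI)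
  fix t j assume t: "t \<in> {0..T}" and j: "j < r"
  have "((\<lambda>s. \<Sum>i<p. A $$ (j,i) * x s $ i) has_real_derivative (\<Sum>i<p. A $$ (j,i) * x' t $ i)) (at t within {0..T})"
    by (intro DERIV_sum DERIV_cmult vec_deriv_entry[OF x t]) auto
  moreover have "(A *\<^sub>v x' t) $ j = (\<Sum>i<p. A $$ (j,i) * x' t $ i)"
    by (rule mult_mat_vec_index[OF A vec_deriv_carrier(2)[OF x t] j])
  ultimately have D: "((\<lambda>s. \<Sum>i<p. A $$ (j,i) * x s $ i) has_real_derivative (A *\<^sub>v x' t) $ j) (at t within {0..T})"
    by simp
  show "((\<lambda>s. (A *\<^sub>v x s) $ j) has_real_derivative (A *\<^sub>v x' t) $ j) (at t within {0..T})"
    by (rule DERIV_transform_set[OF t _ D]) (rule mult_mat_vec_index[OF A vec_deriv_carrier(1)[OF x] j])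
qed (use A x in \<open>auto simp: vec_deriv_def\<close>)

lemma Ck_vec_0_mult:
  assumes A: "A \<in> carrier_mat r p" and x: "Ck_vec 0 T p x"
  shows "Ck_vec 0 T r (\<lambda>t. A *\<^sub>v x t)"
  unfolding Ck_vec_0_iff
proof (intro ballI conjI allI impI)
  fix j assume j: "j < r"
  have "continuous_on {0..T} (\<lambda>s. \<Sum>i<p. A $$ (j,i) * x s $ i)"
    using x by (intro continuous_intros) (auto simp: Ck_vec_0_iff)
  then show "continuous_on {0..T} (\<lambda>s. (A *\<^sub>v x s) $ j)"
    by (rule continuous_on_eq) (use mult_mat_vec_index[OF A _ j] x in \<open>auto simp: Ck_vec_0_iff\<close>)
qed (use A x in \<open>auto simp: Ck_vec_0_iff\<close>)

lemma vec_deriv_add: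
  assumes x: "vec_deriv T p x x'" and y: "vec_deriv T p y y'"
  shows "vec_deriv T p (\<lambda>t. x t + y t) (\<lambda>t. x' t + y' t)"
  unfolding vec_deriv_def
proof (intro ballI conjI allI impI)
  fix t j assume t: "t \<in> {0..T}" and j: "j < p"
  have D: "((\<lambda>s. x s $ j + y s $ j) has_real_derivative (x' t + y' t) $ j) (at t within {0..T})"
    using DERIV_add[OF vec_deriv_entry[OF x t j] vec_deriv_entry[OF y t j]] vec_deriv_carrier[OF y t] j
    by simp
  show "((\<lambda>s. (x s + y s) $ j) has_real_derivative (x' t + y' t) $ j) (at t within {0..T})"
  proof (rule DERIV_transform_set[OF t _ D])
    fix s assume "s \<in> {0..T}"
    from carrier_vecD[OF vec_deriv_carrier(1)[OF y this]] j
    show "(x s + y s) $ j = x s $ j + y s $ j" by simp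
  qed
qed (use x y in \<open>auto simp: vec_deriv_def\<close>)

lemma vec_deriv_diff:
  assumes x: "vec_deriv T p x x'" and y: "vec_deriv T p y y'"
  shows "vec_deriv T p (\<lambda>t. x t - y t) (\<lambda>t. x' t - y' t)"
  unfolding vec_deriv_def
proof (intro ballI conjI allI impI)
  fix t j assume t: "t \<in> {0..T}" and j: "j < p"
  have D: "((\<lambda>s. x s $ j - y s $ j) has_real_derivative (x' t - y' t) $ j) (at t within {0..T})"
    using DERIV_diff[OF vec_deriv_entry[OF x t j] vec_deriv_entry[OF y t j]] vec_deriv_carrier[OF y t] j
    by simp
  show "((\<lambda>s. (x s - y s) $ j) has_real_derivative (x' t - y' t) $ j) (at t within {0..T})"
  proof (rule DERIV_transform_set[OF t _ D])
    fix s assume "s \<in> {0..T}"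
    from carrier_vecD[OF vec_deriv_carrier(1)[OF y this]] j
    show "(x s - y s) $ j = x s $ j - y s $ j" by simp
  qed
qed (use x y in \<open>auto simp: vec_deriv_def\<close>)

lemma Ck_vec_0_add:
  assumes "Ck_vec 0 T p x" "Ck_vec 0 T p y" shows "Ck_vec 0 T p (\<lambda>t. x t + y t)"
  unfolding Ck_vec_0_iff
proof (intro ballI conjI allI impI)
  fix j assume j: "j < p"
  show "continuous_on {0..T} (\<lambda>s. (x s + y s) $ j)"
  proof (rule continuous_on_eq[where f = "\<lambda>s. x s $ j + y s $ j"])
    show "continuous_on {0..T} (\<lambda>s. x s $ j + y s $ j)"
      using assms j by (intro continuous_intros) (simp_all add: Ck_vec_0_iff)
    show "x s $ j + y s $ j = (x s + y s) $ j" if "s \<in> {0..T}" for s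
      using carrier_vecD[OF Ck_vec_carrier[OF assms(2) that]] j by simp
  qed
qed (use assms in \<open>auto simp: Ck_vec_0_iff\<close>)

lemma vec_deriv_append:
  assumes x: "vec_deriv T p x x'" and y: "vec_deriv T r y y'"
  shows "vec_deriv T (p + r) (\<lambda>t. x t @\<^sub>v y t) (\<lambda>t. x' t @\<^sub>v y' t)"
  unfolding vec_deriv_def
proof (intro ballI conjI allI impI)
  fix t j assume t: "t \<in> {0..T}" and j: "j < p + r"
  have dims: "dim_vec (x s) = p" "dim_vec (y s) = r" "dim_vec (x' s) = p" "dim_vec (y' s) = r"
    if "s \<in> {0..T}" for s
    using vec_deriv_carrier[OF x that] vec_deriv_carrier[OF y that] by auto
  show "((\<lambda>s. (x s @\<^sub>v y s) $ j) has_real_derivative (x' t @\<^sub>v y' t) $ j) (at t within {0..T})"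
  proof (cases "j < p")
    case True
    have "((\<lambda>s. (x s @\<^sub>v y s) $ j) has_real_derivative x' t $ j) (at t within {0..T})"
      by (rule DERIV_transform_set[OF t _ vec_deriv_entry[OF x t True]]) (use True dims in simp)
    then show ?thesis using True dims t by simp
  next
    case False
    then have j': "j - p < r" using j by auto
    have "((\<lambda>s. (x s @\<^sub>v y s) $ j) has_real_derivative y' t $ (j - p)) (at t within {0..T})"
      by (rule DERIV_transform_set[OF t _ vec_deriv_entry[OF y t j']]) (use False j dims in simp)
    then show ?thesis using False dims t j by simp
  qed
qed (use x y in \<open>auto simp: vec_deriv_def\<close>)

lemma Ck_vec_0_append:
  assumes "Ck_vec 0 T p x" "Ck_vec 0 T r y" shows "Ck_vec 0 T (p + r) (\<lambda>t. x t @\<^sub>v y t)"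
  unfolding Ck_vec_0_iff
proof (intro ballI conjI allI impI)
  fix j assume j: "j < p + r"
  show "continuous_on {0..T} (\<lambda>s. (x s @\<^sub>v y s) $ j)"
  proof (rule continuous_on_eq[where f = "if j < p then (\<lambda>s. x s $ j) else (\<lambda>s. y s $ (j - p))"])
    show "continuous_on {0..T} (if j < p then (\<lambda>s. x s $ j) else (\<lambda>s. y s $ (j - p)))"
      using assms j by (simp add: Ck_vec_0_iff)
    show "(if j < p then (\<lambda>s. x s $ j) else (\<lambda>s. y s $ (j - p))) s = (x s @\<^sub>v y s) $ j"
      if "s \<in> {0..T}" for s
      using carrier_vecD[OF Ck_vec_carrier[OF assms(1) that]]
        carrier_vecD[OF Ck_vec_carrier[OF assms(2) that]] j by simp
  qed
qed (use assms in \<open>auto simp: Ck_vec_0_iff\<close>)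

lemma subvec_carrier [simp]: "subvec v a p \<in> carrier_vec p"
  by (simp add: subvec_def)

lemma vec_deriv_subvec:
  assumes x: "vec_deriv T r x x'" and le: "a + p \<le> r"
  shows "vec_deriv T p (\<lambda>t. subvec (x t) a p) (\<lambda>t. subvec (x' t) a p)"
  unfolding vec_deriv_def
proof (intro ballI conjI allI impI)
  fix t j assume t: "t \<in> {0..T}" and j: "j < p"
  show "((\<lambda>s. subvec (x s) a p $ j) has_real_derivative subvec (x' t) a p $ j) (at t within {0..T})"
    using vec_deriv_entry[OF x t, of "a + j"] j le by (simp add: subvec_def)
qed auto

lemma Ck_vec_0_subvec:
  assumes x: "Ck_vec 0 T r x" and le: "a + p \<le> r"
  shows "Ck_vec 0 T p (\<lambda>t. subvec (x t) a p)"
  using x le unfolding Ck_vec_0_iff by (auto simp: subvec_def)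

text \<open>Carries the differential equation from the open interval, where it is assumed, to the
  end points, where initial values and boundary data are taken.\<close>

lemma Ck_vec_0_eq_closure:
  assumes T: "T > 0" and g: "Ck_vec 0 T p g" and h: "Ck_vec 0 T p h"
    and eq: "\<And>t. t \<in> {0<..<T} \<Longrightarrow> g t = h t" and t: "t \<in> {0..T}"
  shows "g t = h t"
proof -
  have "g t $ j = h t $ j" if j: "j < p" for j
  proof -
    have cl: "closure {0<..<T} = {0..T}" using T by simp
    have c: "continuous_on (closure {0<..<T}) (\<lambda>t. g t $ j - h t $ j)"
      unfolding cl using g h j by (intro continuous_intros) (auto simp: Ck_vec_0_iff)
    have "g t $ j - h t $ j = 0"
      by (rule continuous_constant_on_closure[OF c]) (use eq t cl in auto)
    then show ?thesis by simp
  qed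
  then show ?thesis
    using carrier_vecD[OF Ck_vec_carrier[OF g t]] carrier_vecD[OF Ck_vec_carrier[OF h t]] by auto
qed

text \<open>All derivatives are taken within [0,T], so the values outside never matter. Needed
  because free parts and solutions are determined on [0,T] only. The induction needs the previous
  order on the whole interval, not just at \<open>t\<close>.\<close>

lemma nth_deriv_cong:
  assumes "T > 0" "\<And>s. s \<in> {0..T} \<Longrightarrow> g s = h s" "t \<in> {0..T}"
  shows "nth_deriv T i g t = nth_deriv T i h t"
  using assms(3)
proof (induction i arbitrary: t)
  case (Suc i)
  have "(nth_deriv T i g has_vector_derivative D) (at t within {0..T}) \<longleftrightarrow>
        (nth_deriv T i h has_vector_derivative D) (at t within {0..T})" for D
    by (rule has_vector_derivative_cong_ev) (use Suc in \<open>auto simp: eventually_at_filter\<close>)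
  then show ?case by (simp add: nth_deriv_Suc vector_derivative_def)
qed (use assms in auto)

lemma Ck_cong:
  assumes T: "T > 0" and g: "Ck k T g" and eq: "\<And>s. s \<in> {0..T} \<Longrightarrow> g s = h s"
  shows "Ck k T h"
proof -
  have e: "nth_deriv T i g s = nth_deriv T i h s" if "s \<in> {0..T}" for i s
    by (rule nth_deriv_cong[OF T eq that])
  show ?thesis
    unfolding Ck_def
  proof (intro conjI allI impI ballI)
    fix i t assume i: "i < k" and t: "t \<in> {0..T}"
    show "(nth_deriv T i h has_real_derivative nth_deriv T (Suc i) h t) (at t within {0..T})"
      using DERIV_transform_set[OF t _ Ck_deriv[OF g i t], of "nth_deriv T i h"] e t by simp
  next
    show "continuous_on {0..T} (nth_deriv T k h)"
      using Ck_continuous[OF g order_refl] e by (auto intro: continuous_on_eq)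
  qed
qed

lemma Ck_vec_cong:
  assumes "T > 0" "Ck_vec k T p g" "\<And>s. s \<in> {0..T} \<Longrightarrow> g s = h s"
  shows "Ck_vec k T p h"
proof -
  have "Ck k T (\<lambda>t. h t $ j)" if "j < p" for j
    by (rule Ck_cong[where g = "\<lambda>t. g t $ j"]) (use assms that in \<open>auto simp: Ck_vec_def\<close>)
  then show ?thesis using assms(2,3) by (auto simp: Ck_vec_def)
qed

section \<open>The matrix exponential\<close>

lemma mult_mat_zero_vec: "M \<in> carrier_mat r p \<Longrightarrow> M *\<^sub>v 0\<^sub>v p = (0\<^sub>v r :: real vec)"
  by (intro eq_vecI) auto

text \<open>The sum of all absolute entries dominates each column sum, so one more factor costs at
  most this constant. The bound is crude, but geometric growth is all that the exponential series
  needs.\<close>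

lemma pow_mat_entry_bound:
  fixes A :: "real mat"
  assumes A: "A \<in> carrier_mat p p" and ij: "i < p" "j < p"
  shows "\<bar>(A ^\<^sub>m k) $$ (i,j)\<bar> \<le> (\<Sum>r<p. \<Sum>c<p. \<bar>A $$ (r,c)\<bar>) ^ k"
  using ij
proof (induction k arbitrary: j)
  case 0
  then show ?case using A by simp
next
  case (Suc k)
  define K where "K = (\<Sum>r<p. \<Sum>c<p. \<bar>A $$ (r,c)\<bar>)"
  have "(A ^\<^sub>m Suc k) $$ (i,j) = (\<Sum>l<p. (A ^\<^sub>m k) $$ (i,l) * A $$ (l,j))"
    using A Suc.prems by (simp add: scalar_prod_def atLeast0LessThan)
  also have "\<bar>\<dots>\<bar> \<le> (\<Sum>l<p. K ^ k * \<bar>A $$ (l,j)\<bar>)"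
    using Suc.IH[OF Suc.prems(1)] unfolding K_def[symmetric]
    by (intro order_trans[OF sum_abs] sum_mono) (auto simp: abs_mult intro!: mult_right_mono)
  also have "\<dots> = K ^ k * (\<Sum>l<p. \<bar>A $$ (l,j)\<bar>)"
    by (simp add: sum_distrib_left)
  also have "\<dots> \<le> K ^ k * K"
    unfolding K_def using Suc.prems
    by (intro mult_left_mono sum_mono member_le_sum zero_le_power sum_nonneg) auto
  finally show ?case by (simp add: K_def mult.commute)
qed

text \<open>Dominated by the scalar exponential series of the constant in
  \<open>pow_mat_entry_bound\<close> times the absolute value of \<open>t\<close>.\<close>

lemma mat_exp_summable:
  fixes A :: "real mat"
  assumes A: "A \<in> carrier_mat p p" and ij: "i < p" "j < p"
  shows "summable (\<lambda>k. (A ^\<^sub>m k) $$ (i,j) / fact k * t ^ k)"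
proof (rule summable_comparison_test'[of "\<lambda>k. ((\<Sum>r<p. \<Sum>c<p. \<bar>A $$ (r,c)\<bar>) * \<bar>t\<bar>) ^ k /\<^sub>R fact k" 0])
  fix k :: nat
  show "norm ((A ^\<^sub>m k) $$ (i,j) / fact k * t ^ k)
      \<le> ((\<Sum>r<p. \<Sum>c<p. \<bar>A $$ (r,c)\<bar>) * \<bar>t\<bar>) ^ k /\<^sub>R fact k"
    using mult_right_mono[OF pow_mat_entry_bound[OF A ij, of k], of "\<bar>t\<bar> ^ k"]
    by (simp add: abs_mult power_abs power_mult_distrib divide_simps)
qed (rule summable_exp_generic)

lemma pow_mat_smult:
  fixes A :: "real mat"
  assumes A: "A \<in> carrier_mat p p"
  shows "(t \<cdot>\<^sub>m A) ^\<^sub>m k = t ^ k \<cdot>\<^sub>m (A ^\<^sub>m k)"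
proof (induction k)
  case 0
  show ?case using A by (intro eq_matI) auto
next
  case (Suc k)
  have "(t \<cdot>\<^sub>m A) ^\<^sub>m Suc k = (t ^ k \<cdot>\<^sub>m (A ^\<^sub>m k)) * (t \<cdot>\<^sub>m A)"
    using Suc by simp
  also have "\<dots> = (t ^ k * t) \<cdot>\<^sub>m (A ^\<^sub>m k * A)"
    using A by (intro eq_matI) auto
  finally show ?case by (simp add: mult.commute)
qed

lemma mat_exp_carrier [simp]: "A \<in> carrier_mat p p \<Longrightarrow> mat_exp (t \<cdot>\<^sub>m A) \<in> carrier_mat p p"
  by (auto simp: mat_exp_def)

text \<open>Each entry becomes a scalar power series in \<open>t\<close>, which makes termwise
  differentiation available.\<close>

lemma mat_exp_entry:
  assumes A: "A \<in> carrier_mat p p" and ij: "i < p" "j < p"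
  shows "mat_exp (t \<cdot>\<^sub>m A) $$ (i,j) = (\<Sum>k. (A ^\<^sub>m k) $$ (i,j) / fact k * t ^ k)"
proof -
  have "((t \<cdot>\<^sub>m A) ^\<^sub>m k) $$ (i,j) = t ^ k * (A ^\<^sub>m k) $$ (i,j)" for k
    using A ij by (subst pow_mat_smult[OF A]) auto
  then show ?thesis using A ij by (simp add: mat_exp_def mult.commute)
qed

lemma pow_mat_Suc_left:
  fixes A :: "real mat"
  assumes A: "A \<in> carrier_mat p p"
  shows "A ^\<^sub>m Suc k = A * A ^\<^sub>m k"
proof (induction k)
  case (Suc k)
  have "A ^\<^sub>m Suc (Suc k) = A * A ^\<^sub>m k * A" using Suc by simp
  also have "\<dots> = A * (A ^\<^sub>m k * A)"
    by (rule assoc_mult_mat) (use A in auto)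
  finally show ?case by simp
qed (use A in simp)

lemma mult_mat_index:
  "A \<in> carrier_mat r p \<Longrightarrow> B \<in> carrier_mat p c \<Longrightarrow> i < r \<Longrightarrow> j < c \<Longrightarrow>
   (A * B) $$ (i,j) = (\<Sum>l<p. A $$ (i,l) * B $$ (l,j))"
  by (auto simp: scalar_prod_def atLeast0LessThan)

text \<open>Multiplying the series by \<open>A\<close> on either side raises every power by one, so
  both products have the same entries. Commutation with the exponential and the derivative of the
  exponential are both read off from this common series.\<close>

lemma mat_exp_mult_entry:
  fixes A :: "real mat"
  assumes A: "A \<in> carrier_mat p p" and ij: "i < p" "j < p"
  shows "(A * mat_exp (t \<cdot>\<^sub>m A)) $$ (i,j) = (\<Sum>k. (A ^\<^sub>m Suc k) $$ (i,j) / fact k * t ^ k)"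
    and "(mat_exp (t \<cdot>\<^sub>m A) * A) $$ (i,j) = (\<Sum>k. (A ^\<^sub>m Suc k) $$ (i,j) / fact k * t ^ k)"
proof -
  have P: "A ^\<^sub>m k \<in> carrier_mat p p" for k using A by simp
  have "(A * mat_exp (t \<cdot>\<^sub>m A)) $$ (i,j) =
      (\<Sum>l<p. A $$ (i,l) * (\<Sum>k. (A ^\<^sub>m k) $$ (l,j) / fact k * t ^ k))"
    using ij by (simp add: mult_mat_index[OF A mat_exp_carrier[OF A]] mat_exp_entry[OF A])
  also have "\<dots> = (\<Sum>l<p. \<Sum>k. A $$ (i,l) * ((A ^\<^sub>m k) $$ (l,j) / fact k * t ^ k))"
    by (intro sum.cong refl suminf_mult[symmetric] mat_exp_summable[OF A _ ij(2)]) simp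
  also have "\<dots> = (\<Sum>k. \<Sum>l<p. A $$ (i,l) * ((A ^\<^sub>m k) $$ (l,j) / fact k * t ^ k))"
    by (rule suminf_sum[symmetric], rule summable_mult, rule mat_exp_summable[OF A _ ij(2)]) simp
  also have "\<dots> = (\<Sum>k. (A ^\<^sub>m Suc k) $$ (i,j) / fact k * t ^ k)"
    unfolding pow_mat_Suc_left[OF A] mult_mat_index[OF A P ij]
    by (simp add: sum_distrib_right sum_divide_distrib mult.assoc)
  finally show "(A * mat_exp (t \<cdot>\<^sub>m A)) $$ (i,j) = (\<Sum>k. (A ^\<^sub>m Suc k) $$ (i,j) / fact k * t ^ k)" .
  have "(mat_exp (t \<cdot>\<^sub>m A) * A) $$ (i,j) =
      (\<Sum>l<p. (\<Sum>k. (A ^\<^sub>m k) $$ (i,l) / fact k * t ^ k) * A $$ (l,j))"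
    using ij by (simp add: mult_mat_index[OF mat_exp_carrier[OF A] A] mat_exp_entry[OF A])
  also have "\<dots> = (\<Sum>l<p. \<Sum>k. ((A ^\<^sub>m k) $$ (i,l) / fact k * t ^ k) * A $$ (l,j))"
    by (intro sum.cong refl suminf_mult2 mat_exp_summable[OF A ij(1)]) simp
  also have "\<dots> = (\<Sum>k. \<Sum>l<p. ((A ^\<^sub>m k) $$ (i,l) / fact k * t ^ k) * A $$ (l,j))"
    by (rule suminf_sum[symmetric], rule summable_mult2, rule mat_exp_summable[OF A ij(1)]) simp
  also have "\<dots> = (\<Sum>k. (A ^\<^sub>m Suc k) $$ (i,j) / fact k * t ^ k)"
    unfolding pow_mat.simps mult_mat_index[OF P A ij]
    by (simp add: sum_distrib_left sum_distrib_right sum_divide_distrib mult_ac)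
  finally show "(mat_exp (t \<cdot>\<^sub>m A) * A) $$ (i,j) = (\<Sum>k. (A ^\<^sub>m Suc k) $$ (i,j) / fact k * t ^ k)" .
qed

lemma mat_exp_commute:
  fixes A :: "real mat"
  assumes A: "A \<in> carrier_mat p p"
  shows "mat_exp (t \<cdot>\<^sub>m A) * A = A * mat_exp (t \<cdot>\<^sub>m A)"
  by (rule eq_matI) (use A mat_exp_mult_entry[OF A] carrier_matD[OF mat_exp_carrier[OF A]] in auto)

text \<open>Termwise differentiation multiplies the next coefficient by k+1, and (k+1)/(k+1)! = 1/k!
  leaves the series of \<open>mat_exp_mult_entry\<close>.\<close>

lemma mat_exp_deriv:
  fixes A :: "real mat"
  assumes A: "A \<in> carrier_mat p p" and ij: "i < p" "j < p"
  shows "((\<lambda>t. mat_exp (t \<cdot>\<^sub>m A) $$ (i,j)) has_real_derivative (A * mat_exp (t \<cdot>\<^sub>m A)) $$ (i,j)) (at t within S)"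
proof -
  let ?c = "\<lambda>k. (A ^\<^sub>m k) $$ (i,j) / fact k"
  have "diffs ?c = (\<lambda>k. (A ^\<^sub>m Suc k) $$ (i,j) / fact k)"
    by (simp add: diffs_def fun_eq_iff divide_simps)
  moreover have "((\<lambda>t. \<Sum>k. ?c k * t ^ k) has_real_derivative (\<Sum>k. diffs ?c k * t ^ k)) (at t)"
    by (rule termdiffs_strong_converges_everywhere) (rule mat_exp_summable[OF A ij])
  ultimately show ?thesis
    unfolding mat_exp_entry[OF A ij] mat_exp_mult_entry(1)[OF A ij]
    using has_field_derivative_at_within by fastforce
qed

lemma mat_exp_deriv_scaled:
  fixes A :: "real mat"
  assumes A: "A \<in> carrier_mat p p" and ij: "i < p" "j < p"
    and g: "(g has_real_derivative g') (at t within S)"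
  shows "((\<lambda>t. mat_exp (g t \<cdot>\<^sub>m A) $$ (i,j)) has_real_derivative (A * mat_exp (g t \<cdot>\<^sub>m A)) $$ (i,j) * g') (at t within S)"
  by (rule DERIV_chain2[OF mat_exp_deriv[OF A ij, where S = UNIV] g])

lemma mat_exp_zero:
  assumes A: "A \<in> carrier_mat p p"
  shows "mat_exp (0 \<cdot>\<^sub>m A) = 1\<^sub>m p"
proof (rule eq_matI)
  fix i j assume "i < dim_row (1\<^sub>m p :: real mat)" "j < dim_col (1\<^sub>m p :: real mat)"
  then have ij: "i < p" "j < p" by auto
  have "(\<Sum>k. (A ^\<^sub>m k) $$ (i,j) / fact k * 0 ^ k) = (A ^\<^sub>m 0) $$ (i,j)"
    using powser_zero[of "\<lambda>k. (A ^\<^sub>m k) $$ (i,j) / fact k"] by simp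
  then show "mat_exp (0 \<cdot>\<^sub>m A) $$ (i,j) = 1\<^sub>m p $$ (i,j)"
    unfolding mat_exp_entry[OF A ij] using A ij by simp
qed (use A in \<open>auto simp: mat_exp_def\<close>)

text \<open>The derivative of $e^{-sA} e^{(s+t)A}$ with respect to $s$ vanishes.\<close>

lemma mat_exp_inverse_add:
  fixes A :: "real mat"
  assumes A: "A \<in> carrier_mat p p"
  shows "mat_exp ((- s) \<cdot>\<^sub>m A) * mat_exp ((s + t) \<cdot>\<^sub>m A) = mat_exp (t \<cdot>\<^sub>m A)"
proof -
  define X where "X = (\<lambda>s. mat_exp ((- s) \<cdot>\<^sub>m A))"
  define Y where "Y = (\<lambda>s. mat_exp ((s + t) \<cdot>\<^sub>m A))"
  have X: "X s \<in> carrier_mat p p" and Y: "Y s \<in> carrier_mat p p" for s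
    using A by (auto simp: X_def Y_def)
  have XY: "(X s * Y s) $$ (i,j) = (X 0 * Y 0) $$ (i,j)" if ij: "i < p" "j < p" for i j
  proof -
    have dX: "((\<lambda>s. X s $$ (i,l)) has_real_derivative (A * X s) $$ (i,l) * -1) (at s)" if "l < p" for l s
      unfolding X_def by (rule mat_exp_deriv_scaled[OF A ij(1) that]) (auto intro!: derivative_eq_intros)
    have dY: "((\<lambda>s. Y s $$ (l,j)) has_real_derivative (A * Y s) $$ (l,j) * 1) (at s)" if "l < p" for l s
      unfolding Y_def by (rule mat_exp_deriv_scaled[OF A that ij(2)]) (auto intro!: derivative_eq_intros)
    have "((\<lambda>s. (X s * Y s) $$ (i,j)) has_real_derivative 0) (at s)" for s
    proof -
      have "((\<lambda>s. \<Sum>l<p. X s $$ (i,l) * Y s $$ (l,j)) has_real_derivative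
          (\<Sum>l<p. (A * X s) $$ (i,l) * -1 * Y s $$ (l,j) + (A * Y s) $$ (l,j) * 1 * X s $$ (i,l))) (at s)"
        by (intro DERIV_sum DERIV_mult dX dY) auto
      moreover have "(\<Sum>l<p. (A * X s) $$ (i,l) * -1 * Y s $$ (l,j) + (A * Y s) $$ (l,j) * 1 * X s $$ (i,l)) = 0"
      proof -
        have c: "A * X s = X s * A" unfolding X_def by (rule mat_exp_commute[OF A, symmetric])
        have "(X s * A * Y s) $$ (i,j) = (X s * (A * Y s)) $$ (i,j)"
          using assoc_mult_mat[OF X A Y] by simp
        then show ?thesis
          using mult_mat_index[OF mult_carrier_mat[OF X A] Y ij, of s s]
            mult_mat_index[OF X mult_carrier_mat[OF A Y] ij, of s s]
          by (simp add: c sum.distrib sum_negf sum_subtractf mult.commute)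
      qed
      ultimately show ?thesis by (simp add: mult_mat_index[OF X Y ij])
    qed
    then show ?thesis
      by (intro DERIV_isconst_all[of "\<lambda>s. (X s * Y s) $$ (i,j)"] allI)
  qed
  have "X s * Y s = X 0 * Y 0"
    by (rule eq_matI) (use XY carrier_matD[OF X] carrier_matD[OF Y] in auto)
  also have "\<dots> = mat_exp (t \<cdot>\<^sub>m A)"
    using mat_exp_zero[OF A] mat_exp_carrier[OF A, of t] by (simp add: X_def Y_def)
  finally show ?thesis by (simp add: X_def Y_def)
qed

lemma mat_exp_inverse:
  fixes A :: "real mat"
  assumes A: "A \<in> carrier_mat p p"
  shows "mat_exp ((- s) \<cdot>\<^sub>m A) * mat_exp (s \<cdot>\<^sub>m A) = 1\<^sub>m p"
    and "mat_exp (s \<cdot>\<^sub>m A) * mat_exp ((- s) \<cdot>\<^sub>m A) = 1\<^sub>m p"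
  using mat_exp_inverse_add[OF A, of s 0] mat_exp_inverse_add[OF A, of "- s" 0] mat_exp_zero[OF A]
  by simp_all

text \<open>Splits the convolution kernel into a factor depending on \<open>t\<close> alone and one
  depending on \<open>s\<close> alone.\<close>

lemma mat_exp_diff:
  fixes A :: "real mat"
  assumes A: "A \<in> carrier_mat p p"
  shows "mat_exp ((t - s) \<cdot>\<^sub>m A) = mat_exp (t \<cdot>\<^sub>m A) * mat_exp ((- s) \<cdot>\<^sub>m A)"
  using mat_exp_inverse_add[OF A, of "- t" "t - s"] by simp

section \<open>Variation of constants\<close>

text \<open>Product rule with the exponential factored out, which is possible because it commutes
  with \<open>A\<close>. The case c = 1 produces solutions of the linear equation; the case c = -1
  is the integrating factor in the uniqueness proof.\<close>

lemma vec_deriv_mult_mat_exp: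
  fixes A :: "real mat"
  assumes A: "A \<in> carrier_mat p p" and x: "vec_deriv T p x x'"
  shows "vec_deriv T p (\<lambda>t. mat_exp ((c * t) \<cdot>\<^sub>m A) *\<^sub>v x t)
    (\<lambda>t. mat_exp ((c * t) \<cdot>\<^sub>m A) *\<^sub>v (x' t + c \<cdot>\<^sub>v (A *\<^sub>v x t)))"
  unfolding vec_deriv_def
proof (intro ballI conjI allI impI)
  fix t j assume t: "t \<in> {0..T}" and j: "j < p"
  let ?X = "\<lambda>t. mat_exp ((c * t) \<cdot>\<^sub>m A)"
  have X: "?X t \<in> carrier_mat p p" for t using A by simp
  note xc = vec_deriv_carrier(1)[OF x t] and x'c = vec_deriv_carrier(2)[OF x t]
  have dX: "((\<lambda>s. ?X s $$ (j,l)) has_real_derivative (A * ?X t) $$ (j,l) * c) (at t within {0..T})"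
    if "l < p" for l
    by (rule mat_exp_deriv_scaled[OF A j that]) (auto intro!: derivative_eq_intros)
  have D: "((\<lambda>s. \<Sum>l<p. ?X s $$ (j,l) * x s $ l) has_real_derivative
      (\<Sum>l<p. (A * ?X t) $$ (j,l) * c * x t $ l + x' t $ l * ?X t $$ (j,l))) (at t within {0..T})"
    by (intro DERIV_sum DERIV_mult dX vec_deriv_entry[OF x t]) auto
  have a: "?X t *\<^sub>v (A *\<^sub>v x t) = (A * ?X t) *\<^sub>v x t"
    using mat_exp_commute[OF A] assoc_mult_mat_vec[OF X A xc] by simp
  have "?X t *\<^sub>v (x' t + c \<cdot>\<^sub>v (A *\<^sub>v x t)) = ?X t *\<^sub>v x' t + c \<cdot>\<^sub>v (?X t *\<^sub>v (A *\<^sub>v x t))"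
    using mult_add_distrib_mat_vec[OF X x'c] mult_mat_vec[OF X] A xc by simp
  then have "(?X t *\<^sub>v (x' t + c \<cdot>\<^sub>v (A *\<^sub>v x t))) $ j =
      (\<Sum>l<p. ?X t $$ (j,l) * x' t $ l) + c * (\<Sum>l<p. (A * ?X t) $$ (j,l) * x t $ l)"
    using j mult_mat_vec_index[OF X x'c j] mult_mat_vec_index[OF mult_carrier_mat[OF A X] xc j, of t] A
    unfolding a by simp
  also have "\<dots> = (\<Sum>l<p. (A * ?X t) $$ (j,l) * c * x t $ l + x' t $ l * ?X t $$ (j,l))"
    by (simp add: sum_distrib_left sum.distrib mult_ac)
  finally have e: "(\<Sum>l<p. (A * ?X t) $$ (j,l) * c * x t $ l + x' t $ l * ?X t $$ (j,l)) =
    (?X t *\<^sub>v (x' t + c \<cdot>\<^sub>v (A *\<^sub>v x t))) $ j" ..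
  show "((\<lambda>s. (?X s *\<^sub>v x s) $ j) has_real_derivative (?X t *\<^sub>v (x' t + c \<cdot>\<^sub>v (A *\<^sub>v x t))) $ j) (at t within {0..T})"
    using DERIV_transform_set[OF t mult_mat_vec_index[OF X vec_deriv_carrier(1)[OF x] j] D]
    unfolding e .
qed (auto intro!: mult_mat_vec_carrier mat_exp_carrier[OF A] add_carrier_vec smult_carrier_vec A vec_deriv_carrier[OF x])

lemma Ck_vec_0_mat_exp_mult:
  fixes A :: "real mat"
  assumes A: "A \<in> carrier_mat p p" and g: "Ck_vec 0 T p g"
  shows "Ck_vec 0 T p (\<lambda>t. mat_exp ((c * t) \<cdot>\<^sub>m A) *\<^sub>v g t)"
  unfolding Ck_vec_0_iff
proof (intro conjI ballI allI impI)
  fix j assume j: "j < p"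
  have "continuous_on {0..T} (\<lambda>t. mat_exp ((c * t) \<cdot>\<^sub>m A) $$ (j,l))" if "l < p" for l
    by (rule DERIV_continuous_on, rule mat_exp_deriv_scaled[OF A j that, where g' = c])
      (auto intro!: derivative_eq_intros)
  then have "continuous_on {0..T} (\<lambda>t. \<Sum>l<p. mat_exp ((c * t) \<cdot>\<^sub>m A) $$ (j,l) * g t $ l)"
    using g by (intro continuous_intros) (auto simp: Ck_vec_0_iff)
  then show "continuous_on {0..T} (\<lambda>t. (mat_exp ((c * t) \<cdot>\<^sub>m A) *\<^sub>v g t) $ j)"
  proof (rule continuous_on_eq)
    fix t assume t: "t \<in> {0..T}"
    show "(\<Sum>l<p. mat_exp ((c * t) \<cdot>\<^sub>m A) $$ (j,l) * g t $ l) = (mat_exp ((c * t) \<cdot>\<^sub>m A) *\<^sub>v g t) $ j"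
      by (rule mult_mat_vec_index[symmetric, OF mat_exp_carrier[OF A] Ck_vec_carrier[OF g t] j])
  qed
qed (rule mult_mat_vec_carrier[OF mat_exp_carrier[OF A] Ck_vec_carrier[OF g]])

lemma vec_deriv_const:
  "c \<in> carrier_vec p \<Longrightarrow> vec_deriv T p (\<lambda>t. c) (\<lambda>t. 0\<^sub>v p)"
  by (auto simp: vec_deriv_def)

lemma vec_deriv_integral:
  assumes g: "Ck_vec 0 T p g"
  shows "vec_deriv T p (\<lambda>t. integral_vec p 0 t g) g"
  unfolding vec_deriv_def
proof (intro ballI conjI allI impI)
  fix t j assume "t \<in> {0..T}" "j < p"
  then show "((\<lambda>s. integral_vec p 0 s g $ j) has_real_derivative g t $ j) (at t within {0..T})"
    using g by (simp add: integral_vec_def Ck_vec_0_iff) (rule integral_has_real_derivative, auto)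
qed (use Ck_vec_carrier[OF g] in \<open>auto simp: integral_vec_def\<close>)

lemma integral_vec_mult:
  assumes M: "M \<in> carrier_mat r p" and g: "Ck_vec 0 T p g" and t: "t \<in> {0..T}"
  shows "integral_vec r 0 t (\<lambda>s. M *\<^sub>v g s) = M *\<^sub>v integral_vec p 0 t g"
proof (rule eq_vecI)
  fix j assume "j < dim_vec (M *\<^sub>v integral_vec p 0 t g)"
  then have j: "j < r" using M by simp
  have int: "(\<lambda>s. g s $ l) integrable_on {0..t}" if "l < p" for l
    using g t that by (auto simp: Ck_vec_0_iff intro!: integrable_continuous_real elim!: continuous_on_subset)
  have "integral {0..t} (\<lambda>s. (M *\<^sub>v g s) $ j) = integral {0..t} (\<lambda>s. \<Sum>l<p. M $$ (j,l) * g s $ l)"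
    by (rule integral_cong, rule mult_mat_vec_index[OF M _ j]) (use Ck_vec_carrier[OF g] t in auto)
  also have "\<dots> = (\<Sum>l<p. M $$ (j,l) * integral {0..t} (\<lambda>s. g s $ l))"
    using int integrable_on_cmult_left[OF int] by (subst integral_sum) auto
  finally show "integral_vec r 0 t (\<lambda>s. M *\<^sub>v g s) $ j = (M *\<^sub>v integral_vec p 0 t g) $ j"
    using mult_mat_vec_index[OF M _ j, of "integral_vec p 0 t g"] j by (simp add: integral_vec_def)
qed (use M in \<open>auto simp: integral_vec_def\<close>)

lemma integral_vec_cong:
  "(\<And>s. s \<in> {a..b} \<Longrightarrow> g s = h s) \<Longrightarrow> integral_vec p a b g = integral_vec p a b h"
  unfolding integral_vec_def by (intro eq_vecI) (auto intro!: integral_cong)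

text \<open>In the convolution \<open>t\<close> occurs both as a limit and in the integrand. Once
  the exponential in \<open>t\<close> is pulled out, the remaining integral is an ordinary
  antiderivative.\<close>

lemma convolution_eq:
  fixes A :: "real mat"
  assumes A: "A \<in> carrier_mat p p" and g: "Ck_vec 0 T p g" and t: "t \<in> {0..T}"
  shows "integral_vec p 0 t (\<lambda>s. mat_exp ((t - s) \<cdot>\<^sub>m A) *\<^sub>v g s) =
    mat_exp (t \<cdot>\<^sub>m A) *\<^sub>v integral_vec p 0 t (\<lambda>s. mat_exp ((-1 * s) \<cdot>\<^sub>m A) *\<^sub>v g s)"
proof -
  have "integral_vec p 0 t (\<lambda>s. mat_exp ((t - s) \<cdot>\<^sub>m A) *\<^sub>v g s) =
    integral_vec p 0 t (\<lambda>s. mat_exp (t \<cdot>\<^sub>m A) *\<^sub>v (mat_exp ((-1 * s) \<cdot>\<^sub>m A) *\<^sub>v g s))"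
  proof (rule integral_vec_cong)
    fix s assume "s \<in> {0..t}"
    then have "g s \<in> carrier_vec p" using Ck_vec_carrier[OF g] t by auto
    then show "mat_exp ((t - s) \<cdot>\<^sub>m A) *\<^sub>v g s = mat_exp (t \<cdot>\<^sub>m A) *\<^sub>v (mat_exp ((-1 * s) \<cdot>\<^sub>m A) *\<^sub>v g s)"
      using assoc_mult_mat_vec[OF mat_exp_carrier[OF A] mat_exp_carrier[OF A]]
      by (simp add: mat_exp_diff[OF A])
  qed
  also have "\<dots> = mat_exp (t \<cdot>\<^sub>m A) *\<^sub>v integral_vec p 0 t (\<lambda>s. mat_exp ((-1 * s) \<cdot>\<^sub>m A) *\<^sub>v g s)"
    by (rule integral_vec_mult[OF mat_exp_carrier[OF A] Ck_vec_0_mat_exp_mult[OF A g] t])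
  finally show ?thesis .
qed

lemma integral_vec_carrier [simp]: "integral_vec p a b g \<in> carrier_vec p"
  by (simp add: integral_vec_def)

lemma vec_deriv_cong:
  assumes x: "vec_deriv T p x x'" and "\<And>t. t \<in> {0..T} \<Longrightarrow> y t = x t" "\<And>t. t \<in> {0..T} \<Longrightarrow> y' t = x' t"
  shows "vec_deriv T p y y'"
  unfolding vec_deriv_def
proof (intro ballI conjI allI impI)
  fix t j assume t: "t \<in> {0..T}" and j: "j < p"
  have "((\<lambda>s. y s $ j) has_real_derivative x' t $ j) (at t within {0..T})"
    by (rule DERIV_transform_set[OF t _ vec_deriv_entry[OF x t j]]) (simp only: assms(2))
  then show "((\<lambda>s. y s $ j) has_real_derivative y' t $ j) (at t within {0..T})"
    by (simp only: assms(3)[OF t])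
qed (use assms vec_deriv_carrier[OF x] in auto)

text \<open>By \<open>convolution_eq\<close>, \<open>y\<close> is the exponential times
  \<open>?I\<close>, and the derivative of \<open>?I\<close> is the inhomogeneity multiplied by the
  inverse exponential; the product rule then restores \<open>g\<close>.\<close>

lemma variation_of_constants:
  fixes A :: "real mat"
  assumes A: "A \<in> carrier_mat p p" and g: "Ck_vec 0 T p g" and c: "c \<in> carrier_vec p"
  defines "y \<equiv> \<lambda>t. mat_exp (t \<cdot>\<^sub>m A) *\<^sub>v c + integral_vec p 0 t (\<lambda>s. mat_exp ((t - s) \<cdot>\<^sub>m A) *\<^sub>v g s)"
  shows "vec_deriv T p y (\<lambda>t. A *\<^sub>v y t + g t)" "y 0 = c"
proof -
  let ?I = "\<lambda>t. c + integral_vec p 0 t (\<lambda>s. mat_exp ((-1 * s) \<cdot>\<^sub>m A) *\<^sub>v g s)"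
  have y: "y t = mat_exp (t \<cdot>\<^sub>m A) *\<^sub>v ?I t" if "t \<in> {0..T}" for t
    unfolding y_def convolution_eq[OF A g that]
    using mult_add_distrib_mat_vec[OF mat_exp_carrier[OF A] c integral_vec_carrier] by simp
  have I: "vec_deriv T p ?I (\<lambda>t. 0\<^sub>v p + mat_exp ((-1 * t) \<cdot>\<^sub>m A) *\<^sub>v g t)"
    by (intro vec_deriv_add vec_deriv_const c vec_deriv_integral Ck_vec_0_mat_exp_mult A g)
  show "vec_deriv T p y (\<lambda>t. A *\<^sub>v y t + g t)"
  proof (rule vec_deriv_cong[OF vec_deriv_mult_mat_exp[OF A I, of 1]])
    fix t assume t: "t \<in> {0..T}"
    show "y t = mat_exp ((1 * t) \<cdot>\<^sub>m A) *\<^sub>v ?I t" using y[OF t] by simp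
    let ?X = "mat_exp (t \<cdot>\<^sub>m A)" and ?Y = "mat_exp ((- t) \<cdot>\<^sub>m A)"
    have X: "?X \<in> carrier_mat p p" and Y: "?Y \<in> carrier_mat p p" using A by auto
    have gt: "g t \<in> carrier_vec p" using Ck_vec_carrier[OF g t] .
    have Ic: "?I t \<in> carrier_vec p" using c by simp
    have "?X *\<^sub>v (?Y *\<^sub>v g t + A *\<^sub>v ?I t) = ?X *\<^sub>v (?Y *\<^sub>v g t) + ?X *\<^sub>v (A *\<^sub>v ?I t)"
      by (rule mult_add_distrib_mat_vec[OF X mult_mat_vec_carrier[OF Y gt] mult_mat_vec_carrier[OF A Ic]])
    also have "?X *\<^sub>v (?Y *\<^sub>v g t) = g t"
      using assoc_mult_mat_vec[OF X Y gt] mat_exp_inverse(2)[OF A, of t] gt by simp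
    also have "?X *\<^sub>v (A *\<^sub>v ?I t) = A *\<^sub>v y t"
      using assoc_mult_mat_vec[OF X A Ic] assoc_mult_mat_vec[OF A X Ic] mat_exp_commute[OF A, of t] y[OF t]
      by simp
    finally have "?X *\<^sub>v (?Y *\<^sub>v g t + A *\<^sub>v ?I t) = A *\<^sub>v y t + g t"
      using comm_add_vec[OF gt carrier_vecI[OF trans[OF dim_mult_mat_vec carrier_matD(1)[OF A]]], of "y t"]
      by simp
    then show "A *\<^sub>v y t + g t = mat_exp ((1 * t) \<cdot>\<^sub>m A) *\<^sub>v
        (0\<^sub>v p + mat_exp ((-1 * t) \<cdot>\<^sub>m A) *\<^sub>v g t + 1 \<cdot>\<^sub>v (A *\<^sub>v ?I t))"
      using Y gt by simp
  qed
  show "y 0 = c"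
    using c by (auto simp: y_def mat_exp_zero[OF A] integral_vec_def)
qed

lemma vec_deriv_zero_const:
  assumes x: "vec_deriv T p x (\<lambda>t. 0\<^sub>v p)" and t: "t \<in> {0..T}"
  shows "x t = x 0"
proof (rule eq_vecI)
  have 0: "0 \<in> {0..T}" using t by auto
  fix j assume "j < dim_vec (x 0)"
  then have j: "j < p" using vec_deriv_carrier(1)[OF x 0] by simp
  have "((\<lambda>s. x s $ j) has_real_derivative 0) (at s within {0..T})" if "s \<in> {0..T}" for s
    using vec_deriv_entry[OF x that j] unfolding index_zero_vec(1)[OF j] .
  then obtain k where k: "\<And>s. s \<in> {0..T} \<Longrightarrow> x s $ j = k"
    using has_field_derivative_zero_constant[OF convex_real_interval(5), of 0 T "\<lambda>s. x s $ j"] by blast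
  show "x t $ j = x 0 $ j" unfolding k[OF t] k[OF 0] ..
next
  have "0 \<in> {0..T}" using t by auto
  then show "dim_vec (x t) = dim_vec (x 0)"
    using vec_deriv_carrier(1)[OF x] t by (metis carrier_vecD)
qed

lemma minus_vec_zero_imp_eq:
  fixes v w :: "real vec"
  assumes "v - w = 0\<^sub>v p" "v \<in> carrier_vec p" "w \<in> carrier_vec p"
  shows "v = w"
proof (rule eq_vecI)
  fix j assume j: "j < dim_vec w"
  then have "(v - w) $ j = 0" using assms by simp
  with j show "v $ j = w $ j" using assms(2,3) by simp
qed (use assms in simp)

text \<open>The difference of \<open>y\<close> and the variation-of-constants solution with the same
  initial value solves the homogeneous equation. Multiplied by the inverse exponential it has
  derivative zero, hence keeps its value 0 from the left end.\<close>

lemma linear_ode_unique: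
  fixes A :: "real mat"
  assumes T: "T > 0" and A: "A \<in> carrier_mat p p" and g: "Ck_vec 0 T p g"
    and y: "vec_deriv T p y (\<lambda>t. A *\<^sub>v y t + g t)" and t: "t \<in> {0..T}"
  shows "y t = mat_exp (t \<cdot>\<^sub>m A) *\<^sub>v y 0 + integral_vec p 0 t (\<lambda>s. mat_exp ((t - s) \<cdot>\<^sub>m A) *\<^sub>v g s)"
    (is "_ = ?u t")
proof -
  have 0: "0 \<in> {0..T}" using T by simp
  have c: "y 0 \<in> carrier_vec p" using vec_deriv_carrier(1)[OF y 0] .
  note u = variation_of_constants[OF A g c]
  let ?D = "\<lambda>t. y t - ?u t"
  have D: "vec_deriv T p ?D (\<lambda>t. A *\<^sub>v ?D t)"
  proof (rule vec_deriv_cong[OF vec_deriv_diff[OF y u(1)]])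
    fix t assume t: "t \<in> {0..T}"
    have yt: "y t \<in> carrier_vec p" and ut: "?u t \<in> carrier_vec p" and gt: "g t \<in> carrier_vec p"
      using vec_deriv_carrier(1)[OF y t] vec_deriv_carrier(1)[OF u(1) t] Ck_vec_carrier[OF g t] by auto
    have "A *\<^sub>v ?D t = A *\<^sub>v y t - A *\<^sub>v ?u t"
      by (rule mult_minus_distrib_mat_vec[OF A yt ut])
    also have "\<dots> = (A *\<^sub>v y t + g t) - (A *\<^sub>v ?u t + g t)"
      using A gt by (intro eq_vecI) auto
    finally show "A *\<^sub>v ?D t = (A *\<^sub>v y t + g t) - (A *\<^sub>v ?u t + g t)" .
  qed simp
  let ?E = "\<lambda>t. mat_exp ((-1 * t) \<cdot>\<^sub>m A) *\<^sub>v ?D t"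
  have E: "vec_deriv T p ?E (\<lambda>t. 0\<^sub>v p)"
  proof (rule vec_deriv_cong[OF vec_deriv_mult_mat_exp[OF A D]])
    fix t assume t: "t \<in> {0..T}"
    have "A *\<^sub>v ?D t + -1 \<cdot>\<^sub>v (A *\<^sub>v ?D t) = 0\<^sub>v p"
      using A by (intro eq_vecI) auto
    then show "0\<^sub>v p = mat_exp ((-1 * t) \<cdot>\<^sub>m A) *\<^sub>v (A *\<^sub>v ?D t + -1 \<cdot>\<^sub>v (A *\<^sub>v ?D t))"
      by (simp only: mult_mat_zero_vec[OF mat_exp_carrier[OF A]])
  qed simp
  have "?E t = ?E 0" by (rule vec_deriv_zero_const[OF E t])
  also have "?E 0 = 0\<^sub>v p"
    using u(2) c A mat_exp_zero[OF A] by auto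
  finally have Et: "?E t = 0\<^sub>v p" .
  have Dt: "?D t \<in> carrier_vec p" using vec_deriv_carrier(1)[OF D t] .
  have "?D t = mat_exp (t \<cdot>\<^sub>m A) *\<^sub>v ?E t"
    using assoc_mult_mat_vec[OF mat_exp_carrier[OF A] mat_exp_carrier[OF A] Dt, of t "- t"]
      mat_exp_inverse(2)[OF A, of t] Dt by simp
  also have "\<dots> = 0\<^sub>v p" unfolding Et by (rule mult_mat_zero_vec[OF mat_exp_carrier[OF A]])
  finally have "?D t = 0\<^sub>v p" .
  then show ?thesis
    by (rule minus_vec_zero_imp_eq[OF _ vec_deriv_carrier(1)[OF y t] vec_deriv_carrier(1)[OF u(1) t]])
qed

section \<open>Block diagonal matrices\<close>

text \<open>The blocks are given as \<open>F k\<close> for \<open>k\<close> in an index list, with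
  row and column sizes as functions of \<open>k\<close>. In this form one set of lemmas serves
  square, rectangular and empty blocks.\<close>

lemma diag_block_mat_carrier:
  assumes "\<And>k. k \<in> set ks \<Longrightarrow> F k \<in> carrier_mat (r k) (c k)"
  shows "diag_block_mat (map F ks) \<in> carrier_mat (sum_list (map r ks)) (sum_list (map c ks))"
proof (rule carrier_matI)
  show "dim_row (diag_block_mat (map F ks)) = sum_list (map r ks)"
    "dim_col (diag_block_mat (map F ks)) = sum_list (map c ks)"
    unfolding dim_diag_block_mat map_map o_def using carrier_matD[OF assms]
    by (auto intro!: arg_cong[of _ _ sum_list] map_cong)
qed

lemma diag_block_mat_Cons:
  assumes "\<And>k. k \<in> set ks \<Longrightarrow> F k \<in> carrier_mat (r k) (c k)" "F k \<in> carrier_mat (r k) (c k)"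
  shows "diag_block_mat (map F (k # ks)) = four_block_mat (F k)
    (0\<^sub>m (r k) (sum_list (map c ks))) (0\<^sub>m (sum_list (map r ks)) (c k)) (diag_block_mat (map F ks))"
  using diag_block_mat_carrier[of ks F r c, OF assms(1)] assms(2)
  by (simp add: Let_def)

lemma diag_block_mat_mult:
  assumes "\<And>k. k \<in> set ks \<Longrightarrow> F k \<in> carrier_mat (r k) (p k)"
    and "\<And>k. k \<in> set ks \<Longrightarrow> G k \<in> carrier_mat (p k) (c k)"
  shows "diag_block_mat (map F ks) * diag_block_mat (map G ks) =
    (diag_block_mat (map (\<lambda>k. F k * G k) ks) :: real mat)"
  using assms
proof (induction ks)
  case Nil
  show ?case by (intro eq_matI) auto
next
  case (Cons k ks)
  have F: "F i \<in> carrier_mat (r i) (p i)" and G: "G i \<in> carrier_mat (p i) (c i)"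
    if "i \<in> set (k # ks)" for i
    using Cons.prems that by auto
  have FG: "F i * G i \<in> carrier_mat (r i) (c i)" if "i \<in> set (k # ks)" for i
    by (rule mult_carrier_mat[OF F[OF that] G[OF that]])
  have Fk: "F k \<in> carrier_mat (r k) (p k)" and Gk: "G k \<in> carrier_mat (p k) (c k)"
    using F G by auto
  have dF: "diag_block_mat (map F ks) \<in> carrier_mat (sum_list (map r ks)) (sum_list (map p ks))"
    by (rule diag_block_mat_carrier) (use F in auto)
  have dG: "diag_block_mat (map G ks) \<in> carrier_mat (sum_list (map p ks)) (sum_list (map c ks))"
    by (rule diag_block_mat_carrier) (use G in auto)
  have eF: "diag_block_mat (map F (k # ks)) = four_block_mat (F k) (0\<^sub>m (r k) (sum_list (map p ks)))
      (0\<^sub>m (sum_list (map r ks)) (p k)) (diag_block_mat (map F ks))"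
    by (rule diag_block_mat_Cons) (use F in auto)
  have eG: "diag_block_mat (map G (k # ks)) = four_block_mat (G k) (0\<^sub>m (p k) (sum_list (map c ks)))
      (0\<^sub>m (sum_list (map p ks)) (c k)) (diag_block_mat (map G ks))"
    by (rule diag_block_mat_Cons) (use G in auto)
  have "diag_block_mat (map F (k # ks)) * diag_block_mat (map G (k # ks)) =
      four_block_mat (F k * G k + 0\<^sub>m (r k) (sum_list (map p ks)) * 0\<^sub>m (sum_list (map p ks)) (c k))
        (F k * 0\<^sub>m (p k) (sum_list (map c ks)) + 0\<^sub>m (r k) (sum_list (map p ks)) * diag_block_mat (map G ks))
        (0\<^sub>m (sum_list (map r ks)) (p k) * G k + diag_block_mat (map F ks) * 0\<^sub>m (sum_list (map p ks)) (c k))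
        (0\<^sub>m (sum_list (map r ks)) (p k) * 0\<^sub>m (p k) (sum_list (map c ks)) +
          diag_block_mat (map F ks) * diag_block_mat (map G ks))"
    unfolding eF eG by (rule mult_four_block_mat[OF Fk _ _ dF Gk _ _ dG]) auto
  also have "\<dots> = four_block_mat (F k * G k) (0\<^sub>m (r k) (sum_list (map c ks)))
      (0\<^sub>m (sum_list (map r ks)) (c k)) (diag_block_mat (map F ks) * diag_block_mat (map G ks))"
    using Fk Gk dF dG by (intro cong_four_block_mat) (auto intro!: eq_matI)
  also have "diag_block_mat (map F ks) * diag_block_mat (map G ks) = diag_block_mat (map (\<lambda>k. F k * G k) ks)"
    by (rule Cons.IH) (use F G in auto)
  also have "four_block_mat (F k * G k) (0\<^sub>m (r k) (sum_list (map c ks)))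
      (0\<^sub>m (sum_list (map r ks)) (c k)) (diag_block_mat (map (\<lambda>k. F k * G k) ks)) =
      diag_block_mat (map (\<lambda>k. F k * G k) (k # ks))"
    by (rule diag_block_mat_Cons[symmetric]) (use FG in auto)
  finally show ?case .
qed

lemma diag_block_mat_transpose:
  assumes "\<And>k. k \<in> set ks \<Longrightarrow> F k \<in> carrier_mat (r k) (c k)"
  shows "transpose_mat (diag_block_mat (map F ks)) = diag_block_mat (map (\<lambda>k. transpose_mat (F k)) ks)"
  using assms
proof (induction ks)
  case (Cons k ks)
  have F: "F i \<in> carrier_mat (r i) (c i)" if "i \<in> set (k # ks)" for i
    using Cons.prems that by auto
  have "transpose_mat (diag_block_mat (map F (k # ks))) =
      four_block_mat (transpose_mat (F k)) (transpose_mat (0\<^sub>m (sum_list (map r ks)) (c k)))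
        (transpose_mat (0\<^sub>m (r k) (sum_list (map c ks)))) (transpose_mat (diag_block_mat (map F ks)))"
  proof -
    have Fk: "F k \<in> carrier_mat (r k) (c k)" using F by simp
    have dF: "diag_block_mat (map F ks) \<in> carrier_mat (sum_list (map r ks)) (sum_list (map c ks))"
      by (rule diag_block_mat_carrier) (use F in auto)
    have eF: "diag_block_mat (map F (k # ks)) = four_block_mat (F k) (0\<^sub>m (r k) (sum_list (map c ks)))
        (0\<^sub>m (sum_list (map r ks)) (c k)) (diag_block_mat (map F ks))"
      by (rule diag_block_mat_Cons) (use F in auto)
    show ?thesis unfolding eF by (rule transpose_four_block_mat[OF Fk _ _ dF]) auto
  qed
  also have "\<dots> = diag_block_mat (map (\<lambda>k. transpose_mat (F k)) (k # ks))"
    using F Cons.IH by (subst diag_block_mat_Cons[of ks _ c r]) auto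
  finally show ?case .
qed (intro eq_matI, auto)

lemma diag_block_mat_add:
  assumes "\<And>k. k \<in> set ks \<Longrightarrow> F k \<in> carrier_mat (r k) (c k)"
    and "\<And>k. k \<in> set ks \<Longrightarrow> G k \<in> carrier_mat (r k) (c k)"
  shows "diag_block_mat (map F ks) + diag_block_mat (map G ks) =
    (diag_block_mat (map (\<lambda>k. F k + G k) ks) :: real mat)"
  using assms
proof (induction ks)
  case (Cons k ks)
  have F: "F i \<in> carrier_mat (r i) (c i)" and G: "G i \<in> carrier_mat (r i) (c i)"
    if "i \<in> set (k # ks)" for i
    using Cons.prems that by auto
  have "diag_block_mat (map F (k # ks)) + diag_block_mat (map G (k # ks)) =
      four_block_mat (F k + G k) (0\<^sub>m (r k) (sum_list (map c ks)) + 0\<^sub>m (r k) (sum_list (map c ks)))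
        (0\<^sub>m (sum_list (map r ks)) (c k) + 0\<^sub>m (sum_list (map r ks)) (c k))
        (diag_block_mat (map F ks) + diag_block_mat (map G ks))"
  proof -
    have Fk: "F k \<in> carrier_mat (r k) (c k)" and Gk: "G k \<in> carrier_mat (r k) (c k)" using F G by auto
    have dF: "diag_block_mat (map F ks) \<in> carrier_mat (sum_list (map r ks)) (sum_list (map c ks))"
      by (rule diag_block_mat_carrier) (use F in auto)
    have dG: "diag_block_mat (map G ks) \<in> carrier_mat (sum_list (map r ks)) (sum_list (map c ks))"
      by (rule diag_block_mat_carrier) (use G in auto)
    have eF: "diag_block_mat (map F (k # ks)) = four_block_mat (F k) (0\<^sub>m (r k) (sum_list (map c ks)))
        (0\<^sub>m (sum_list (map r ks)) (c k)) (diag_block_mat (map F ks))"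
      by (rule diag_block_mat_Cons) (use F in auto)
    have eG: "diag_block_mat (map G (k # ks)) = four_block_mat (G k) (0\<^sub>m (r k) (sum_list (map c ks)))
        (0\<^sub>m (sum_list (map r ks)) (c k)) (diag_block_mat (map G ks))"
      by (rule diag_block_mat_Cons) (use G in auto)
    show ?thesis unfolding eF eG by (rule add_four_block_mat[OF Fk _ _ dF Gk _ _ dG]) auto
  qed
  also have "\<dots> = diag_block_mat (map (\<lambda>k. F k + G k) (k # ks))"
    using F G Cons.IH by (subst diag_block_mat_Cons[of ks _ r c]) auto
  finally show ?case .
qed (intro eq_matI, auto)

lemma diag_block_mat_zero:
  "diag_block_mat (map (\<lambda>k. 0\<^sub>m (r k) (c k)) ks) = (0\<^sub>m (sum_list (map r ks)) (sum_list (map c ks)) :: real mat)"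
proof (induction ks)
  case (Cons k ks)
  then show ?case by (subst diag_block_mat_Cons[of ks _ r c]) auto
qed auto

lemma diag_block_mat_one:
  "diag_block_mat (map (\<lambda>k. 1\<^sub>m (r k)) ks) = (1\<^sub>m (sum_list (map r ks)) :: real mat)"
proof (induction ks)
  case (Cons k ks)
  then show ?case by (subst diag_block_mat_Cons[of ks _ r r]) auto
qed auto

lemma diag_block_mat_Cons_mult_vec:
  fixes A :: "real mat"
  assumes A: "A \<in> carrier_mat r c" and D: "diag_block_mat As \<in> carrier_mat r' c'"
    and u: "u \<in> carrier_vec c" and w: "w \<in> carrier_vec c'"
  shows "diag_block_mat (A # As) *\<^sub>v (u @\<^sub>v w) = A *\<^sub>v u @\<^sub>v diag_block_mat As *\<^sub>v w"
proof -
  have "diag_block_mat (A # As) = four_block_mat A (0\<^sub>m r c') (0\<^sub>m r' c) (diag_block_mat As)"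
    using A D by (simp add: Let_def)
  then have "diag_block_mat (A # As) *\<^sub>v (u @\<^sub>v w) =
      (A *\<^sub>v u + 0\<^sub>m r c' *\<^sub>v w) @\<^sub>v (0\<^sub>m r' c *\<^sub>v u + diag_block_mat As *\<^sub>v w)"
    using four_block_mat_mult_vec[OF A zero_carrier_mat zero_carrier_mat D u w] by simp
  also have "A *\<^sub>v u + 0\<^sub>m r c' *\<^sub>v w = A *\<^sub>v u"
    using A w by (intro eq_vecI) auto
  also have "0\<^sub>m r' c *\<^sub>v u + diag_block_mat As *\<^sub>v w = diag_block_mat As *\<^sub>v w"
    using D u by (intro eq_vecI) auto
  finally show ?thesis .
qed

lemma block_append:
  assumes "u \<in> carrier_vec r"
  shows "block (r # a) 0 (u @\<^sub>v w) = u"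
    and "k < length a \<Longrightarrow> w \<in> carrier_vec (sum_list a) \<Longrightarrow> block (r # a) (Suc k) (u @\<^sub>v w) = block a k w"
proof -
  show "block (r # a) 0 (u @\<^sub>v w) = u"
    using assms by (intro eq_vecI) (auto simp: block_def subvec_def)
next
  assume k: "k < length a" and w: "w \<in> carrier_vec (sum_list a)"
  have "sum_list (take k a) + a ! k \<le> sum_list a"
  proof -
    have "sum_list (take (Suc k) a) + sum_list (drop (Suc k) a) = sum_list a"
      by (metis append_take_drop_id sum_list_append)
    then show ?thesis using k by (simp add: take_Suc_conv_app_nth)
  qed
  then show "block (r # a) (Suc k) (u @\<^sub>v w) = block a k w"
    using assms w by (intro eq_vecI) (auto simp: block_def subvec_def)
qed

lemma subvec_append_self:
  assumes "v \<in> carrier_vec (p + r)"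
  shows "v = subvec v 0 p @\<^sub>v subvec v p r"
  using assms by (intro eq_vecI) (auto simp: subvec_def)

text \<open>For rectangular blocks the offsets of rows and columns drift apart, so the product is
  cut according to \<open>r\<close> and the argument according to \<open>c\<close>.\<close>

lemma block_diag_block_mat_mult:
  assumes "\<And>k. k \<in> set ks \<Longrightarrow> F k \<in> carrier_mat (r k) (c k)"
    and "v \<in> carrier_vec (sum_list (map c ks))" and "k < length ks"
  shows "block (map r ks) k (diag_block_mat (map F ks) *\<^sub>v v) = F (ks ! k) *\<^sub>v (block (map c ks) k v :: real vec)"
  using assms
proof (induction ks arbitrary: v k)
  case (Cons j ks)
  have F: "F i \<in> carrier_mat (r i) (c i)" if "i \<in> set (j # ks)" for i
    using Cons.prems that by auto
  define u w where "u = subvec v 0 (c j)" and "w = subvec v (c j) (sum_list (map c ks))"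
  have u: "u \<in> carrier_vec (c j)" and w: "w \<in> carrier_vec (sum_list (map c ks))"
    by (auto simp: u_def w_def)
  have v: "v = u @\<^sub>v w"
    unfolding u_def w_def by (rule subvec_append_self) (use Cons.prems in auto)
  have dF: "diag_block_mat (map F ks) \<in> carrier_mat (sum_list (map r ks)) (sum_list (map c ks))"
    by (rule diag_block_mat_carrier) (use F in auto)
  have Fj: "F j \<in> carrier_mat (r j) (c j)" using F by simp
  have eq: "diag_block_mat (map F (j # ks)) *\<^sub>v v = F j *\<^sub>v u @\<^sub>v diag_block_mat (map F ks) *\<^sub>v w"
    unfolding v list.map by (rule diag_block_mat_Cons_mult_vec[OF Fj dF u w])
  have Fu: "F j *\<^sub>v u \<in> carrier_vec (r j)" and
    Dw: "diag_block_mat (map F ks) *\<^sub>v w \<in> carrier_vec (sum_list (map r ks))"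
    using Fj u dF w by (auto intro: mult_mat_vec_carrier)
  show ?case
  proof (cases k)
    case 0
    have "block (map c (j # ks)) 0 v = u"
      unfolding v list.map by (rule block_append(1)[OF u])
    moreover have "block (map r (j # ks)) 0 (diag_block_mat (map F (j # ks)) *\<^sub>v v) = F j *\<^sub>v u"
      unfolding eq unfolding list.map by (rule block_append(1)[OF Fu])
    ultimately show ?thesis using 0 by simp
  next
    case (Suc k')
    then have k': "k' < length ks" using Cons.prems by simp
    have "block (map r (j # ks)) k (diag_block_mat (map F (j # ks)) *\<^sub>v v) =
        block (map r ks) k' (diag_block_mat (map F ks) *\<^sub>v w)"
      unfolding eq Suc unfolding list.map by (rule block_append(2)[OF Fu _ Dw]) (simp add: k')
    also have "\<dots> = F (ks ! k') *\<^sub>v block (map c ks) k' w"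
      by (rule Cons.IH[OF _ w k']) (use F in auto)
    also have "block (map c ks) k' w = block (map c (j # ks)) k v"
      unfolding v Suc list.map by (rule block_append(2)[OF u _ w, symmetric]) (simp add: k')
    finally show ?thesis by (simp add: Suc)
  qed
qed simp

lemma block_offset_less:
  fixes a :: "nat list"
  assumes "k < length a" "i < a ! k"
  shows "sum_list (take k a) + i < sum_list a"
proof -
  have "sum_list (take (Suc k) a) + sum_list (drop (Suc k) a) = sum_list a"
    by (metis append_take_drop_id sum_list_append)
  then show ?thesis using assms by (simp add: take_Suc_conv_app_nth)
qed

lemma block_index_cases:
  fixes a :: "nat list"
  assumes "j < sum_list a"
  obtains k i where "k < length a" "i < a ! k" "j = sum_list (take k a) + i"
proof -
  have "\<exists>k<length a. \<exists>i<a ! k. j = sum_list (take k a) + i"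
    using assms
  proof (induction a arbitrary: j)
    case (Cons r a)
    show ?case
    proof (cases "j < r")
      case True
      then show ?thesis by (intro exI[of _ 0]) auto
    next
      case False
      then have "j - r < sum_list a" using Cons.prems by simp
      from Cons.IH[OF this] obtain k i where "k < length a" "i < a ! k" "j - r = sum_list (take k a) + i"
        by blast
      then show ?thesis using False by (intro exI[of _ "Suc k"]) auto
    qed
  qed simp
  then show ?thesis using that by blast
qed

lemma block_index [simp]: "i < a ! k \<Longrightarrow> block a k v $ i = v $ (sum_list (take k a) + i)"
  by (simp add: block_def subvec_def)

lemma block_carrier [simp]: "block a k v \<in> carrier_vec (a ! k)"
  by (simp add: block_def)

lemma vec_eq_blockI:
  assumes "v \<in> carrier_vec (sum_list a)" "w \<in> carrier_vec (sum_list a)"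
    and "\<And>k i. k < length a \<Longrightarrow> i < a ! k \<Longrightarrow> v $ (sum_list (take k a) + i) = w $ (sum_list (take k a) + i)"
  shows "v = w"
proof (rule eq_vecI)
  fix j assume "j < dim_vec w"
  then have "j < sum_list a" using assms by simp
  then obtain k i where "k < length a" "i < a ! k" "j = sum_list (take k a) + i"
    by (rule block_index_cases)
  then show "v $ j = w $ j" using assms(3) by simp
qed (use assms in simp)

section \<open>Canonical blocks\<close>

lemma canonical_block_carrier [simp]:
  "N_block k \<in> carrier_mat k k" "K_block k \<in> carrier_mat (k - 1) k" "L_block k \<in> carrier_mat (k - 1) k"
  "e1_block k \<in> carrier_mat k 1"
  by (simp_all add: N_block_def K_block_def L_block_def e1_block_def)

lemma sum_list_diff_1:
  fixes a :: "nat list"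
  assumes "\<forall>k\<in>set a. k \<ge> 1"
  shows "sum_list (map (\<lambda>k. k - 1) a) = sum_list a - length a" "length a \<le> sum_list a"
proof -
  have "sum_list (map (\<lambda>k. k - 1) a) + length a = sum_list a"
    using assms by (induction a) auto
  then show "sum_list (map (\<lambda>k. k - 1) a) = sum_list a - length a" "length a \<le> sum_list a" by auto
qed

lemma canonical_mat_carrier:
  assumes "\<forall>k\<in>set a. k \<ge> 1"
  shows "K_mat a \<in> carrier_mat (sum_list a - length a) (sum_list a)"
    "L_mat a \<in> carrier_mat (sum_list a - length a) (sum_list a)"
    "M_mat a \<in> carrier_mat (sum_list a) (length a)"
    "Mbar_mat a \<in> carrier_mat (sum_list a - length a) (length a)"
  using diag_block_mat_carrier[of a K_block "\<lambda>k. k - 1" "\<lambda>k. k", OF canonical_block_carrier(2)]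
    diag_block_mat_carrier[of a L_block "\<lambda>k. k - 1" "\<lambda>k. k", OF canonical_block_carrier(3)]
    diag_block_mat_carrier[of a e1_block "\<lambda>k. k" "\<lambda>k. 1", OF canonical_block_carrier(4)]
    diag_block_mat_carrier[of a "\<lambda>k. e1_block (k - 1)" "\<lambda>k. k - 1" "\<lambda>k. 1", OF canonical_block_carrier(4)]
    sum_list_diff_1[OF assms]
  by (simp_all add: K_mat_def L_mat_def M_mat_def Mbar_mat_def sum_list_triv)

lemma N_mat_carrier: "N_mat a \<in> carrier_mat (sum_list a) (sum_list a)"
  using diag_block_mat_carrier[of a N_block "\<lambda>k. k" "\<lambda>k. k"] by (simp add: N_mat_def)

text \<open>\<open>L_block\<close> deletes the first entry of a vector and \<open>K_block\<close>
  the last one; their transposes put a zero in front and at the end. Each identity composes two such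
  operations; for instance, deleting the last entry and then prepending a zero is the shift
  \<open>N_block\<close>. The sixth identity excludes k = 0, where the product would be the 1 x 1
  zero matrix.\<close>

lemma canonical_block_identities:
  shows "L_block k * e1_block k = 0\<^sub>m (k - 1) 1"
    and "L_block k * transpose_mat (L_block k) = 1\<^sub>m (k - 1)"
    and "K_block k * transpose_mat (K_block k) = 1\<^sub>m (k - 1)"
    and "transpose_mat (L_block k) * K_block k = N_block k"
    and "K_block k * e1_block k = e1_block (k - 1)"
    and "k \<ge> 1 \<Longrightarrow> transpose_mat (e1_block k) * e1_block k = 1\<^sub>m 1"
    and "e1_block k * transpose_mat (e1_block k) + transpose_mat (L_block k) * L_block k = 1\<^sub>m k"
proof -
  note d = L_block_def K_block_def N_block_def e1_block_def scalar_prod_def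
  \<comment> \<open>Every entry of these products is a sum of products of two indicators in which
    one index condition singles out at most one summand.\<close>
  have delta: "(\<Sum>l = 0..<r. (if P l then 1 else 0) * (if l = s then 1 else 0)) =
      (if s < r \<and> P s then 1 else (0::real))" for r s :: nat and P
  proof -
    have "(\<Sum>l = 0..<r. (if P l then 1 else 0) * (if l = s then 1 else 0)) =
        (\<Sum>l = 0..<r. if l = s then (if P s then 1 else 0) else (0::real))"
      by (rule sum.cong) auto
    then show ?thesis by simp
  qed
  have delta_sym: "(\<Sum>l = 0..<r. (if i = l then 1 else 0) * (if j = l then 1 else 0)) =
      (if i = j \<and> i < r then 1 else (0::real))" for r i j :: nat
    using delta[where r = r and P = "\<lambda>l. i = l" and s = j] unfolding eq_commute[of _ j] by auto
  show "L_block k * e1_block k = 0\<^sub>m (k - 1) 1"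
    by (intro eq_matI) (auto simp: d intro!: sum.neutral)
  show "L_block k * transpose_mat (L_block k) = 1\<^sub>m (k - 1)"
    by (intro eq_matI) (auto simp: d delta delta_sym)
  show "K_block k * transpose_mat (K_block k) = 1\<^sub>m (k - 1)"
    by (intro eq_matI) (auto simp: d delta delta_sym)
  show "transpose_mat (L_block k) * K_block k = N_block k"
    by (intro eq_matI) (auto simp: d delta)
  show "K_block k * e1_block k = e1_block (k - 1)"
    by (intro eq_matI) (auto simp: d delta)
  show "k \<ge> 1 \<Longrightarrow> transpose_mat (e1_block k) * e1_block k = 1\<^sub>m 1"
    by (intro eq_matI) (auto simp: d delta)
  have delta': "(\<Sum>l = 0..<r. (if i = Suc l then 1 else 0) * (if j = Suc l then 1 else 0)) =
      (if i = j \<and> 0 < i \<and> i \<le> r then 1 else (0::real))" for r i j :: nat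
  proof (cases j)
    case (Suc j')
    then show ?thesis
      using delta[where r = r and P = "\<lambda>l. i = Suc l" and s = j'] unfolding eq_commute[of _ j'] by auto
  qed auto
  show "e1_block k * transpose_mat (e1_block k) + transpose_mat (L_block k) * L_block k = 1\<^sub>m k"
    by (intro eq_matI) (auto simp: d delta')
qed

text \<open>Products, sums and transposes of block diagonal matrices are formed blockwise, so the
  identities for single blocks lift. The last one splits a vector into the leading entries of its
  blocks and the rest.\<close>

lemma canonical_identities:
  assumes pos: "\<forall>k\<in>set a. k \<ge> 1"
  shows "L_mat a * M_mat a = 0\<^sub>m (sum_list a - length a) (length a)"
    and "L_mat a * transpose_mat (L_mat a) = 1\<^sub>m (sum_list a - length a)"
    and "K_mat a * transpose_mat (K_mat a) = 1\<^sub>m (sum_list a - length a)"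
    and "transpose_mat (L_mat a) * K_mat a = N_mat a"
    and "K_mat a * M_mat a = Mbar_mat a"
    and "transpose_mat (M_mat a) * M_mat a = 1\<^sub>m (length a)"
    and "M_mat a * transpose_mat (M_mat a) + transpose_mat (L_mat a) * L_mat a = 1\<^sub>m (sum_list a)"
proof -
  have tL: "transpose_mat (L_mat a) = diag_block_mat (map (\<lambda>k. transpose_mat (L_block k)) a)"
    unfolding L_mat_def by (rule diag_block_mat_transpose[OF canonical_block_carrier(3)])
  have tK: "transpose_mat (K_mat a) = diag_block_mat (map (\<lambda>k. transpose_mat (K_block k)) a)"
    unfolding K_mat_def by (rule diag_block_mat_transpose[OF canonical_block_carrier(2)])
  have tM: "transpose_mat (M_mat a) = diag_block_mat (map (\<lambda>k. transpose_mat (e1_block k)) a)"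
    unfolding M_mat_def by (rule diag_block_mat_transpose[OF canonical_block_carrier(4)])
  note c = canonical_block_carrier
  have tL': "transpose_mat (L_block k) \<in> carrier_mat k (k - 1)"
    and tK': "transpose_mat (K_block k) \<in> carrier_mat k (k - 1)"
    and tM': "transpose_mat (e1_block k) \<in> carrier_mat 1 k" for k
    using c by (auto simp: transpose_carrier_mat)
  note s = sum_list_diff_1(1)[OF pos] sum_list_triv
  show "L_mat a * M_mat a = 0\<^sub>m (sum_list a - length a) (length a)"
    unfolding L_mat_def M_mat_def diag_block_mat_mult[OF c(3) c(4)] canonical_block_identities(1)
    unfolding diag_block_mat_zero s by simp
  show "L_mat a * transpose_mat (L_mat a) = 1\<^sub>m (sum_list a - length a)"
    unfolding tL unfolding L_mat_def diag_block_mat_mult[OF c(3) tL'] canonical_block_identities(2)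
    unfolding diag_block_mat_one s by simp
  show "K_mat a * transpose_mat (K_mat a) = 1\<^sub>m (sum_list a - length a)"
    unfolding tK unfolding K_mat_def diag_block_mat_mult[OF c(2) tK'] canonical_block_identities(3)
    unfolding diag_block_mat_one s by simp
  show "transpose_mat (L_mat a) * K_mat a = N_mat a"
    unfolding tL K_mat_def N_mat_def diag_block_mat_mult[OF tL' c(2)] canonical_block_identities(4) ..
  show "K_mat a * M_mat a = Mbar_mat a"
    unfolding K_mat_def M_mat_def Mbar_mat_def diag_block_mat_mult[OF c(2) c(4)] canonical_block_identities(5) ..
  have "map (\<lambda>k. transpose_mat (e1_block k) * e1_block k) a = map (\<lambda>k. 1\<^sub>m 1) a"
    using pos canonical_block_identities(6) by auto
  then show "transpose_mat (M_mat a) * M_mat a = 1\<^sub>m (length a)"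
    unfolding tM
    unfolding M_mat_def diag_block_mat_mult[OF tM' c(4)]
    by (simp only: diag_block_mat_one[of "\<lambda>k. 1"] sum_list_triv) simp
  have "diag_block_mat (map (\<lambda>k. e1_block k * transpose_mat (e1_block k)) a) +
      diag_block_mat (map (\<lambda>k. transpose_mat (L_block k) * L_block k) a) =
      diag_block_mat (map (\<lambda>k. e1_block k * transpose_mat (e1_block k) + transpose_mat (L_block k) * L_block k) a)"
    by (rule diag_block_mat_add[OF mult_carrier_mat[OF c(4) tM'] mult_carrier_mat[OF tL' c(3)]])
  then show "M_mat a * transpose_mat (M_mat a) + transpose_mat (L_mat a) * L_mat a = 1\<^sub>m (sum_list a)"
    unfolding tM tL
    unfolding M_mat_def L_mat_def diag_block_mat_mult[OF c(4) tM'] diag_block_mat_mult[OF tL' c(3)]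
      canonical_block_identities(7) diag_block_mat_one by simp
qed

text \<open>With \<open>pos\<close>, equality of sum and length forces every index to be 1: each
  block is then nothing but its leading entry.\<close>

lemma M_mat_eq_one:
  assumes pos: "\<forall>k\<in>set a. k \<ge> 1" and eq: "sum_list a = length a"
  shows "M_mat a = 1\<^sub>m (length a)"
proof -
  have "sum_list (map (\<lambda>k. k - 1) a) = 0" using sum_list_diff_1[OF pos] eq by simp
  then have "\<forall>k\<in>set a. k - 1 = 0" by simp
  then have "\<forall>k\<in>set a. k = 1" using pos by (metis diff_is_0_eq le_antisym)
  moreover have "e1_block 1 = 1\<^sub>m 1" by (intro eq_matI) (auto simp: e1_block_def)
  ultimately have "map e1_block a = map (\<lambda>k. 1\<^sub>m 1) a" by auto
  then show ?thesis
    unfolding M_mat_def by (simp only: diag_block_mat_one[of "\<lambda>k. 1"] sum_list_triv) simp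
qed

text \<open>The p-th power moves entries down by p places. For p at least k no index pair satisfies
  the condition, so nilpotency is included.\<close>

lemma N_block_pow: "N_block k ^\<^sub>m p = mat k k (\<lambda>(i,j). if i = j + p then 1 else 0)"
proof (induction p)
  case (Suc p)
  show ?case
  proof (rule eq_matI)
    fix i j assume "i < dim_row (mat k k (\<lambda>(i, j). if i = j + Suc p then 1 else 0) :: real mat)"
      "j < dim_col (mat k k (\<lambda>(i, j). if i = j + Suc p then 1 else 0) :: real mat)"
    then have ij: "i < k" "j < k" by auto
    have "(N_block k ^\<^sub>m Suc p) $$ (i,j) =
        (\<Sum>l<k. (if i = l + p then 1 else 0) * (if l = Suc j then 1 else 0))"
      unfolding pow_mat.simps Suc using ij by (simp add: N_block_def scalar_prod_def atLeast0LessThan)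
    also have "\<dots> = (\<Sum>l<k. if l = Suc j then (if i = Suc j + p then 1 else 0) else 0)"
      by (rule sum.cong) auto
    also have "\<dots> = (if i = j + Suc p then 1 else 0)" using ij by simp
    finally show "(N_block k ^\<^sub>m Suc p) $$ (i,j) = mat k k (\<lambda>(i, j). if i = j + Suc p then 1 else 0) $$ (i,j)"
      using ij by simp
  qed (auto simp: N_block_def)
qed (auto simp: N_block_def)

text \<open>The shift happens inside each block and fills up with zeros; nothing leaks in from the
  preceding block. The truncated difference \<open>i - p\<close> is read only when it is
  genuine.\<close>

lemma N_mat_pow_mult_index:
  assumes v: "v \<in> carrier_vec (sum_list a)" and k: "k < length a" and i: "i < a ! k"
  shows "(N_mat a ^\<^sub>m p *\<^sub>v v) $ (sum_list (take k a) + i) =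
    (if p \<le> i then v $ (sum_list (take k a) + (i - p)) else 0)"
proof -
  have "N_mat a ^\<^sub>m p = diag_block_mat (map (\<lambda>A. A ^\<^sub>m p) (map N_block a))"
    unfolding N_mat_def by (rule diag_block_pow_mat) (auto simp: N_block_def)
  also have "\<dots> = diag_block_mat (map (\<lambda>k. N_block k ^\<^sub>m p) a)"
    by (simp add: o_def)
  finally have N: "N_mat a ^\<^sub>m p = diag_block_mat (map (\<lambda>k. N_block k ^\<^sub>m p) a)" .
  have c: "N_block k ^\<^sub>m p \<in> carrier_mat k k" for k by (simp add: N_block_pow)
  have "(N_mat a ^\<^sub>m p *\<^sub>v v) $ (sum_list (take k a) + i) = block a k (N_mat a ^\<^sub>m p *\<^sub>v v) $ i"
    using i by simp
  also have "block a k (N_mat a ^\<^sub>m p *\<^sub>v v) = N_block (a ! k) ^\<^sub>m p *\<^sub>v block a k v"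
    using block_diag_block_mat_mult[of a "\<lambda>k. N_block k ^\<^sub>m p" "\<lambda>k. k" "\<lambda>k. k" v k, OF c] v k
    unfolding N by simp
  also have "\<dots> $ i = (\<Sum>j<a ! k. (if i = j + p then 1 else 0) * v $ (sum_list (take k a) + j))"
    using mult_mat_vec_index[OF c block_carrier i] i by (simp add: N_block_pow)
  also have "\<dots> = (\<Sum>j<a ! k. if j = i - p then (if p \<le> i then v $ (sum_list (take k a) + (i - p)) else 0) else 0)"
    by (rule sum.cong) auto
  also have "\<dots> = (if p \<le> i then v $ (sum_list (take k a) + (i - p)) else 0)"
    using i by (simp add: less_imp_diff_less)
  finally show ?thesis .
qed

lemma N_mat_mult_index:
  assumes v: "v \<in> carrier_vec (sum_list a)" and k: "k < length a" and i: "i < a ! k"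
  shows "(N_mat a *\<^sub>v v) $ (sum_list (take k a) + i) =
    (if i = 0 then 0 else v $ (sum_list (take k a) + (i - 1)))"
proof -
  have "N_mat a ^\<^sub>m 1 = N_mat a" using N_mat_carrier[of a] by simp
  then show ?thesis using N_mat_pow_mult_index[OF v k i, of 1] by auto
qed

section \<open>Nilpotent chains\<close>

text \<open>The Neumann series for the inverse of N d/dt - I, finite because N is nilpotent. With
  \<open>f1\<close> it is the component \<open>x1\<close>; with \<open>f3\<close> it is the vector
  from which \<open>K_mat\<close> produces \<open>x3\<close> and whose last entries encode condition
  (a).\<close>

definition chain_sol :: "real \<Rightarrow> nat list \<Rightarrow> (real \<Rightarrow> real vec) \<Rightarrow> real \<Rightarrow> real vec" where
  "chain_sol T a g t =
     - sum_vec (sum_list a) (\<lambda>i. N_mat a ^\<^sub>m i *\<^sub>v deriv_vec T i g t) (max_index a)"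

lemma chain_sol_carrier [simp]: "chain_sol T a g t \<in> carrier_vec (sum_list a)"
  by (simp add: chain_sol_def sum_vec_def)

lemma chain_sol_dim [simp]: "dim_vec (chain_sol T a g t) = sum_list a"
  by (rule carrier_vecD[OF chain_sol_carrier])

lemma max_index_ge: "k < length a \<Longrightarrow> a ! k \<le> max_index a"
  by (simp add: max_index_def)

text \<open>Shifts by more than \<open>i\<close> places vanish at position \<open>i\<close>, so the
  summation bound common to all blocks drops out. Position \<open>i\<close> involves derivatives of
  order at most \<open>i\<close>, hence less than the size of its block.\<close>

lemma chain_sol_index:
  assumes g: "g t \<in> carrier_vec (sum_list a)" and k: "k < length a" and i: "i < a ! k"
  shows "chain_sol T a g t $ (sum_list (take k a) + i) =
    - (\<Sum>p\<le>i. nth_deriv T p (\<lambda>s. g s $ (sum_list (take k a) + (i - p))) t)"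
proof -
  let ?o = "sum_list (take k a)"
  have d: "deriv_vec T p g t \<in> carrier_vec (sum_list a)" for p
    using g by (simp add: deriv_vec_def)
  have o: "?o + i < sum_list a" by (rule block_offset_less[OF k i])
  have "chain_sol T a g t $ (?o + i) =
      - (\<Sum>p<max_index a. (N_mat a ^\<^sub>m p *\<^sub>v deriv_vec T p g t) $ (?o + i))"
    using o by (simp add: chain_sol_def sum_vec_def)
  also have "(\<Sum>p<max_index a. (N_mat a ^\<^sub>m p *\<^sub>v deriv_vec T p g t) $ (?o + i)) =
      (\<Sum>p<max_index a. if p \<le> i then deriv_vec T p g t $ (?o + (i - p)) else 0)"
    by (simp only: N_mat_pow_mult_index[OF d k i])
  also have "\<dots> = (\<Sum>p\<in>{..<max_index a} \<inter> {p. p \<le> i}. deriv_vec T p g t $ (?o + (i - p)))"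
    by (simp add: sum.If_cases)
  also have "{..<max_index a} \<inter> {p. p \<le> i} = {..i}"
    using i max_index_ge[OF k] by auto
  also have "(\<Sum>p\<le>i. deriv_vec T p g t $ (?o + (i - p))) =
      (\<Sum>p\<le>i. nth_deriv T p (\<lambda>s. g s $ (?o + (i - p))) t)"
    using o g by (intro sum.cong) (auto simp: deriv_vec_def)
  finally show ?thesis .
qed

lemma Ck_1I:
  assumes T: "T > 0" and d: "\<And>t. t \<in> {0..T} \<Longrightarrow> (f has_real_derivative f' t) (at t within {0..T})"
    and c: "continuous_on {0..T} f'"
  shows "Ck 1 T f" "t \<in> {0..T} \<Longrightarrow> nth_deriv T 1 f t = f' t"
proof -
  have e: "nth_deriv T 1 f t = f' t" if "t \<in> {0..T}" for t
    using nth_deriv_SucI[OF T that, of 0 f] d[OF that] by simp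
  then show "t \<in> {0..T} \<Longrightarrow> nth_deriv T 1 f t = f' t" .
  have "continuous_on {0..T} (nth_deriv T 1 f)"
    by (rule continuous_on_eq[OF c]) (rule e[symmetric])
  moreover have "(nth_deriv T 0 f has_real_derivative nth_deriv T (Suc 0) f t) (at t within {0..T})"
    if "t \<in> {0..T}" for t
    using d[OF that] e[OF that] by simp
  ultimately show "Ck 1 T f" by (simp add: Ck_def)
qed

text \<open>Used twice, for the blocks belonging to \<open>\<alpha>\<close> and, after a
  transformation, for the overdetermined blocks belonging to \<open>\<gamma>\<close>.\<close>

locale chain_data =
  fixes T :: real and a :: "nat list" and g :: "real \<Rightarrow> real vec"
  assumes T: "T > 0"
    and g_carrier: "\<And>t. t \<in> {0..T} \<Longrightarrow> g t \<in> carrier_vec (sum_list a)"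
    and reg: "\<And>k. k < length a \<Longrightarrow> Ck_vec (a ! k) T (a ! k) (\<lambda>t. block a k (g t))"
begin

lemma reg_entry:
  assumes "k < length a" "i < a ! k"
  shows "Ck (a ! k) T (\<lambda>t. g t $ (sum_list (take k a) + i))"
  using reg[OF assms(1)] assms(2) by (simp add: Ck_vec_def)

lemma g_cont: "Ck_vec 0 T (sum_list a) g"
  unfolding Ck_vec_0_iff
proof (intro conjI ballI allI impI)
  fix j assume "j < sum_list a"
  then obtain k i where ki: "k < length a" "i < a ! k" and j: "j = sum_list (take k a) + i"
    by (rule block_index_cases)
  show "continuous_on {0..T} (\<lambda>t. g t $ j)"
    using Ck_continuous[OF reg_entry[OF ki], of 0] by (simp add: j)
qed (rule g_carrier)

text \<open>Differentiating position \<open>i\<close> once more needs order i+1, which is at most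
  the block size: the regularity \<open>reg\<close> provides exactly this.\<close>

lemma chain_sol_entry_deriv:
  assumes k: "k < length a" and i: "i < a ! k"
  shows "Ck 1 T (\<lambda>t. chain_sol T a g t $ (sum_list (take k a) + i))"
    and "t \<in> {0..T} \<Longrightarrow> nth_deriv T 1 (\<lambda>t. chain_sol T a g t $ (sum_list (take k a) + i)) t =
      - (\<Sum>p\<le>i. nth_deriv T (Suc p) (\<lambda>s. g s $ (sum_list (take k a) + (i - p))) t)"
proof -
  let ?G = "\<lambda>p s. g s $ (sum_list (take k a) + (i - p))"
  let ?f = "\<lambda>t. chain_sol T a g t $ (sum_list (take k a) + i)"
  let ?f' = "\<lambda>t. - (\<Sum>p\<le>i. nth_deriv T (Suc p) (?G p) t)"
  have G: "Ck (a ! k) T (?G p)" if "p \<le> i" for p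
    using i by (intro reg_entry k) simp
  have d: "(?f has_real_derivative ?f' t) (at t within {0..T})" if t: "t \<in> {0..T}" for t
  proof -
    have "((\<lambda>t. - (\<Sum>p\<le>i. nth_deriv T p (?G p) t)) has_real_derivative ?f' t) (at t within {0..T})"
      by (intro DERIV_minus DERIV_sum Ck_deriv[OF G _ t]) (use i in auto)
    then show ?thesis
      by (rule DERIV_transform_set[OF t, rotated]) (rule chain_sol_index[where g = g, OF g_carrier k i])
  qed
  have c: "continuous_on {0..T} ?f'"
    by (intro continuous_intros Ck_continuous[OF G]) (use i in auto)
  show "Ck 1 T ?f" "t \<in> {0..T} \<Longrightarrow> nth_deriv T 1 ?f t = ?f' t"
    using Ck_1I[OF T d c] by auto
qed

lemma chain_sol_C1: "Ck_vec 1 T (sum_list a) (chain_sol T a g)"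
  unfolding Ck_vec_def
proof (intro conjI ballI allI impI)
  fix j assume "j < sum_list a"
  then obtain k i where ki: "k < length a" "i < a ! k" and j: "j = sum_list (take k a) + i"
    by (rule block_index_cases)
  show "Ck 1 T (\<lambda>t. chain_sol T a g t $ j)"
    unfolding j by (rule chain_sol_entry_deriv(1)[OF ki])
qed simp

lemma chain_sol_eq:
  assumes t: "t \<in> {0..T}"
  shows "N_mat a *\<^sub>v deriv_vec T 1 (chain_sol T a g) t = chain_sol T a g t + g t"
proof (rule vec_eq_blockI)
  let ?S = "chain_sol T a g"
  have d: "deriv_vec T 1 ?S t \<in> carrier_vec (sum_list a)"
    using carrier_vecD[OF chain_sol_carrier[of T a g t]] by (simp add: deriv_vec_def)
  show "N_mat a *\<^sub>v deriv_vec T 1 ?S t \<in> carrier_vec (sum_list a)"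
    by (rule mult_mat_vec_carrier[OF N_mat_carrier d])
  show "?S t + g t \<in> carrier_vec (sum_list a)"
    using g_carrier[OF t] by simp
  fix k i assume k: "k < length a" and i: "i < a ! k"
  let ?o = "sum_list (take k a)"
  have o: "?o + i < sum_list a" by (rule block_offset_less[OF k i])
  have S: "(?S t + g t) $ (?o + i) = ?S t $ (?o + i) + g t $ (?o + i)"
    using o carrier_vecD[OF g_carrier[OF t]] by simp
  show "(N_mat a *\<^sub>v deriv_vec T 1 ?S t) $ (?o + i) = (?S t + g t) $ (?o + i)"
  proof (cases i)
    case 0
    then show ?thesis unfolding S N_mat_mult_index[OF d k i] chain_sol_index[where t = t and g = g, OF g_carrier[OF t] k i]
      by simp
  next
    case (Suc i')
    then have i': "i' < a ! k" using i by simp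
    have "(N_mat a *\<^sub>v deriv_vec T 1 ?S t) $ (?o + i) = deriv_vec T 1 ?S t $ (?o + i')"
      unfolding N_mat_mult_index[OF d k i] by (simp add: Suc)
    also have "\<dots> = nth_deriv T 1 (\<lambda>t. ?S t $ (?o + i')) t"
      using block_offset_less[OF k i'] carrier_vecD[OF chain_sol_carrier[of T a g t]]
      by (simp add: deriv_vec_def)
    also have "\<dots> = - (\<Sum>p\<le>i'. nth_deriv T (Suc p) (\<lambda>s. g s $ (?o + (i' - p))) t)"
      by (rule chain_sol_entry_deriv(2)[OF k i' t])
    \<comment> \<open>In the sum for position \<open>i\<close> the term p = 0 is \<open>g\<close>
      itself and cancels against the added entry; the other terms, with p lowered by one, are the
      derivative of position \<open>i'\<close>.\<close>
    also have "\<dots> = ?S t $ (?o + i) + g t $ (?o + i)"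
      unfolding chain_sol_index[where t = t and g = g, OF g_carrier[OF t] k i]
      by (simp add: Suc sum.atMost_Suc_shift del: sum.atMost_Suc)
    finally show ?thesis unfolding S .
  qed
qed

text \<open>No initial value is free: the first row of each block reads 0 = X + g, and every later
  row expresses its entry through the derivative of the preceding one.\<close>

lemma chain_sol_unique:
  assumes X: "vec_deriv T (sum_list a) X X'"
    and eq: "\<And>t. t \<in> {0..T} \<Longrightarrow> N_mat a *\<^sub>v X' t = X t + g t"
    and t: "t \<in> {0..T}"
  shows "X t = chain_sol T a g t"
proof (rule vec_eq_blockI)
  let ?S = "chain_sol T a g"
  fix k i assume k: "k < length a" and i: "i < a ! k"
  let ?o = "sum_list (take k a)"
  note S' = Ck_vec_1_deriv(1)[OF chain_sol_C1]
  show "X t $ (?o + i) = ?S t $ (?o + i)"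
    using i t
  \<comment> \<open>The time is generalized because the entry at position \<open>i\<close> has to be
    known on the whole interval before it can be differentiated.\<close>
  proof (induction i arbitrary: t)
    case (0 t)
    have "(N_mat a *\<^sub>v X' t) $ (?o + 0) = (X t + g t) $ (?o + 0)"
      and "(N_mat a *\<^sub>v deriv_vec T 1 ?S t) $ (?o + 0) = (?S t + g t) $ (?o + 0)"
      using eq chain_sol_eq 0 by auto
    then show ?case
      using N_mat_mult_index[OF vec_deriv_carrier(2)[OF X 0(2)] k 0(1)]
        N_mat_mult_index[OF vec_deriv_carrier(2)[OF S' 0(2)] k 0(1)]
        block_offset_less[OF k 0(1)] carrier_vecD[OF g_carrier[OF 0(2)]] by simp
  next
    case (Suc i t)
    then have i: "i < a ! k" by simp
    have o: "?o + i < sum_list a" "?o + Suc i < sum_list a"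
      using block_offset_less[OF k i] block_offset_less[OF k Suc.prems(1)] by auto
    have "X' t $ (?o + i) = deriv_vec T 1 ?S t $ (?o + i)"
    proof (rule trans[OF sym])
      show "nth_deriv T 1 (\<lambda>s. X s $ (?o + i)) t = X' t $ (?o + i)"
        using nth_deriv_SucI[OF T Suc.prems(2), of 0] vec_deriv_entry[OF X Suc.prems(2) o(1)] by simp
      have "nth_deriv T 1 (\<lambda>s. X s $ (?o + i)) t = nth_deriv T 1 (\<lambda>s. ?S s $ (?o + i)) t"
        by (rule nth_deriv_cong[OF T Suc.IH[OF i] Suc.prems(2)])
      also have "\<dots> = deriv_vec T 1 ?S t $ (?o + i)"
        using o carrier_vecD[OF chain_sol_carrier[of T a g t]] by (simp add: deriv_vec_def)
      finally show "nth_deriv T 1 (\<lambda>s. X s $ (?o + i)) t = deriv_vec T 1 ?S t $ (?o + i)" .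
    qed
    moreover have "(N_mat a *\<^sub>v X' t) $ (?o + Suc i) = (X t + g t) $ (?o + Suc i)"
      and "(N_mat a *\<^sub>v deriv_vec T 1 ?S t) $ (?o + Suc i) = (?S t + g t) $ (?o + Suc i)"
      using eq chain_sol_eq Suc.prems by auto
    ultimately show ?case
      using N_mat_mult_index[OF vec_deriv_carrier(2)[OF X Suc.prems(2)] k Suc.prems(1)]
        N_mat_mult_index[OF vec_deriv_carrier(2)[OF S' Suc.prems(2)] k Suc.prems(1)]
        o carrier_vecD[OF g_carrier[OF Suc.prems(2)]] by simp
  qed
qed (use vec_deriv_carrier(1)[OF X t] in simp_all)

end

text \<open>Deleting the last entry of each block and appending a zero is the projection onto the
  range of K^T. A vector lies in that range exactly if it is fixed, that is, if these last entries
  vanish.\<close>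

lemma trans_K_K_index:
  assumes pos: "\<forall>k\<in>set a. k \<ge> 1"
    and v: "v \<in> carrier_vec (sum_list a)" and k: "k < length a" and i: "i < a ! k"
  shows "(transpose_mat (K_mat a) *\<^sub>v (K_mat a *\<^sub>v v)) $ (sum_list (take k a) + i) =
    (if i < a ! k - 1 then v $ (sum_list (take k a) + i) else 0)"
proof -
  let ?F = "\<lambda>k. transpose_mat (K_block k) * K_block k"
  have tK: "transpose_mat (K_block k) \<in> carrier_mat k (k - 1)" for k
    using canonical_block_carrier(2)[of k] by (simp add: transpose_carrier_mat)
  have F: "?F k \<in> carrier_mat k k" for k
    by (rule mult_carrier_mat[OF tK canonical_block_carrier(2)])
  have "transpose_mat (K_mat a) * K_mat a = diag_block_mat (map ?F a)"
    unfolding K_mat_def diag_block_mat_transpose[OF canonical_block_carrier(2)]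
    by (rule diag_block_mat_mult[OF tK canonical_block_carrier(2)])
  then have e: "transpose_mat (K_mat a) *\<^sub>v (K_mat a *\<^sub>v v) = diag_block_mat (map ?F a) *\<^sub>v v"
    using assoc_mult_mat_vec[OF _ canonical_mat_carrier(1)[OF pos] v, of "transpose_mat (K_mat a)"]
      canonical_mat_carrier(1)[OF pos] by (simp add: transpose_carrier_mat)
  have Fij: "?F n $$ (i,j) = (if i = j \<and> i < n - 1 then 1 else 0)" if "i < n" "j < n" for n i j
  proof -
    have "?F n $$ (i,j) = (\<Sum>l<n - 1. (if l = i then 1 else 0) * (if l = j then 1 else 0))"
      using that by (simp add: K_block_def scalar_prod_def atLeast0LessThan)
    also have "\<dots> = (\<Sum>l<n - 1. if l = i then (if i = j then 1 else 0) else 0)"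
      by (rule sum.cong) auto
    finally show ?thesis by auto
  qed
  have "(diag_block_mat (map ?F a) *\<^sub>v v) $ (sum_list (take k a) + i) = block a k (diag_block_mat (map ?F a) *\<^sub>v v) $ i"
    using i by simp
  also have "block a k (diag_block_mat (map ?F a) *\<^sub>v v) = ?F (a ! k) *\<^sub>v block a k v"
    using block_diag_block_mat_mult[of a ?F "\<lambda>k. k" "\<lambda>k. k" v k, OF F] v k by simp
  also have "\<dots> $ i = (\<Sum>j<a ! k. ?F (a ! k) $$ (i,j) * block a k v $ j)"
    by (rule mult_mat_vec_index[OF F block_carrier i])
  also have "\<dots> = (\<Sum>j<a ! k. if j = i then (if i < a ! k - 1 then v $ (sum_list (take k a) + i) else 0) else 0)"
    using i by (intro sum.cong refl) (simp only: Fij lessThan_iff block_index, auto)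
  also have "\<dots> = (if i < a ! k - 1 then v $ (sum_list (take k a) + i) else 0)"
    using i by simp
  finally show ?thesis unfolding e .
qed

context chain_data
begin

text \<open>The substitution p = a_k - i turns the last entry of a block into the sum of condition
  (a), up to sign. Condition (a) counts components from 1 and vectors are indexed from 0, hence the
  index \<open>i - 1\<close>.\<close>

lemma chain_sol_last_entry:
  assumes k: "k < length a" and pos: "a ! k \<ge> 1" and t: "t \<in> {0..T}"
  shows "chain_sol T a g t $ (sum_list (take k a) + (a ! k - 1)) =
    - (\<Sum>i=1..a ! k. nth_deriv T (a ! k - i) (\<lambda>s. block a k (g s) $ (i - 1)) t)"
proof -
  let ?o = "sum_list (take k a)"
  have l: "a ! k - 1 < a ! k" using pos by simp
  have "(\<Sum>p\<le>a ! k - 1. nth_deriv T p (\<lambda>s. g s $ (?o + (a ! k - 1 - p))) t) =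
      (\<Sum>i=1..a ! k. nth_deriv T (a ! k - i) (\<lambda>s. block a k (g s) $ (i - 1)) t)"
    by (rule sum.reindex_bij_witness[of _ "\<lambda>i. a ! k - i" "\<lambda>p. a ! k - p"]) (use pos in auto)
  then show ?thesis
    using chain_sol_index[where g = g and t = t, OF g_carrier[OF t] k l] by simp
qed

text \<open>For X = K^T x the identities L^T K = N and K K^T = I turn the equation into N X' = X +
  g, so X is the chain solution. Applying K recovers x, and as X lies in the range of K^T its last
  entries vanish.\<close>

lemma overdetermined_necessary:
  assumes pos: "\<forall>k\<in>set a. k \<ge> 1"
    and x: "vec_deriv T (sum_list a - length a) x x'"
    and eq: "\<And>t. t \<in> {0..T} \<Longrightarrow>
      transpose_mat (L_mat a) *\<^sub>v x' t = transpose_mat (K_mat a) *\<^sub>v x t + g t"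
    and t: "t \<in> {0..T}"
  shows "x t = K_mat a *\<^sub>v chain_sol T a g t"
    and "k < length a \<Longrightarrow> chain_sol T a g t $ (sum_list (take k a) + (a ! k - 1)) = 0"
proof -
  note K = canonical_mat_carrier(1)[OF pos] and L = canonical_mat_carrier(2)[OF pos]
  have tK: "transpose_mat (K_mat a) \<in> carrier_mat (sum_list a) (sum_list a - length a)"
    and tL: "transpose_mat (L_mat a) \<in> carrier_mat (sum_list a) (sum_list a - length a)"
    using K L by (simp_all add: transpose_carrier_mat)
  have KtK: "K_mat a *\<^sub>v (transpose_mat (K_mat a) *\<^sub>v y) = y" if "y \<in> carrier_vec (sum_list a - length a)" for y
    using assoc_mult_mat_vec[OF K tK that] canonical_identities(3)[OF pos] that by simp
  have X: "transpose_mat (K_mat a) *\<^sub>v x t = chain_sol T a g t" if "t \<in> {0..T}" for t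
  proof (rule chain_sol_unique[OF vec_deriv_mult[OF tK x] _ that])
    fix t assume t: "t \<in> {0..T}"
    have x't: "x' t \<in> carrier_vec (sum_list a - length a)" using vec_deriv_carrier(2)[OF x t] .
    have "N_mat a *\<^sub>v (transpose_mat (K_mat a) *\<^sub>v x' t) =
        transpose_mat (L_mat a) *\<^sub>v (K_mat a *\<^sub>v (transpose_mat (K_mat a) *\<^sub>v x' t))"
      unfolding canonical_identities(4)[OF pos, symmetric]
      by (rule assoc_mult_mat_vec[OF tL K mult_mat_vec_carrier[OF tK x't]])
    then show "N_mat a *\<^sub>v (transpose_mat (K_mat a) *\<^sub>v x' t) = transpose_mat (K_mat a) *\<^sub>v x t + g t"
      unfolding KtK[OF x't] eq[OF t] .
  qed
  show "x t = K_mat a *\<^sub>v chain_sol T a g t"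
    using KtK[OF vec_deriv_carrier(1)[OF x t]] X[OF t] by simp
  then have "chain_sol T a g t = transpose_mat (K_mat a) *\<^sub>v (K_mat a *\<^sub>v chain_sol T a g t)"
    using X[OF t] by simp
  moreover assume k: "k < length a"
  ultimately have "chain_sol T a g t $ (sum_list (take k a) + (a ! k - 1)) =
      (transpose_mat (K_mat a) *\<^sub>v (K_mat a *\<^sub>v chain_sol T a g t)) $ (sum_list (take k a) + (a ! k - 1))"
    by simp
  also have "\<dots> = 0"
    using k pos by (subst trans_K_K_index[OF pos chain_sol_carrier k]) (auto simp: Suc_le_eq)
  finally show "chain_sol T a g t $ (sum_list (take k a) + (a ! k - 1)) = 0" .
qed

text \<open>Vanishing last entries mean that K^T K fixes the chain solution S. Hence x = K S
  satisfies K^T x = S, and L^T x' = N S' is the right-hand side by the chain equation.\<close>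

lemma overdetermined_sufficient:
  assumes pos: "\<forall>k\<in>set a. k \<ge> 1"
    and last: "\<And>k t. k < length a \<Longrightarrow> t \<in> {0..T} \<Longrightarrow> chain_sol T a g t $ (sum_list (take k a) + (a ! k - 1)) = 0"
  defines "x \<equiv> \<lambda>t. K_mat a *\<^sub>v chain_sol T a g t"
    and "x' \<equiv> \<lambda>t. K_mat a *\<^sub>v deriv_vec T 1 (chain_sol T a g) t"
  shows "vec_deriv T (sum_list a - length a) x x'" "Ck_vec 0 T (sum_list a - length a) x'"
    and "t \<in> {0..T} \<Longrightarrow> transpose_mat (L_mat a) *\<^sub>v x' t = transpose_mat (K_mat a) *\<^sub>v x t + g t"
proof -
  note K = canonical_mat_carrier(1)[OF pos] and L = canonical_mat_carrier(2)[OF pos]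
  have tK: "transpose_mat (K_mat a) \<in> carrier_mat (sum_list a) (sum_list a - length a)"
    and tL: "transpose_mat (L_mat a) \<in> carrier_mat (sum_list a) (sum_list a - length a)"
    using K L by (simp_all add: transpose_carrier_mat)
  note S = Ck_vec_1_deriv[OF chain_sol_C1]
  show "vec_deriv T (sum_list a - length a) x x'"
    unfolding x_def x'_def by (rule vec_deriv_mult[OF K S(1)])
  show "Ck_vec 0 T (sum_list a - length a) x'"
    unfolding x'_def by (rule Ck_vec_0_mult[OF K S(2)])
  have X: "transpose_mat (K_mat a) *\<^sub>v x t = chain_sol T a g t" if t: "t \<in> {0..T}" for t
  proof (rule vec_eq_blockI)
    fix k i assume k: "k < length a" and i: "i < a ! k"
    then have "i < a ! k - 1 \<or> i = a ! k - 1" by auto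
    then show "(transpose_mat (K_mat a) *\<^sub>v x t) $ (sum_list (take k a) + i) =
        chain_sol T a g t $ (sum_list (take k a) + i)"
      unfolding x_def trans_K_K_index[OF pos chain_sol_carrier k i] using last[OF k t] by auto
  qed (use tK in \<open>auto simp: x_def\<close>)
  assume t: "t \<in> {0..T}"
  let ?S' = "deriv_vec T 1 (chain_sol T a g) t"
  have S': "?S' \<in> carrier_vec (sum_list a)" by (rule vec_deriv_carrier(2)[OF S(1) t])
  have "transpose_mat (L_mat a) *\<^sub>v x' t = N_mat a *\<^sub>v ?S'"
    unfolding x'_def canonical_identities(4)[OF pos, symmetric]
    by (rule assoc_mult_mat_vec[OF tL K S', symmetric])
  then show "transpose_mat (L_mat a) *\<^sub>v x' t = transpose_mat (K_mat a) *\<^sub>v x t + g t"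
    unfolding X[OF t] chain_sol_eq[OF t] .
qed

end

section \<open>Underdetermined blocks\<close>

lemma vec_add_rotate:
  fixes u v w :: "real vec"
  assumes "u \<in> carrier_vec p" "v \<in> carrier_vec p" "w \<in> carrier_vec p"
  shows "u + v + w = v + (w + u)"
  using assms by (intro eq_vecI) auto

definition under_input :: "nat list \<Rightarrow> (real \<Rightarrow> real vec) \<Rightarrow> (real \<Rightarrow> real vec) \<Rightarrow> real \<Rightarrow> real vec" where
  "under_input a g \<phi> s = transpose_mat (L_mat a) *\<^sub>v (g s + Mbar_mat a *\<^sub>v \<phi> s)"

lemma under_input_cont:
  assumes pos: "\<forall>k\<in>set a. k \<ge> 1"
    and "Ck_vec 0 T (sum_list a - length a) g" "Ck_vec 0 T (length a) \<phi>"
  shows "Ck_vec 0 T (sum_list a) (under_input a g \<phi>)"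
  unfolding under_input_def
  using canonical_mat_carrier[OF pos]
  by (intro Ck_vec_0_mult[of _ _ "sum_list a - length a"] Ck_vec_0_add[OF assms(2)]
      Ck_vec_0_mult[OF _ assms(3)]) (auto simp: transpose_carrier_mat)

text \<open>Since L M = 0 and L L^T = I, only \<open>L_mat a\<close> applied to the initial value
  survives as data of the differential equation; it becomes the second half of the parameter vector
  of the boundary problem.\<close>

lemma underdetermined_necessary:
  assumes T: "T > 0" and pos: "\<forall>k\<in>set a. k \<ge> 1"
    and g: "Ck_vec 0 T (sum_list a - length a) g"
    and x: "vec_deriv T (sum_list a) x x'"
    and eq: "\<And>t. t \<in> {0..T} \<Longrightarrow> L_mat a *\<^sub>v x' t = K_mat a *\<^sub>v x t + g t"
    and \<phi>: "\<And>t. t \<in> {0..T} \<Longrightarrow> \<phi> t = transpose_mat (M_mat a) *\<^sub>v x t"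
    and t: "t \<in> {0..T}"
  shows "x t = mat_exp (t \<cdot>\<^sub>m N_mat a) *\<^sub>v (transpose_mat (L_mat a) *\<^sub>v (L_mat a *\<^sub>v x 0)) +
    (M_mat a *\<^sub>v \<phi> t + integral_vec (sum_list a) 0 t (\<lambda>s. mat_exp ((t - s) \<cdot>\<^sub>m N_mat a) *\<^sub>v under_input a g \<phi> s))"
proof -
  note K = canonical_mat_carrier(1)[OF pos] and L = canonical_mat_carrier(2)[OF pos]
    and M = canonical_mat_carrier(3)[OF pos] and Mb = canonical_mat_carrier(4)[OF pos]
  let ?b = "sum_list a - length a"
  have tL: "transpose_mat (L_mat a) \<in> carrier_mat (sum_list a) ?b"
    and tM: "transpose_mat (M_mat a) \<in> carrier_mat (length a) (sum_list a)"
    using L M by (simp_all add: transpose_carrier_mat)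
  have \<phi>0: "Ck_vec 0 T (length a) \<phi>"
    by (rule Ck_vec_cong[OF T Ck_vec_0_mult[OF tM vec_deriv_cont[OF x]]]) (simp only: \<phi>)
  let ?z = "\<lambda>t. transpose_mat (L_mat a) *\<^sub>v (L_mat a *\<^sub>v x t)"
  have split: "x t = M_mat a *\<^sub>v \<phi> t + ?z t" if t: "t \<in> {0..T}" for t
  proof -
    have xt: "x t \<in> carrier_vec (sum_list a)" using vec_deriv_carrier(1)[OF x t] .
    have "x t = (M_mat a * transpose_mat (M_mat a) + transpose_mat (L_mat a) * L_mat a) *\<^sub>v x t"
      unfolding canonical_identities(7)[OF pos] using xt by simp
    also have "\<dots> = M_mat a *\<^sub>v \<phi> t + ?z t"
      unfolding add_mult_distrib_mat_vec[OF mult_carrier_mat[OF M tM] mult_carrier_mat[OF tL L] xt]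
        assoc_mult_mat_vec[OF M tM xt] assoc_mult_mat_vec[OF tL L xt] \<phi>[OF t] ..
    finally show ?thesis .
  qed
  have z: "vec_deriv T (sum_list a) ?z (\<lambda>t. N_mat a *\<^sub>v ?z t + under_input a g \<phi> t)"
  proof (rule vec_deriv_cong[OF vec_deriv_mult[OF tL vec_deriv_mult[OF L x]]])
    fix t assume t: "t \<in> {0..T}"
    have xt: "x t \<in> carrier_vec (sum_list a)" using vec_deriv_carrier(1)[OF x t] .
    have zt: "?z t \<in> carrier_vec (sum_list a)"
      by (intro mult_mat_vec_carrier[OF tL] mult_mat_vec_carrier[OF L] xt)
    have \<phi>t: "\<phi> t \<in> carrier_vec (length a)" using Ck_vec_carrier[OF \<phi>0 t] .
    have gt: "g t \<in> carrier_vec ?b" using Ck_vec_carrier[OF g t] .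
    have Mt: "M_mat a *\<^sub>v \<phi> t \<in> carrier_vec (sum_list a)" by (rule mult_mat_vec_carrier[OF M \<phi>t])
    have Mbt: "Mbar_mat a *\<^sub>v \<phi> t \<in> carrier_vec ?b" by (rule mult_mat_vec_carrier[OF Mb \<phi>t])
    have Kz: "K_mat a *\<^sub>v ?z t \<in> carrier_vec ?b" by (rule mult_mat_vec_carrier[OF K zt])
    have "K_mat a *\<^sub>v x t = K_mat a *\<^sub>v (M_mat a *\<^sub>v \<phi> t) + K_mat a *\<^sub>v ?z t"
      using mult_add_distrib_mat_vec[OF K Mt zt] split[OF t] by simp
    also have "K_mat a *\<^sub>v (M_mat a *\<^sub>v \<phi> t) = Mbar_mat a *\<^sub>v \<phi> t"
      unfolding assoc_mult_mat_vec[OF K M \<phi>t, symmetric] canonical_identities(5)[OF pos] ..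
    finally have "K_mat a *\<^sub>v x t + g t = K_mat a *\<^sub>v ?z t + (g t + Mbar_mat a *\<^sub>v \<phi> t)"
      using vec_add_rotate[OF Mbt Kz gt] by simp
    then have "transpose_mat (L_mat a) *\<^sub>v (L_mat a *\<^sub>v x' t) =
        transpose_mat (L_mat a) *\<^sub>v (K_mat a *\<^sub>v ?z t) + under_input a g \<phi> t"
      unfolding eq[OF t] under_input_def
      using mult_add_distrib_mat_vec[OF tL Kz add_carrier_vec[OF gt Mbt]] by simp
    also have "transpose_mat (L_mat a) *\<^sub>v (K_mat a *\<^sub>v ?z t) = N_mat a *\<^sub>v ?z t"
      unfolding assoc_mult_mat_vec[OF tL K zt, symmetric] canonical_identities(4)[OF pos] ..
    finally show "N_mat a *\<^sub>v ?z t + under_input a g \<phi> t = transpose_mat (L_mat a) *\<^sub>v (L_mat a *\<^sub>v x' t)" ..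
  qed simp
  have "?z t = mat_exp (t \<cdot>\<^sub>m N_mat a) *\<^sub>v ?z 0 +
      integral_vec (sum_list a) 0 t (\<lambda>s. mat_exp ((t - s) \<cdot>\<^sub>m N_mat a) *\<^sub>v under_input a g \<phi> s)"
    by (rule linear_ode_unique[OF T N_mat_carrier under_input_cont[OF pos g \<phi>0] z t])
  moreover have "M_mat a *\<^sub>v \<phi> t \<in> carrier_vec (sum_list a)"
    by (rule mult_mat_vec_carrier[OF M Ck_vec_carrier[OF \<phi>0 t]])
  ultimately show ?thesis
    using split[OF t] carrier_matD[OF mat_exp_carrier[OF N_mat_carrier[of a], of t]] 
    by (intro eq_vecI) (auto simp: integral_vec_def)
qed

text \<open>The derivative of \<open>\<phi>\<close> makes \<open>x\<close> differentiable but drops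
  out of the equation because L M = 0. The last property shows that the parameter
  \<open>\<phi>\<close> really is the free part of the constructed \<open>x\<close>.\<close>

lemma underdetermined_sufficient:
  assumes T: "T > 0" and pos: "\<forall>k\<in>set a. k \<ge> 1"
    and g: "Ck_vec 0 T (sum_list a - length a) g"
    and \<phi>: "Ck_vec 1 T (length a) \<phi>" and y: "y \<in> carrier_vec (sum_list a - length a)"
  defines "x \<equiv> \<lambda>t. mat_exp (t \<cdot>\<^sub>m N_mat a) *\<^sub>v (transpose_mat (L_mat a) *\<^sub>v y) +
    (M_mat a *\<^sub>v \<phi> t + integral_vec (sum_list a) 0 t (\<lambda>s. mat_exp ((t - s) \<cdot>\<^sub>m N_mat a) *\<^sub>v under_input a g \<phi> s))"
  obtains x' where "vec_deriv T (sum_list a) x x'" "Ck_vec 0 T (sum_list a) x'"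
    "\<And>t. t \<in> {0..T} \<Longrightarrow> L_mat a *\<^sub>v x' t = K_mat a *\<^sub>v x t + g t"
    "\<And>t. t \<in> {0..T} \<Longrightarrow> transpose_mat (M_mat a) *\<^sub>v x t = \<phi> t"
proof -
  note K = canonical_mat_carrier(1)[OF pos] and L = canonical_mat_carrier(2)[OF pos]
    and M = canonical_mat_carrier(3)[OF pos] and Mb = canonical_mat_carrier(4)[OF pos]
  let ?b = "sum_list a - length a"
  have tL: "transpose_mat (L_mat a) \<in> carrier_mat (sum_list a) ?b"
    and tM: "transpose_mat (M_mat a) \<in> carrier_mat (length a) (sum_list a)"
    using L M by (simp_all add: transpose_carrier_mat)
  note \<phi>' = Ck_vec_1_deriv[OF \<phi>] and \<phi>0 = Ck_vec_1_imp_0[OF \<phi>]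
  note u = under_input_cont[OF pos g \<phi>0]
  let ?c = "transpose_mat (L_mat a) *\<^sub>v y"
  have c: "?c \<in> carrier_vec (sum_list a)" by (rule mult_mat_vec_carrier[OF tL y])
  let ?z = "\<lambda>t. mat_exp (t \<cdot>\<^sub>m N_mat a) *\<^sub>v ?c +
    integral_vec (sum_list a) 0 t (\<lambda>s. mat_exp ((t - s) \<cdot>\<^sub>m N_mat a) *\<^sub>v under_input a g \<phi> s)"
  let ?z' = "\<lambda>t. N_mat a *\<^sub>v ?z t + under_input a g \<phi> t"
  have z: "vec_deriv T (sum_list a) ?z ?z'" and z0: "?z 0 = ?c"
    using variation_of_constants[OF N_mat_carrier u c] by auto
  have zc: "?z t \<in> carrier_vec (sum_list a)" if "t \<in> {0..T}" for t
    using vec_deriv_carrier(1)[OF z that] .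
  have Nz: "N_mat a *\<^sub>v ?z t = transpose_mat (L_mat a) *\<^sub>v (K_mat a *\<^sub>v ?z t)" if t: "t \<in> {0..T}" for t
    unfolding assoc_mult_mat_vec[OF tL K zc[OF t], symmetric] canonical_identities(4)[OF pos] ..
  have x: "x t = M_mat a *\<^sub>v \<phi> t + ?z t" if t: "t \<in> {0..T}" for t
    unfolding x_def using zc[OF t] mult_mat_vec_carrier[OF M Ck_vec_carrier[OF \<phi>0 t]]
      carrier_matD[OF mat_exp_carrier[OF N_mat_carrier[of a], of t]]
    by (intro eq_vecI) (auto simp: integral_vec_def)
  let ?x' = "\<lambda>t. M_mat a *\<^sub>v deriv_vec T 1 \<phi> t + ?z' t"
  have 1: "vec_deriv T (sum_list a) x ?x'"
    by (rule vec_deriv_cong[OF vec_deriv_add[OF vec_deriv_mult[OF M \<phi>'(1)] z]]) (simp_all only: x)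
  have 2: "Ck_vec 0 T (sum_list a) ?x'"
    by (intro Ck_vec_0_add Ck_vec_0_mult[OF M \<phi>'(2)] Ck_vec_0_mult[OF N_mat_carrier] vec_deriv_cont[OF z] u)
  have LM: "transpose_mat (M_mat a) * transpose_mat (L_mat a) = 0\<^sub>m (length a) ?b"
    using transpose_mult[OF L M] canonical_identities(1)[OF pos] by simp
  have 3: "L_mat a *\<^sub>v ?x' t = K_mat a *\<^sub>v x t + g t" if t: "t \<in> {0..T}" for t
  proof -
    have \<phi>t: "\<phi> t \<in> carrier_vec (length a)" using Ck_vec_carrier[OF \<phi>0 t] .
    have \<phi>'t: "deriv_vec T 1 \<phi> t \<in> carrier_vec (length a)" using vec_deriv_carrier(2)[OF \<phi>'(1) t] .
    have gt: "g t \<in> carrier_vec ?b" using Ck_vec_carrier[OF g t] .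
    have zt: "?z t \<in> carrier_vec (sum_list a)" using zc[OF t] .
    have ut: "under_input a g \<phi> t \<in> carrier_vec (sum_list a)" using Ck_vec_carrier[OF u t] .
    have Mbt: "Mbar_mat a *\<^sub>v \<phi> t \<in> carrier_vec ?b" by (rule mult_mat_vec_carrier[OF Mb \<phi>t])
    have Kz: "K_mat a *\<^sub>v ?z t \<in> carrier_vec ?b" by (rule mult_mat_vec_carrier[OF K zt])
    have Mt: "M_mat a *\<^sub>v \<phi> t \<in> carrier_vec (sum_list a)" by (rule mult_mat_vec_carrier[OF M \<phi>t])
    have LtL: "L_mat a *\<^sub>v (transpose_mat (L_mat a) *\<^sub>v v) = v" if "v \<in> carrier_vec ?b" for v
      using assoc_mult_mat_vec[OF L tL that] canonical_identities(2)[OF pos] that by simp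
    have "L_mat a *\<^sub>v ?x' t = L_mat a *\<^sub>v (M_mat a *\<^sub>v deriv_vec T 1 \<phi> t) + L_mat a *\<^sub>v ?z' t"
      by (rule mult_add_distrib_mat_vec[OF L mult_mat_vec_carrier[OF M \<phi>'t] vec_deriv_carrier(2)[OF z t]])
    also have "L_mat a *\<^sub>v (M_mat a *\<^sub>v deriv_vec T 1 \<phi> t) = 0\<^sub>v ?b"
      unfolding assoc_mult_mat_vec[OF L M \<phi>'t, symmetric] canonical_identities(1)[OF pos]
      using \<phi>'t by (intro eq_vecI) auto
    also have "L_mat a *\<^sub>v ?z' t = L_mat a *\<^sub>v (N_mat a *\<^sub>v ?z t) + L_mat a *\<^sub>v under_input a g \<phi> t"
      by (rule mult_add_distrib_mat_vec[OF L mult_mat_vec_carrier[OF N_mat_carrier zt] ut])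
    also have "L_mat a *\<^sub>v (N_mat a *\<^sub>v ?z t) = K_mat a *\<^sub>v ?z t"
      unfolding Nz[OF t] by (rule LtL[OF Kz])
    also have "L_mat a *\<^sub>v under_input a g \<phi> t = g t + Mbar_mat a *\<^sub>v \<phi> t"
      unfolding under_input_def by (rule LtL[OF add_carrier_vec[OF gt Mbt]])
    also have "Mbar_mat a *\<^sub>v \<phi> t = K_mat a *\<^sub>v (M_mat a *\<^sub>v \<phi> t)"
      unfolding assoc_mult_mat_vec[OF K M \<phi>t, symmetric] canonical_identities(5)[OF pos] ..
    also have "0\<^sub>v ?b + (K_mat a *\<^sub>v ?z t + (g t + K_mat a *\<^sub>v (M_mat a *\<^sub>v \<phi> t))) =
        K_mat a *\<^sub>v (M_mat a *\<^sub>v \<phi> t) + K_mat a *\<^sub>v ?z t + g t"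
      unfolding vec_add_rotate[OF mult_mat_vec_carrier[OF K Mt] Kz gt]
      by (intro left_zero_vec add_carrier_vec Kz gt mult_mat_vec_carrier[OF K Mt])
    also have "K_mat a *\<^sub>v (M_mat a *\<^sub>v \<phi> t) + K_mat a *\<^sub>v ?z t = K_mat a *\<^sub>v x t"
      unfolding x[OF t] by (rule mult_add_distrib_mat_vec[OF K Mt zt, symmetric])
    finally show ?thesis .
  qed
  have MLz: "transpose_mat (M_mat a) *\<^sub>v (transpose_mat (L_mat a) *\<^sub>v v) = 0\<^sub>v (length a)"
    if "v \<in> carrier_vec ?b" for v
    unfolding assoc_mult_mat_vec[OF tM tL that, symmetric] LM using that by (intro eq_vecI) auto
  \<comment> \<open>Both terms of \<open>?z'\<close> lie in the range of L^T, which M^T annihilates.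
    So M^T applied to \<open>?z\<close> is constant, and it starts at 0 because \<open>?z\<close>
    starts in that range too.\<close>
  have Mz': "vec_deriv T (length a) (\<lambda>t. transpose_mat (M_mat a) *\<^sub>v ?z t) (\<lambda>t. 0\<^sub>v (length a))"
  proof (rule vec_deriv_cong[OF vec_deriv_mult[OF tM z]])
    fix t assume t: "t \<in> {0..T}"
    have zt: "?z t \<in> carrier_vec (sum_list a)" using zc[OF t] .
    have ut: "under_input a g \<phi> t \<in> carrier_vec (sum_list a)" using Ck_vec_carrier[OF u t] .
    have Kz: "K_mat a *\<^sub>v ?z t \<in> carrier_vec ?b" by (rule mult_mat_vec_carrier[OF K zt])
    have "transpose_mat (M_mat a) *\<^sub>v ?z' t =
        transpose_mat (M_mat a) *\<^sub>v (N_mat a *\<^sub>v ?z t) + transpose_mat (M_mat a) *\<^sub>v under_input a g \<phi> t"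
      by (rule mult_add_distrib_mat_vec[OF tM mult_mat_vec_carrier[OF N_mat_carrier zt] ut])
    also have "transpose_mat (M_mat a) *\<^sub>v (N_mat a *\<^sub>v ?z t) = 0\<^sub>v (length a)"
      unfolding Nz[OF t] by (rule MLz[OF Kz])
    also have "transpose_mat (M_mat a) *\<^sub>v under_input a g \<phi> t = 0\<^sub>v (length a)"
      unfolding under_input_def
      by (intro MLz add_carrier_vec mult_mat_vec_carrier[OF Mb] Ck_vec_carrier[OF g t] Ck_vec_carrier[OF \<phi>0 t])
    finally show "0\<^sub>v (length a) = transpose_mat (M_mat a) *\<^sub>v ?z' t" by simp
  qed simp
  have Mz: "transpose_mat (M_mat a) *\<^sub>v ?z t = 0\<^sub>v (length a)" if t: "t \<in> {0..T}" for t
    using vec_deriv_zero_const[OF Mz' t] unfolding z0 MLz[OF y] .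
  have 4: "transpose_mat (M_mat a) *\<^sub>v x t = \<phi> t" if t: "t \<in> {0..T}" for t
  proof -
    have \<phi>t: "\<phi> t \<in> carrier_vec (length a)" using Ck_vec_carrier[OF \<phi>0 t] .
    have "transpose_mat (M_mat a) *\<^sub>v x t =
        transpose_mat (M_mat a) *\<^sub>v (M_mat a *\<^sub>v \<phi> t) + transpose_mat (M_mat a) *\<^sub>v ?z t"
      unfolding x[OF t] by (rule mult_add_distrib_mat_vec[OF tM mult_mat_vec_carrier[OF M \<phi>t] zc[OF t]])
    also have "transpose_mat (M_mat a) *\<^sub>v (M_mat a *\<^sub>v \<phi> t) = \<phi> t"
      unfolding assoc_mult_mat_vec[OF tM M \<phi>t, symmetric] canonical_identities(6)[OF pos]
      using \<phi>t by simp
    finally show ?thesis unfolding Mz[OF t] using \<phi>t by simp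
  qed
  show ?thesis by (rule that[OF 1 2 3 4])
qed

section \<open>Replacing a continuous free part by a smooth one\<close>

text \<open>Gram--Schmidt with respect to the weight $\omega$; the functions $G_i$ may be linearly dependent.\<close>

lemma weighted_projection:
  fixes G :: "nat \<Rightarrow> real \<Rightarrow> real"
  assumes G: "\<And>i. i < r \<Longrightarrow> continuous_on {0..T} (G i)"
    and \<delta>: "continuous_on {0..T} \<delta>" and \<omega>: "continuous_on {0..T} \<omega>"
    and pos: "\<And>s. s \<in> {0<..<T} \<Longrightarrow> 0 < \<omega> s" and ends: "\<omega> 0 = 0" "\<omega> T = 0" and T: "T > 0"
  shows "\<exists>c. \<forall>j<r. integral {0..T} (\<lambda>s. G j s * (\<omega> s * (\<Sum>i<r. c i * G i s) - \<delta> s)) = 0"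
  using G \<delta>
proof (induction r arbitrary: \<delta>)
  case (Suc r)
  let ?I = "\<lambda>f. integral {0..T} f"
  have G: "continuous_on {0..T} (G i)" if "i < Suc r" for i using Suc.prems(1) that by auto
  \<comment> \<open>The induction hypothesis is used twice: for the new function itself, whose
    residual \<open>e\<close> is then orthogonal to the earlier ones with respect to the weight, and
    for \<open>\<delta>\<close>, which gives the approximation \<open>u\<close> by the earlier
    ones.\<close>
  have "continuous_on {0..T} (\<lambda>s. \<omega> s * G r s)" using \<omega> G by (intro continuous_intros) auto
  from Suc.IH[OF _ this] G obtain a
    where a: "\<And>j. j < r \<Longrightarrow> ?I (\<lambda>s. G j s * (\<omega> s * (\<Sum>i<r. a i * G i s) - \<omega> s * G r s)) = 0"
    by auto
  from Suc.IH[OF _ Suc.prems(2)] G obtain c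
    where c: "\<And>j. j < r \<Longrightarrow> ?I (\<lambda>s. G j s * (\<omega> s * (\<Sum>i<r. c i * G i s) - \<delta> s)) = 0"
    by auto
  define e where "e s = G r s - (\<Sum>i<r. a i * G i s)" for s
  define u where "u s = (\<Sum>i<r. c i * G i s)" for s
  have ec: "continuous_on {0..T} e" and uc: "continuous_on {0..T} u"
    unfolding e_def u_def using G by (auto intro!: continuous_intros)
  note cont = continuous_on_mult continuous_on_diff continuous_on_add continuous_on_const
    \<omega> ec uc Suc.prems(2) G continuous_on_sum
  have aj: "?I (\<lambda>s. G j s * (\<omega> s * e s)) = 0" if "j < r" for j
  proof -
    have "?I (\<lambda>s. G j s * (\<omega> s * e s)) = - ?I (\<lambda>s. G j s * (\<omega> s * (\<Sum>i<r. a i * G i s) - \<omega> s * G r s))"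
      unfolding integral_neg[symmetric] by (rule integral_cong) (simp add: e_def algebra_simps)
    then show ?thesis using a[OF that] by simp
  qed
  define E where "E = ?I (\<lambda>s. e s * (\<omega> s * e s))"
  \<comment> \<open>The coefficient that makes the remaining error orthogonal to \<open>e\<close>.
    For E = 0 the residual contributes nothing and any value would do; 0 avoids the
    division.\<close>
  define l where "l = (if E = 0 then 0 else - ?I (\<lambda>s. e s * (\<omega> s * u s - \<delta> s)) / E)"
  define D where "D s = \<omega> s * (u s + l * e s) - \<delta> s" for s
  have Dc: "continuous_on {0..T} D" unfolding D_def by (intro cont)
  have split: "?I (\<lambda>s. f s * D s) = ?I (\<lambda>s. f s * (\<omega> s * u s - \<delta> s)) + l * ?I (\<lambda>s. f s * (\<omega> s * e s))"
    if f: "continuous_on {0..T} f" for f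
  proof -
    have "?I (\<lambda>s. f s * D s) = ?I (\<lambda>s. f s * (\<omega> s * u s - \<delta> s) + l * (f s * (\<omega> s * e s)))"
      by (rule integral_cong) (simp add: D_def algebra_simps)
    also have "\<dots> = ?I (\<lambda>s. f s * (\<omega> s * u s - \<delta> s)) + ?I (\<lambda>s. l * (f s * (\<omega> s * e s)))"
      by (intro integral_add integrable_continuous_real cont f)
    finally show ?thesis by simp
  qed
  have j: "?I (\<lambda>s. G j s * D s) = 0" if "j < r" for j
    using split[OF G, of j] aj[OF that] c[OF that] that by (simp add: u_def)
  have eD: "?I (\<lambda>s. e s * D s) = 0"
  proof (cases "E = 0")
    case False
    then show ?thesis using split[OF ec] by (simp add: l_def E_def)
  next
    \<comment> \<open>A continuous nonnegative integrand with integral 0 vanishes, and the weight is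
      positive inside, so \<open>e\<close> is 0 there; the two end points are negligible for the
      integral.\<close>
    case True
    have \<omega>_nonneg: "0 \<le> \<omega> s" if "s \<in> {0..T}" for s
      using that pos[of s] ends by (cases "s = 0 \<or> s = T") (auto intro: less_imp_le)
    have wc: "continuous_on {0..T} (\<lambda>s. e s * (\<omega> s * e s))" by (intro cont)
    have "e s = 0" if s: "s \<in> {0<..<T}" for s
    proof -
      have "e s * (\<omega> s * e s) = 0"
      proof (rule has_integral_0_cbox_imp_0[where a = 0 and b = T and f = "\<lambda>s. e s * (\<omega> s * e s)"])
        show "continuous_on (cbox 0 T) (\<lambda>s. e s * (\<omega> s * e s))" using wc by simp
        show "0 \<le> e s * (\<omega> s * e s)" if "s \<in> box 0 T" for s
          using \<omega>_nonneg[of s] that mult_nonneg_nonneg[of "\<omega> s" "e s * e s"] by (simp add: mult_ac)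
        show "((\<lambda>s. e s * (\<omega> s * e s)) has_integral 0) (cbox 0 T)"
          using integrable_integral[OF integrable_continuous_real[OF wc]] True by (simp add: E_def)
      qed (use s T in auto)
      then show ?thesis using pos[OF s] by simp
    qed
    then have "?I (\<lambda>s. e s * D s) = ?I (\<lambda>s. 0)"
      by (intro integral_spike[of "{0, T}"]) auto
    then show ?thesis by simp
  qed
  have rD: "?I (\<lambda>s. G r s * D s) = 0"
  proof -
    have "?I (\<lambda>s. G r s * D s) = ?I (\<lambda>s. e s * D s + (\<Sum>i<r. a i * (G i s * D s)))"
      by (rule integral_cong) (simp add: e_def algebra_simps sum_distrib_left)
    also have "\<dots> = ?I (\<lambda>s. e s * D s) + ?I (\<lambda>s. \<Sum>i<r. a i * (G i s * D s))"
      by (intro integral_add integrable_continuous_real cont Dc) auto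
    also have "?I (\<lambda>s. \<Sum>i<r. a i * (G i s * D s)) = (\<Sum>i<r. ?I (\<lambda>s. a i * (G i s * D s)))"
      by (intro integral_sum integrable_continuous_real cont Dc) auto
    finally show ?thesis using eD j by simp
  qed
  \<comment> \<open>Coefficients of u + l e, with \<open>e\<close> expanded in the functions
    \<open>G\<close>.\<close>
  define c' where "c' i = (if i = r then l else c i - l * a i)" for i
  have "\<omega> s * (\<Sum>i<Suc r. c' i * G i s) - \<delta> s = D s" for s
  proof -
    have "(\<Sum>i<Suc r. c' i * G i s) = (\<Sum>i<r. (c i - l * a i) * G i s) + l * G r s"
      by (simp add: c'_def)
    also have "\<dots> = u s + l * e s"
      by (simp add: u_def e_def algebra_simps sum_subtractf sum_distrib_left)
    finally show ?thesis by (simp add: D_def)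
  qed
  then show ?case using j rD by (intro exI[of _ c']) (auto simp: less_Suc_eq)
qed simp

text \<open>The function \<open>\<psi>\<close> is the linear interpolation of the end values plus
  s(T - s) times a combination of the \<open>G i\<close>. The factor vanishes at both ends, so the
  coefficients from \<open>weighted_projection\<close> can match the integrals freely;
  \<open>\<psi>\<close> is C^1 because the \<open>G i\<close> are.\<close>

lemma smooth_with_same_moments:
  fixes G G' :: "nat \<Rightarrow> real \<Rightarrow> real"
  assumes T: "T > 0" and \<phi>: "continuous_on {0..T} \<phi>"
    and G: "\<And>i t. i < r \<Longrightarrow> t \<in> {0..T} \<Longrightarrow> (G i has_real_derivative G' i t) (at t within {0..T})"
    and G': "\<And>i. i < r \<Longrightarrow> continuous_on {0..T} (G' i)"
  obtains \<psi> where "Ck 1 T \<psi>" "\<psi> 0 = \<phi> 0" "\<psi> T = \<phi> T"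
    "\<And>j. j < r \<Longrightarrow> integral {0..T} (\<lambda>s. G j s * \<psi> s) = integral {0..T} (\<lambda>s. G j s * \<phi> s)"
proof -
  define m where "m = (\<phi> T - \<phi> 0) / T"
  let ?\<delta> = "\<lambda>s. \<phi> s - (\<phi> 0 + m * s)" and ?\<omega> = "\<lambda>s::real. s * (T - s)"
  have Gc: "continuous_on {0..T} (G i)" if "i < r" for i
    by (rule DERIV_continuous_on[OF G[OF that]])
  have \<delta>c: "continuous_on {0..T} ?\<delta>" using \<phi> by (intro continuous_intros)
  have "\<exists>c. \<forall>j<r. integral {0..T} (\<lambda>s. G j s * (?\<omega> s * (\<Sum>i<r. c i * G i s) - ?\<delta> s)) = 0"
    by (rule weighted_projection[OF Gc \<delta>c _ _ _ _ T]) (auto intro!: continuous_intros)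
  then obtain c where c: "\<And>j. j < r \<Longrightarrow>
      integral {0..T} (\<lambda>s. G j s * (?\<omega> s * (\<Sum>i<r. c i * G i s) - ?\<delta> s)) = 0"
    by blast
  define \<psi> where "\<psi> s = \<phi> 0 + m * s + ?\<omega> s * (\<Sum>i<r. c i * G i s)" for s
  have d: "(\<psi> has_real_derivative
      (m + ((T - 2 * t) * (\<Sum>i<r. c i * G i t) + ?\<omega> t * (\<Sum>i<r. c i * G' i t)))) (at t within {0..T})"
    if t: "t \<in> {0..T}" for t
    unfolding \<psi>_def
    by (rule derivative_eq_intros DERIV_sum G t refl | simp)+ (auto simp: algebra_simps)
  have "Ck 1 T \<psi>"
    by (rule Ck_1I(1)[OF T d]) (use Gc G' in \<open>auto intro!: continuous_intros\<close>)
  moreover have "\<psi> 0 = \<phi> 0" "\<psi> T = \<phi> T"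
    using T by (simp_all add: \<psi>_def m_def)
  moreover have "integral {0..T} (\<lambda>s. G j s * \<psi> s) = integral {0..T} (\<lambda>s. G j s * \<phi> s)" if "j < r" for j
  proof -
    have \<psi>c: "continuous_on {0..T} \<psi>" by (rule DERIV_continuous_on[OF d])
    have "integral {0..T} (\<lambda>s. G j s * \<psi> s) - integral {0..T} (\<lambda>s. G j s * \<phi> s) =
        integral {0..T} (\<lambda>s. G j s * \<psi> s - G j s * \<phi> s)"
      by (intro integral_diff[symmetric] integrable_continuous_real continuous_on_mult Gc that \<phi> \<psi>c)
    also have "\<dots> = integral {0..T} (\<lambda>s. G j s * (?\<omega> s * (\<Sum>i<r. c i * G i s) - ?\<delta> s))"
      by (rule integral_cong) (simp add: \<psi>_def algebra_simps)
    finally show ?thesis using c[OF that] by simp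
  qed
  ultimately show ?thesis by (rule that)
qed

text \<open>Up to a term independent of the free part, each entry of the integral is a sum over the
  components of the free part of integrals against fixed kernels. Hence each component can be
  replaced separately, with one integral to preserve per entry.\<close>

lemma smooth_free_part:
  assumes T: "T > 0" and pos: "\<forall>k\<in>set a. k \<ge> 1"
    and g: "Ck_vec 0 T (sum_list a - length a) g" and \<phi>: "Ck_vec 0 T (length a) \<phi>"
  obtains \<psi> where "Ck_vec 1 T (length a) \<psi>" "\<psi> 0 = \<phi> 0" "\<psi> T = \<phi> T"
    "integral_vec (sum_list a) 0 T (\<lambda>s. mat_exp ((T - s) \<cdot>\<^sub>m N_mat a) *\<^sub>v under_input a g \<psi> s) =
     integral_vec (sum_list a) 0 T (\<lambda>s. mat_exp ((T - s) \<cdot>\<^sub>m N_mat a) *\<^sub>v under_input a g \<phi> s)"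
proof -
  let ?n = "sum_list a" and ?r = "length a"
  let ?b = "?n - ?r"
  note L = canonical_mat_carrier(2)[OF pos] and Mb = canonical_mat_carrier(4)[OF pos]
  have tL: "transpose_mat (L_mat a) \<in> carrier_mat ?n ?b" using L by (simp add: transpose_carrier_mat)
  let ?X = "\<lambda>s. mat_exp ((T - s) \<cdot>\<^sub>m N_mat a)" and ?LM = "transpose_mat (L_mat a) * Mbar_mat a"
  note N = N_mat_carrier[of a] and X = mat_exp_carrier[OF N_mat_carrier[of a]]
  have LM: "?LM \<in> carrier_mat ?n ?r" by (rule mult_carrier_mat[OF tL Mb])
  \<comment> \<open>The kernel with which component \<open>k\<close> of the free part enters entry
    \<open>j\<close> of the integral: entry (j,k) of the exponential times L^T times
    \<open>Mbar_mat a\<close>. \<open>G'\<close> is its derivative in \<open>s\<close>.\<close>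
  define G where "G k j s = (\<Sum>l<?n. ?X s $$ (j,l) * ?LM $$ (l,k))" for k j s
  define G' where "G' k j s = (\<Sum>l<?n. (N_mat a * ?X s) $$ (j,l) * -1 * ?LM $$ (l,k))" for k j s
  have dX: "((\<lambda>s. ?X s $$ (i,j)) has_real_derivative (N_mat a * ?X t) $$ (i,j) * -1) (at t within S)"
    if "i < ?n" "j < ?n" for i j t S
    by (rule mat_exp_deriv_scaled[OF N that]) (auto intro!: derivative_eq_intros)
  have Xc: "continuous_on S (\<lambda>s. ?X s $$ (i,j))" if "i < ?n" "j < ?n" for i j S
    by (rule DERIV_continuous_on[OF dX[OF that]])
  have dG: "(G k j has_real_derivative G' k j t) (at t within {0..T})" if "j < ?n" for k j t
    unfolding G_def[abs_def] G'_def by (intro DERIV_sum DERIV_cmult_right dX that) auto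
  have Gc: "continuous_on {0..T} (G k j)" if "j < ?n" for k j
    by (rule DERIV_continuous_on[OF dG[OF that]])
  have G'c: "continuous_on {0..T} (G' k j)" if "j < ?n" for k j
  proof -
    have "continuous_on {0..T} (\<lambda>s. (N_mat a * ?X s) $$ (j,l))" if l: "l < ?n" for l
      unfolding mult_mat_index[OF N X \<open>j < ?n\<close> l] by (intro continuous_intros Xc l) simp
    then show ?thesis unfolding G'_def[abs_def] by (intro continuous_intros) simp
  qed
  have \<phi>k: "continuous_on {0..T} (\<lambda>s. \<phi> s $ k)" if "k < ?r" for k
    using \<phi> that by (simp add: Ck_vec_0_iff)
  define ok where "ok k p \<longleftrightarrow> Ck 1 T p \<and> p 0 = \<phi> 0 $ k \<and> p T = \<phi> T $ k \<and>
      (\<forall>j<?n. integral {0..T} (\<lambda>s. G k j s * p s) = integral {0..T} (\<lambda>s. G k j s * \<phi> s $ k))" for k p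
  have "\<exists>p. ok k p" if k: "k < ?r" for k
    using smooth_with_same_moments[OF T \<phi>k[OF k], of ?n "G k" "G' k", OF dG G'c]
    unfolding ok_def by blast
  then have "ok k (SOME p. ok k p)" if "k < ?r" for k
    using that by (intro someI_ex[of "ok k"])
  then obtain p where ok: "\<And>k. k < ?r \<Longrightarrow> ok k (p k)"
    by (rule that)
  then have p: "\<And>k. k < ?r \<Longrightarrow> Ck 1 T (p k)" "\<And>k. k < ?r \<Longrightarrow> p k 0 = \<phi> 0 $ k"
      "\<And>k. k < ?r \<Longrightarrow> p k T = \<phi> T $ k"
      "\<And>k j. k < ?r \<Longrightarrow> j < ?n \<Longrightarrow>
        integral {0..T} (\<lambda>s. G k j s * p k s) = integral {0..T} (\<lambda>s. G k j s * \<phi> s $ k)"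
    by (simp_all only: ok_def)
  define \<psi> where "\<psi> s = vec ?r (\<lambda>k. p k s)" for s
  have \<psi>: "Ck_vec 1 T ?r \<psi>" using p(1) by (auto simp: Ck_vec_def \<psi>_def)
  have "0 \<in> {0..T}" "T \<in> {0..T}" using T by auto
  then have ends: "\<psi> 0 = \<phi> 0" "\<psi> T = \<phi> T"
    using carrier_vecD[OF Ck_vec_carrier[OF \<phi>]] by (auto simp: \<psi>_def p)
  \<comment> \<open>The first integral does not involve \<open>\<chi>\<close>, so equal moments give
    equal integrals.\<close>
  have int: "integral {0..T} (\<lambda>s. (?X s *\<^sub>v under_input a g \<chi> s) $ j) =
      integral {0..T} (\<lambda>s. \<Sum>l<?n. ?X s $$ (j,l) * (transpose_mat (L_mat a) *\<^sub>v g s) $ l) +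
      (\<Sum>k<?r. integral {0..T} (\<lambda>s. G k j s * \<chi> s $ k))"
    if \<chi>: "Ck_vec 0 T ?r \<chi>" and j: "j < ?n" for \<chi> j
  proof -
    have \<chi>k: "continuous_on {0..T} (\<lambda>s. \<chi> s $ k)" if "k < ?r" for k
      using \<chi> that by (simp add: Ck_vec_0_iff)
    have tgc: "continuous_on {0..T} (\<lambda>s. (transpose_mat (L_mat a) *\<^sub>v g s) $ l)" if "l < ?n" for l
      using Ck_vec_0_mult[OF tL g] that by (simp add: Ck_vec_0_iff)
    have "(?X s *\<^sub>v under_input a g \<chi> s) $ j =
        (\<Sum>l<?n. ?X s $$ (j,l) * (transpose_mat (L_mat a) *\<^sub>v g s) $ l) + (\<Sum>k<?r. G k j s * \<chi> s $ k)"
      if s: "s \<in> {0..T}" for s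
    proof -
      have gs: "g s \<in> carrier_vec ?b" and \<chi>s: "\<chi> s \<in> carrier_vec ?r"
        using Ck_vec_carrier[OF g s] Ck_vec_carrier[OF \<chi> s] .
      have u: "under_input a g \<chi> s = transpose_mat (L_mat a) *\<^sub>v g s + ?LM *\<^sub>v \<chi> s"
        unfolding under_input_def assoc_mult_mat_vec[OF tL Mb \<chi>s]
        by (rule mult_add_distrib_mat_vec[OF tL gs mult_mat_vec_carrier[OF Mb \<chi>s]])
      have uc: "under_input a g \<chi> s \<in> carrier_vec ?n"
        unfolding u by (intro add_carrier_vec mult_mat_vec_carrier[OF tL gs] mult_mat_vec_carrier[OF LM \<chi>s])
      have "(?X s *\<^sub>v under_input a g \<chi> s) $ j = (\<Sum>l<?n. ?X s $$ (j,l) * under_input a g \<chi> s $ l)"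
        by (rule mult_mat_vec_index[OF X uc j])
      also have "\<dots> = (\<Sum>l<?n. ?X s $$ (j,l) * (transpose_mat (L_mat a) *\<^sub>v g s) $ l +
          ?X s $$ (j,l) * (\<Sum>k<?r. ?LM $$ (l,k) * \<chi> s $ k))"
      proof (rule sum.cong[OF refl])
        fix l assume "l \<in> {..<?n}"
        then have l: "l < ?n" by simp
        have "under_input a g \<chi> s $ l = (transpose_mat (L_mat a) *\<^sub>v g s) $ l + (?LM *\<^sub>v \<chi> s) $ l"
          unfolding u by (rule index_add_vec(1)) (use l carrier_matD[OF LM] in simp)
        then show "?X s $$ (j,l) * under_input a g \<chi> s $ l =
            ?X s $$ (j,l) * (transpose_mat (L_mat a) *\<^sub>v g s) $ l +
            ?X s $$ (j,l) * (\<Sum>k<?r. ?LM $$ (l,k) * \<chi> s $ k)"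
          unfolding mult_mat_vec_index[OF LM \<chi>s l] by (simp only: distrib_left)
      qed
      also have "\<dots> = (\<Sum>l<?n. ?X s $$ (j,l) * (transpose_mat (L_mat a) *\<^sub>v g s) $ l) +
          (\<Sum>l<?n. \<Sum>k<?r. ?X s $$ (j,l) * ?LM $$ (l,k) * \<chi> s $ k)"
        by (simp only: sum.distrib sum_distrib_left mult.assoc)
      also have "(\<Sum>l<?n. \<Sum>k<?r. ?X s $$ (j,l) * ?LM $$ (l,k) * \<chi> s $ k) = (\<Sum>k<?r. G k j s * \<chi> s $ k)"
        by (subst sum.swap) (simp only: G_def sum_distrib_right)
      finally show ?thesis .
    qed
    then have "integral {0..T} (\<lambda>s. (?X s *\<^sub>v under_input a g \<chi> s) $ j) =
        integral {0..T} (\<lambda>s. (\<Sum>l<?n. ?X s $$ (j,l) * (transpose_mat (L_mat a) *\<^sub>v g s) $ l) +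
          (\<Sum>k<?r. G k j s * \<chi> s $ k))"
      by (rule integral_cong)
    also have "\<dots> = integral {0..T} (\<lambda>s. \<Sum>l<?n. ?X s $$ (j,l) * (transpose_mat (L_mat a) *\<^sub>v g s) $ l) +
        integral {0..T} (\<lambda>s. \<Sum>k<?r. G k j s * \<chi> s $ k)"
      by (intro integral_add integrable_continuous_real continuous_on_sum continuous_on_mult Xc Gc \<chi>k tgc j)
        auto
    also have "integral {0..T} (\<lambda>s. \<Sum>k<?r. G k j s * \<chi> s $ k) =
        (\<Sum>k<?r. integral {0..T} (\<lambda>s. G k j s * \<chi> s $ k))"
      by (intro integral_sum integrable_continuous_real continuous_on_mult Gc \<chi>k j) auto
    finally show ?thesis .
  qed
  have "integral_vec ?n 0 T (\<lambda>s. ?X s *\<^sub>v under_input a g \<psi> s) =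
      integral_vec ?n 0 T (\<lambda>s. ?X s *\<^sub>v under_input a g \<phi> s)"
  proof (rule eq_vecI)
    fix j assume "j < dim_vec (integral_vec ?n 0 T (\<lambda>s. ?X s *\<^sub>v under_input a g \<phi> s))"
    then have j: "j < ?n" by (simp add: integral_vec_def)
    have "(\<Sum>k<?r. integral {0..T} (\<lambda>s. G k j s * \<psi> s $ k)) = (\<Sum>k<?r. integral {0..T} (\<lambda>s. G k j s * \<phi> s $ k))"
      by (rule sum.cong) (use p(4)[OF _ j] in \<open>auto simp: \<psi>_def\<close>)
    then show "integral_vec ?n 0 T (\<lambda>s. ?X s *\<^sub>v under_input a g \<psi> s) $ j =
        integral_vec ?n 0 T (\<lambda>s. ?X s *\<^sub>v under_input a g \<phi> s) $ j"
      using int[OF Ck_vec_1_imp_0[OF \<psi>] j] int[OF \<phi> j] j by (simp add: integral_vec_def)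
  qed (simp add: integral_vec_def)
  then show ?thesis by (rule that[OF \<psi> ends])
qed

section \<open>Splitting the boundary value problem\<close>

lemma diag_block_mat_4_carrier:
  fixes M0 M1 M2 M3 :: "real mat"
  assumes "M0 \<in> carrier_mat r0 c0" "M1 \<in> carrier_mat r1 c1" "M2 \<in> carrier_mat r2 c2" "M3 \<in> carrier_mat r3 c3"
  shows "diag_block_mat [M0, M1, M2, M3] \<in> carrier_mat (r0 + (r1 + (r2 + r3))) (c0 + (c1 + (c2 + c3)))"
    "diag_block_mat [M1, M2, M3] \<in> carrier_mat (r1 + (r2 + r3)) (c1 + (c2 + c3))"
    "diag_block_mat [M2, M3] \<in> carrier_mat (r2 + r3) (c2 + c3)"
  unfolding carrier_mat_def mem_Collect_eq dim_diag_block_mat using assms by simp_all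

lemma diag_block_mat_4_mult_vec:
  fixes M0 M1 M2 M3 :: "real mat"
  assumes M: "M0 \<in> carrier_mat r0 c0" "M1 \<in> carrier_mat r1 c1" "M2 \<in> carrier_mat r2 c2" "M3 \<in> carrier_mat r3 c3"
    and v: "v0 \<in> carrier_vec c0" "v1 \<in> carrier_vec c1" "v2 \<in> carrier_vec c2" "v3 \<in> carrier_vec c3"
  shows "diag_block_mat [M0, M1, M2, M3] *\<^sub>v (v0 @\<^sub>v v1 @\<^sub>v v2 @\<^sub>v v3) =
    M0 *\<^sub>v v0 @\<^sub>v M1 *\<^sub>v v1 @\<^sub>v M2 *\<^sub>v v2 @\<^sub>v M3 *\<^sub>v v3"
proof -
  note c = diag_block_mat_4_carrier[OF M]
  have s: "diag_block_mat [M3] \<in> carrier_mat r3 c3" using M by (simp only: diag_block_mat_singleton)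
  have w3: "v2 @\<^sub>v v3 \<in> carrier_vec (c2 + c3)" by (rule append_carrier_vec[OF v(3,4)])
  have w2: "v1 @\<^sub>v v2 @\<^sub>v v3 \<in> carrier_vec (c1 + (c2 + c3))" by (rule append_carrier_vec[OF v(2) w3])
  show ?thesis
    unfolding diag_block_mat_Cons_mult_vec[OF M(1) c(2) v(1) w2]
      diag_block_mat_Cons_mult_vec[OF M(2) c(3) v(2) w3]
      diag_block_mat_Cons_mult_vec[OF M(3) s v(3,4)] diag_block_mat_singleton ..
qed

lemma col_block_carrier [simp]: "M \<in> carrier_mat r p \<Longrightarrow> col_block M a q \<in> carrier_mat r q"
  by (simp add: col_block_def)

lemma col_block_append_mult_vec:
  fixes M :: "real mat"
  assumes u: "u \<in> carrier_vec p" and w: "w \<in> carrier_vec q"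
  shows "col_block M a (p + q) *\<^sub>v (u @\<^sub>v w) = col_block M a p *\<^sub>v u + col_block M (a + p) q *\<^sub>v w"
proof (rule eq_vecI)
  fix i assume "i < dim_vec (col_block M a p *\<^sub>v u + col_block M (a + p) q *\<^sub>v w)"
  then have i: "i < dim_row M" by (simp add: col_block_def)
  have cb: "col_block M b s \<in> carrier_mat (dim_row M) s" for b s by (simp add: col_block_def)
  have "(col_block M a (p + q) *\<^sub>v (u @\<^sub>v w)) $ i = (\<Sum>j<p + q. col_block M a (p + q) $$ (i,j) * (u @\<^sub>v w) $ j)"
    by (rule mult_mat_vec_index[OF cb append_carrier_vec[OF u w] i])
  also have "\<dots> = (\<Sum>j<p. col_block M a (p + q) $$ (i,j) * (u @\<^sub>v w) $ j) +
      (\<Sum>j<q. col_block M a (p + q) $$ (i,p + j) * (u @\<^sub>v w) $ (p + j))"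
  proof -
    have "(\<Sum>j<p + q. F j) = (\<Sum>j<p. F j) + (\<Sum>j<q. F (p + j))" for F :: "nat \<Rightarrow> real"
      by (induction q) simp_all
    then show ?thesis .
  qed
  also have "(\<Sum>j<p. col_block M a (p + q) $$ (i,j) * (u @\<^sub>v w) $ j) = (\<Sum>j<p. col_block M a p $$ (i,j) * u $ j)"
    using i u w by (intro sum.cong) (auto simp: col_block_def)
  also have "(\<Sum>j<q. col_block M a (p + q) $$ (i,p + j) * (u @\<^sub>v w) $ (p + j)) =
      (\<Sum>j<q. col_block M (a + p) q $$ (i,j) * w $ j)"
    using i u w by (intro sum.cong) (auto simp: col_block_def add.assoc)
  finally show "(col_block M a (p + q) *\<^sub>v (u @\<^sub>v w)) $ i =
      (col_block M a p *\<^sub>v u + col_block M (a + p) q *\<^sub>v w) $ i"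
    using mult_mat_vec_index[OF cb u i] mult_mat_vec_index[OF cb w i] i
    by (simp add: col_block_def)
qed (simp add: col_block_def)

lemma col_block_4_mult_vec:
  fixes M :: "real mat"
  assumes M: "M \<in> carrier_mat r (c0 + c1 + c2 + c3)"
    and v: "v0 \<in> carrier_vec c0" "v1 \<in> carrier_vec c1" "v2 \<in> carrier_vec c2" "v3 \<in> carrier_vec c3"
  shows "M *\<^sub>v (v0 @\<^sub>v v1 @\<^sub>v v2 @\<^sub>v v3) =
    col_block M 0 c0 *\<^sub>v v0 + (col_block M c0 c1 *\<^sub>v v1 +
      (col_block M (c0 + c1) c2 *\<^sub>v v2 + col_block M (c0 + c1 + c2) c3 *\<^sub>v v3))"
proof -
  have "M = col_block M 0 (c0 + (c1 + (c2 + c3)))"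
    using M by (intro eq_matI) (auto simp: col_block_def)
  moreover have w3: "v2 @\<^sub>v v3 \<in> carrier_vec (c2 + c3)" by (rule append_carrier_vec[OF v(3,4)])
  moreover have w2: "v1 @\<^sub>v v2 @\<^sub>v v3 \<in> carrier_vec (c1 + (c2 + c3))" by (rule append_carrier_vec[OF v(2) w3])
  ultimately have "M *\<^sub>v (v0 @\<^sub>v v1 @\<^sub>v v2 @\<^sub>v v3) =
      col_block M 0 c0 *\<^sub>v v0 + col_block M (0 + c0) (c1 + (c2 + c3)) *\<^sub>v (v1 @\<^sub>v v2 @\<^sub>v v3)"
    using col_block_append_mult_vec[OF v(1) w2, of M 0] by simp
  then show ?thesis
    unfolding col_block_append_mult_vec[OF v(2) w3] col_block_append_mult_vec[OF v(3,4)] by simp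
qed

lemma subvec_4:
  assumes "v \<in> carrier_vec (c0 + c1 + c2 + c3)"
  shows "v = subvec v 0 c0 @\<^sub>v subvec v c0 c1 @\<^sub>v subvec v (c0 + c1) c2 @\<^sub>v subvec v (c0 + c1 + c2) c3"
  using assms by (intro eq_vecI) (auto simp: subvec_def)

lemma append_4_eq_iff:
  assumes "u0 \<in> carrier_vec c0" "u1 \<in> carrier_vec c1" "u2 \<in> carrier_vec c2" "u3 \<in> carrier_vec c3"
    and "v0 \<in> carrier_vec c0" "v1 \<in> carrier_vec c1" "v2 \<in> carrier_vec c2" "v3 \<in> carrier_vec c3"
  shows "u0 @\<^sub>v u1 @\<^sub>v u2 @\<^sub>v u3 = v0 @\<^sub>v v1 @\<^sub>v v2 @\<^sub>v v3 \<longleftrightarrow> u0 = v0 \<and> u1 = v1 \<and> u2 = v2 \<and> u3 = v3"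
  by (simp only: append_vec_eq[OF assms(1,5)] append_vec_eq[OF assms(2,6)] append_vec_eq[OF assms(3,7)])

lemma append_4_carrier:
  assumes "v0 \<in> carrier_vec c0" "v1 \<in> carrier_vec c1" "v2 \<in> carrier_vec c2" "v3 \<in> carrier_vec c3"
  shows "v0 @\<^sub>v v1 @\<^sub>v v2 @\<^sub>v v3 \<in> carrier_vec (c0 + c1 + c2 + c3)"
  using append_carrier_vec[OF assms(1) append_carrier_vec[OF assms(2) append_carrier_vec[OF assms(3,4)]]]
  by (simp only: add.assoc)

lemma mult_mat_vec_row_carrier: "M \<in> carrier_mat r p \<Longrightarrow> M *\<^sub>v v \<in> carrier_vec r"
  by (intro carrier_vecI) simp

lemma mult_mat_uminus_vec:
  fixes M :: "real mat"
  assumes "M \<in> carrier_mat r p" "v \<in> carrier_vec p"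
  shows "M *\<^sub>v (- v) = - (M *\<^sub>v v)"
  using assms by (intro eq_vecI) auto

lemma append_4_add:
  assumes "u0 \<in> carrier_vec c0" "u1 \<in> carrier_vec c1" "u2 \<in> carrier_vec c2" "u3 \<in> carrier_vec c3"
    and "v0 \<in> carrier_vec c0" "v1 \<in> carrier_vec c1" "v2 \<in> carrier_vec c2" "v3 \<in> carrier_vec c3"
  shows "(u0 @\<^sub>v u1 @\<^sub>v u2 @\<^sub>v u3) + (v0 @\<^sub>v v1 @\<^sub>v v2 @\<^sub>v v3) =
    (u0 + v0) @\<^sub>v (u1 + v1) @\<^sub>v (u2 + v2) @\<^sub>v (u3 + v3 :: real vec)"
  using assms by (intro eq_vecI) auto

lemma invertible_mat_obtain:
  fixes M :: "real mat"
  assumes M: "M \<in> carrier_mat p p" "invertible_mat M"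
  obtains N where "N \<in> carrier_mat p p" "M * N = 1\<^sub>m p" "N * M = 1\<^sub>m p"
proof -
  obtain N where N: "M * N = 1\<^sub>m (dim_row M)" "N * M = 1\<^sub>m (dim_row N)"
    using M by (auto simp: invertible_mat_def inverts_mat_def)
  have "dim_col N = p" using arg_cong[OF N(1), of dim_col] M by simp
  moreover have "dim_row N = p" using arg_cong[OF N(2), of dim_col] M by simp
  ultimately show ?thesis using that[of N] N M by auto
qed

lemma mult_mat_vec_cancel:
  fixes M N :: "real mat"
  assumes "M \<in> carrier_mat p p" "N \<in> carrier_mat p p" "N * M = 1\<^sub>m p" "v \<in> carrier_vec p"
  shows "N *\<^sub>v (M *\<^sub>v v) = v"
  using assoc_mult_mat_vec[OF assms(2,1,4)] assms(3,4) by simp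

lemma mat_triple_mult_vec:
  fixes M X N :: "real mat"
  assumes "M \<in> carrier_mat r r" "X \<in> carrier_mat r p" "N \<in> carrier_mat p p" "v \<in> carrier_vec p"
  shows "(M * X * N) *\<^sub>v v = M *\<^sub>v (X *\<^sub>v (N *\<^sub>v v))"
  unfolding assoc_mult_mat_vec[OF mult_carrier_mat[OF assms(1,2)] assms(3,4)]
  by (rule assoc_mult_mat_vec[OF assms(1,2) mult_mat_vec_carrier[OF assms(3,4)]])

text \<open>A solution \<open>v\<close> of Q v = e is represented by the choice z = v, since G e = G
  Q v. Conversely Q G e = e holds for \<open>e\<close> in the range, and Q annihilates the range of
  I - G Q. The predicate \<open>P\<close> carries along whatever is to be said about
  \<open>v\<close>, later the representation of the solution.\<close>

lemma gen_inverse_parametrization: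
  assumes Q: "Q \<in> carrier_mat l q" and G: "gen_inverse Q G" and e: "e \<in> carrier_vec l"
  shows "(\<exists>v\<in>carrier_vec q. Q *\<^sub>v v = e \<and> P v) \<longleftrightarrow>
    e \<in> mat_range Q \<and> (\<exists>z\<in>carrier_vec q. P (G *\<^sub>v e + (1\<^sub>m q - G * Q) *\<^sub>v z))"
proof -
  have Gc: "G \<in> carrier_mat q l" and QGQ: "Q * G * Q = Q"
    using G Q by (auto simp: gen_inverse_def)
  have range: "e \<in> mat_range Q \<longleftrightarrow> (\<exists>v\<in>carrier_vec q. Q *\<^sub>v v = e)"
    using Q by (auto simp: mat_range_def)
  have QGQv: "Q *\<^sub>v (G *\<^sub>v (Q *\<^sub>v v)) = Q *\<^sub>v v" if "v \<in> carrier_vec q" for v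
    using assoc_mult_mat_vec[OF mult_carrier_mat[OF Q Gc] Q that]
      assoc_mult_mat_vec[OF Q Gc mult_mat_vec_carrier[OF Q that]] QGQ by simp
  have w: "(1\<^sub>m q - G * Q) *\<^sub>v z = z - G *\<^sub>v (Q *\<^sub>v z)" if "z \<in> carrier_vec q" for z
    using minus_mult_distrib_mat_vec[OF one_carrier_mat mult_carrier_mat[OF Gc Q] that]
      assoc_mult_mat_vec[OF Gc Q that] that by simp
  show ?thesis
  proof
    assume "\<exists>v\<in>carrier_vec q. Q *\<^sub>v v = e \<and> P v"
    then obtain v where v: "v \<in> carrier_vec q" "Q *\<^sub>v v = e" "P v" by blast
    have "G *\<^sub>v e + (1\<^sub>m q - G * Q) *\<^sub>v v = v"
      unfolding w[OF v(1)] v(2)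
      using v(1) carrier_matD[OF Gc] by (intro eq_vecI) auto
    then show "e \<in> mat_range Q \<and> (\<exists>z\<in>carrier_vec q. P (G *\<^sub>v e + (1\<^sub>m q - G * Q) *\<^sub>v z))"
      using v range by metis
  next
    assume "e \<in> mat_range Q \<and> (\<exists>z\<in>carrier_vec q. P (G *\<^sub>v e + (1\<^sub>m q - G * Q) *\<^sub>v z))"
    then obtain v z where v: "v \<in> carrier_vec q" "Q *\<^sub>v v = e" and z: "z \<in> carrier_vec q"
      and P: "P (G *\<^sub>v e + (1\<^sub>m q - G * Q) *\<^sub>v z)"
      using range by blast
    let ?y = "G *\<^sub>v e + (1\<^sub>m q - G * Q) *\<^sub>v z"
    have Ge: "G *\<^sub>v e \<in> carrier_vec q" by (rule mult_mat_vec_carrier[OF Gc e])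
    have GQz: "G *\<^sub>v (Q *\<^sub>v z) \<in> carrier_vec q"
      by (intro mult_mat_vec_carrier[OF Gc] mult_mat_vec_carrier[OF Q] z)
    have y: "?y \<in> carrier_vec q" unfolding w[OF z] using Ge z GQz by simp
    have "Q *\<^sub>v ?y = Q *\<^sub>v (G *\<^sub>v e) + (Q *\<^sub>v z - Q *\<^sub>v (G *\<^sub>v (Q *\<^sub>v z)))"
      unfolding w[OF z] mult_add_distrib_mat_vec[OF Q Ge minus_carrier_vec[OF z GQz]]
        mult_minus_distrib_mat_vec[OF Q z GQz] ..
    also have "\<dots> = e"
      using QGQv[OF v(1)] QGQv[OF z] mult_mat_vec_carrier[OF Q z] e unfolding v(2)
      by (intro eq_vecI) auto
    finally show "\<exists>v\<in>carrier_vec q. Q *\<^sub>v v = e \<and> P v" using y P by blast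
  qed
qed

lemma append_cols_mult_vec:
  fixes M N :: "real mat"
  assumes M: "M \<in> carrier_mat r p" and N: "N \<in> carrier_mat r q"
    and u: "u \<in> carrier_vec p" and w: "w \<in> carrier_vec q"
  shows "append_cols M N *\<^sub>v (u @\<^sub>v w) = M *\<^sub>v u + N *\<^sub>v w"
proof -
  have "append_cols M N *\<^sub>v (u @\<^sub>v w) = (M *\<^sub>v u + N *\<^sub>v w) @\<^sub>v (0\<^sub>m 0 p *\<^sub>v u + 0\<^sub>m 0 q *\<^sub>v w)"
    using four_block_mat_mult_vec[OF M N zero_carrier_mat zero_carrier_mat u w, of 0] M N
    by (simp add: append_cols_def)
  also have "\<dots> = M *\<^sub>v u + N *\<^sub>v w"
    using mult_mat_vec_carrier[OF M u] mult_mat_vec_carrier[OF N w] by (intro eq_vecI) auto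
  finally show ?thesis .
qed

lemma append_cols_carrier:
  "M \<in> carrier_mat r p \<Longrightarrow> N \<in> carrier_mat r q \<Longrightarrow> append_cols M N \<in> carrier_mat r (p + q)"
  by (auto simp: append_cols_def)

lemma sum_vec_mult:
  assumes M: "M \<in> carrier_mat r p" and v: "\<And>i. v i \<in> carrier_vec p"
  shows "sum_vec r (\<lambda>i. M *\<^sub>v v i) k = M *\<^sub>v sum_vec p v k"
proof (rule eq_vecI)
  fix j assume "j < dim_vec (M *\<^sub>v sum_vec p v k)"
  then have j: "j < r" using M by simp
  have s: "sum_vec p v k \<in> carrier_vec p" by (simp add: sum_vec_def)
  have "sum_vec r (\<lambda>i. M *\<^sub>v v i) k $ j = (\<Sum>i<k. \<Sum>l<p. M $$ (j,l) * v i $ l)"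
    using j by (simp add: sum_vec_def mult_mat_vec_index[OF M v j])
  also have "\<dots> = (\<Sum>l<p. M $$ (j,l) * sum_vec p v k $ l)"
    by (subst sum.swap) (simp add: sum_vec_def sum_distrib_left)
  finally show "sum_vec r (\<lambda>i. M *\<^sub>v v i) k $ j = (M *\<^sub>v sum_vec p v k) $ j"
    by (simp only: mult_mat_vec_index[OF M s j])
qed (use M in \<open>simp add: sum_vec_def\<close>)

lemma sum_vec_add:
  assumes "\<And>i. u i \<in> carrier_vec p" "\<And>i. v i \<in> carrier_vec p"
  shows "sum_vec p (\<lambda>i. u i + v i) k = sum_vec p u k + sum_vec p v k"
  using carrier_vecD[OF assms(1)] carrier_vecD[OF assms(2)]
  by (intro eq_vecI) (auto simp: sum_vec_def sum.distrib)

text \<open>Unprimed terms with index 0 or 2 depend on the parameter vector and stay on the left.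
  The primed ones are the contributions of the inhomogeneity and of the free part; \<open>b0\<close>
  has no primed partner because the integral vanishes at time 0.\<close>

lemma boundary_rearrange:
  fixes b0 :: "real vec"
  assumes "b0 \<in> carrier_vec l" "b1 \<in> carrier_vec l" "b2 \<in> carrier_vec l" "b2' \<in> carrier_vec l" "b3 \<in> carrier_vec l"
    "c0 \<in> carrier_vec l" "c0' \<in> carrier_vec l" "c1 \<in> carrier_vec l" "c2 \<in> carrier_vec l" "c2' \<in> carrier_vec l"
    "c3 \<in> carrier_vec l" "d \<in> carrier_vec l"
  shows "b0 + (b1 + ((b2 + b2') + b3)) + ((c0 + c0') + (c1 + ((c2 + c2') + c3))) = d \<longleftrightarrow>
    (b0 + c0) + (b2 + c2) = d - c0' - (b1 + c1) - (b2' + c2') - (b3 + c3)"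
proof -
  note D = assms[THEN carrier_vecD]
  show ?thesis
    unfolding vec_eq_iff using D by (auto simp: algebra_simps)
qed

section \<open>Solvability of the boundary value problem\<close>

text \<open>For each continuous \<open>\<phi>\<close> the first three claims give solvability with
  free part \<open>\<phi>\<close>, plain solvability from (a) and (b), and the description of all
  solutions with that free part. The final claim starts from an arbitrary solution and supplies its
  own \<open>\<phi>\<close>, for which (b) and the representation hold.\<close>

theorem theorem4p1:
  fixes E A B C V W A0 B0 B1 B2 B3 C0 C1 C2 C3 P0 P2 Q :: "real mat"
    and d d0 d1 d3 :: "real vec"
    and f f0 f1 f2 f3 :: "real \<Rightarrow> real vec"
    and h :: "(real \<Rightarrow> real vec) \<Rightarrow> real \<Rightarrow> real vec"
    and d2 dhat :: "(real \<Rightarrow> real vec) \<Rightarrow> real vec"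
    and w :: "(real \<Rightarrow> real vec) \<Rightarrow> real mat \<Rightarrow> real vec \<Rightarrow> real vec"
    and x0 x2 xsol :: "(real \<Rightarrow> real vec) \<Rightarrow> real mat \<Rightarrow> real vec \<Rightarrow> real \<Rightarrow> real vec"
    and x1 x3 :: "real \<Rightarrow> real vec"
    and T :: real
    and m n l n0 b q :: nat
    and \<alpha> \<beta> \<gamma> :: "nat list"
    and cond_a :: bool
    and cond_b :: "(real \<Rightarrow> real vec) \<Rightarrow> bool"
  assumes T: "T > 0"
    and EA: "E \<in> carrier_mat m n" "A \<in> carrier_mat m n"
    and BC: "B \<in> carrier_mat l n" "C \<in> carrier_mat l n"
    and d: "d \<in> carrier_vec l"
    and f_dim: "\<forall>t\<in>{0..T}. f t \<in> carrier_vec m"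
    and f_C1: "\<forall>i<m. (\<lambda>t. f t $ i) C1_differentiable_on {0<..<T}"
    and W: "W \<in> carrier_mat m m" "invertible_mat W"
    and V: "V \<in> carrier_mat n n" "invertible_mat V"
    \<comment> \<open>quasi-Kronecker form\<close>
    and A0: "A0 \<in> carrier_mat n0 n0"
    and pos: "\<forall>k\<in>set \<alpha>. k \<ge> 1" "\<forall>k\<in>set \<beta>. k \<ge> 1" "\<forall>k\<in>set \<gamma>. k \<ge> 1"
    and WEV: "W * E * V = diag_block_mat [1\<^sub>m n0, N_mat \<alpha>, L_mat \<beta>, transpose_mat (L_mat \<gamma>)]"
    and WAV: "W * A * V =
      diag_block_mat [A0, 1\<^sub>m (sum_list \<alpha>), K_mat \<beta>, transpose_mat (K_mat \<gamma>)]"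
    and b: "b = sum_list \<beta> - length \<beta>"
    and q: "q = n0 + b" "q > 0"
    \<comment> \<open>splitting of \<open>W f\<close>, \<open>B V\<close> and \<open>C V\<close>\<close>
    and f0: "f0 = (\<lambda>t. subvec (W *\<^sub>v f t) 0 n0)"
    and f1: "f1 = (\<lambda>t. subvec (W *\<^sub>v f t) n0 (sum_list \<alpha>))"
    and f2: "f2 = (\<lambda>t. subvec (W *\<^sub>v f t) (n0 + sum_list \<alpha>) b)"
    and f3: "f3 = (\<lambda>t. subvec (W *\<^sub>v f t) (n0 + sum_list \<alpha> + b) (sum_list \<gamma>))"
    and B0: "B0 = col_block (B * V) 0 n0"
    and B1: "B1 = col_block (B * V) n0 (sum_list \<alpha>)"
    and B2: "B2 = col_block (B * V) (n0 + sum_list \<alpha>) (sum_list \<beta>)"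
    and B3: "B3 = col_block (B * V) (n0 + sum_list \<alpha> + sum_list \<beta>) (sum_list \<gamma> - length \<gamma>)"
    and C0: "C0 = col_block (C * V) 0 n0"
    and C1: "C1 = col_block (C * V) n0 (sum_list \<alpha>)"
    and C2: "C2 = col_block (C * V) (n0 + sum_list \<alpha>) (sum_list \<beta>)"
    and C3: "C3 = col_block (C * V) (n0 + sum_list \<alpha> + sum_list \<beta>) (sum_list \<gamma> - length \<gamma>)"
    \<comment> \<open>regularity assumptions (A0)--(A3)\<close>
    and reg0: "Ck_vec 0 T n0 f0"
    and reg1: "\<forall>k<length \<alpha>. Ck_vec (\<alpha> ! k) T (\<alpha> ! k) (\<lambda>t. block \<alpha> k (f1 t))"
    and reg2: "Ck_vec 0 T b f2"
    and reg3: "\<forall>k<length \<gamma>. Ck_vec (\<gamma> ! k) T (\<gamma> ! k) (\<lambda>t. block \<gamma> k (f3 t))"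
    \<comment> \<open>notation\<close>
    and h: "h = (\<lambda>\<phi> t. M_mat \<beta> *\<^sub>v \<phi> t +
      integral_vec (sum_list \<beta>) 0 t (\<lambda>s. mat_exp ((t - s) \<cdot>\<^sub>m N_mat \<beta>) *\<^sub>v
        (transpose_mat (L_mat \<beta>) *\<^sub>v (f2 s + Mbar_mat \<beta> *\<^sub>v \<phi> s))))"
    and Q: "Q = (if sum_list \<beta> > length \<beta>
      then append_cols (B0 + C0 * mat_exp (T \<cdot>\<^sub>m A0))
             ((B2 + C2 * mat_exp (T \<cdot>\<^sub>m N_mat \<beta>)) * transpose_mat (L_mat \<beta>))
      else B0 + C0 * mat_exp (T \<cdot>\<^sub>m A0))"
    and d0: "d0 = C0 *\<^sub>v integral_vec n0 0 T (\<lambda>s. mat_exp ((T - s) \<cdot>\<^sub>m A0) *\<^sub>v f0 s)"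
    and d1: "d1 = - sum_vec l (\<lambda>i. (B1 * N_mat \<alpha> ^\<^sub>m i) *\<^sub>v deriv_vec T i f1 0
                                 + (C1 * N_mat \<alpha> ^\<^sub>m i) *\<^sub>v deriv_vec T i f1 T) (max_index \<alpha>)"
    and d2: "d2 = (\<lambda>\<phi>. if sum_list \<beta> > length \<beta>
      then (B2 * M_mat \<beta>) *\<^sub>v \<phi> 0 + C2 *\<^sub>v h \<phi> T
      else B2 *\<^sub>v \<phi> 0 + C2 *\<^sub>v \<phi> T)"
    and d3: "d3 = (if sum_list \<gamma> > length \<gamma>
      then - sum_vec l (\<lambda>i. (B3 * K_mat \<gamma> * N_mat \<gamma> ^\<^sub>m i) *\<^sub>v deriv_vec T i f3 0
                          + (C3 * K_mat \<gamma> * N_mat \<gamma> ^\<^sub>m i) *\<^sub>v deriv_vec T i f3 T) (max_index \<gamma>)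
      else 0\<^sub>v l)"
    and dhat: "dhat = (\<lambda>\<phi>. d - d0 - d1 - d2 \<phi> - d3)"
    and P0: "P0 = append_cols (1\<^sub>m n0) (0\<^sub>m n0 b)"
    and P2: "P2 = append_cols (0\<^sub>m b n0) (1\<^sub>m b)"
    \<comment> \<open>conditions (a) and (b)\<close>
    and cond_a: "cond_a \<longleftrightarrow> (\<forall>k<length \<gamma>. \<forall>t\<in>{0..T}.
      (\<Sum>i=1..\<gamma> ! k. nth_deriv T (\<gamma> ! k - i) (\<lambda>s. block \<gamma> k (f3 s) $ (i - 1)) t) = 0)"
    and cond_b: "cond_b = (\<lambda>\<phi>. dhat \<phi> \<in> mat_range Q)"
    \<comment> \<open>representation of the solutions\<close>
    and w: "w = (\<lambda>\<phi> Qg z. Qg *\<^sub>v dhat \<phi> + (1\<^sub>m q - Qg * Q) *\<^sub>v z)"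
    and x0: "x0 = (\<lambda>\<phi> Qg z t. mat_exp (t \<cdot>\<^sub>m A0) *\<^sub>v (P0 *\<^sub>v w \<phi> Qg z) +
      integral_vec n0 0 t (\<lambda>s. mat_exp ((t - s) \<cdot>\<^sub>m A0) *\<^sub>v f0 s))"
    and x1: "x1 = (\<lambda>t. - sum_vec (sum_list \<alpha>)
      (\<lambda>i. N_mat \<alpha> ^\<^sub>m i *\<^sub>v deriv_vec T i f1 t) (max_index \<alpha>))"
    and x2: "x2 = (\<lambda>\<phi> Qg z t. if sum_list \<beta> > length \<beta>
      then mat_exp (t \<cdot>\<^sub>m N_mat \<beta>) *\<^sub>v (transpose_mat (L_mat \<beta>) *\<^sub>v (P2 *\<^sub>v w \<phi> Qg z)) + h \<phi> t
      else \<phi> t)"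
    and x3: "x3 = (\<lambda>t. - (K_mat \<gamma> *\<^sub>v sum_vec (sum_list \<gamma>)
      (\<lambda>i. N_mat \<gamma> ^\<^sub>m i *\<^sub>v deriv_vec T i f3 t) (max_index \<gamma>)))"
    and xsol: "xsol = (\<lambda>\<phi> Qg z t. if sum_list \<gamma> > length \<gamma>
      then V *\<^sub>v (x0 \<phi> Qg z t @\<^sub>v x1 t @\<^sub>v x2 \<phi> Qg z t @\<^sub>v x3 t)
      else V *\<^sub>v (x0 \<phi> Qg z t @\<^sub>v x1 t @\<^sub>v x2 \<phi> Qg z t))"
  shows
    "(\<forall>\<phi>. Ck_vec 0 T (length \<beta>) \<phi> \<longrightarrow>
        ((\<exists>x. bvp_solution E A f B C d T x \<and> has_free_part V n0 \<alpha> \<beta> \<gamma> T \<phi> x) \<longleftrightarrow>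
           Ck_vec 1 T (length \<beta>) \<phi> \<and> cond_a \<and> cond_b \<phi>) \<and>
        (cond_a \<and> cond_b \<phi> \<longrightarrow> (\<exists>x. bvp_solution E A f B C d T x)) \<and>
        (\<forall>Qg. gen_inverse Q Qg \<longrightarrow>
           (\<forall>x. bvp_solution E A f B C d T x \<and> has_free_part V n0 \<alpha> \<beta> \<gamma> T \<phi> x \<longleftrightarrow>
              Ck_vec 1 T (length \<beta>) \<phi> \<and> cond_a \<and> cond_b \<phi> \<and>
              (\<exists>z\<in>carrier_vec q. \<forall>t\<in>{0..T}. x t = xsol \<phi> Qg z t)))) \<and>
     (\<forall>x. bvp_solution E A f B C d T x \<longrightarrow>
        cond_a \<and>
        (\<exists>\<phi>. Ck_vec 0 T (length \<beta>) \<phi> \<and> has_free_part V n0 \<alpha> \<beta> \<gamma> T \<phi> x \<and> cond_b \<phi> \<and>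
           (\<forall>Qg. gen_inverse Q Qg \<longrightarrow>
              (\<exists>z\<in>carrier_vec q. \<forall>t\<in>{0..T}. x t = xsol \<phi> Qg z t))))"
proof -

  \<comment> \<open>Dimensions and inverse transformations\<close>
  let ?a = "sum_list \<alpha>" and ?bb = "sum_list \<beta>" and ?g = "sum_list \<gamma>"
  let ?c = "sum_list \<gamma> - length \<gamma>"
  let ?I = "{0..T}"
  have 0: "0 \<in> ?I" and TT: "T \<in> ?I" using T by auto
  obtain Vi where Vi: "Vi \<in> carrier_mat n n" "V * Vi = 1\<^sub>m n" "Vi * V = 1\<^sub>m n"
    using invertible_mat_obtain[OF V] .
  obtain Wi where Wi: "Wi \<in> carrier_mat m m" "W * Wi = 1\<^sub>m m" "Wi * W = 1\<^sub>m m"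
    using invertible_mat_obtain[OF W] .
  note LB = canonical_mat_carrier(2)[OF pos(2), folded b] and KB = canonical_mat_carrier(1)[OF pos(2), folded b]
    and MB = canonical_mat_carrier(3)[OF pos(2)]
    and LG = canonical_mat_carrier(2)[OF pos(3)] and KG = canonical_mat_carrier(1)[OF pos(3)]
  have tLB: "transpose_mat (L_mat \<beta>) \<in> carrier_mat ?bb b"
    and tMB: "transpose_mat (M_mat \<beta>) \<in> carrier_mat (length \<beta>) ?bb"
    and tLG: "transpose_mat (L_mat \<gamma>) \<in> carrier_mat ?g ?c"
    and tKG: "transpose_mat (K_mat \<gamma>) \<in> carrier_mat ?g ?c"
    using LB MB LG KG by (simp_all add: transpose_carrier_mat)
  note NA = N_mat_carrier[of \<alpha>] and NB = N_mat_carrier[of \<beta>]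
  note lenb = sum_list_diff_1(2)[OF pos(2)]
  \<comment> \<open>The sizes \<open>m\<close> and \<open>n\<close> are not assumed to match the
    block sizes; they are read off from the dimensions of \<open>W * E * V\<close>.\<close>
  have mn: "m = n0 + ?a + b + ?g" "n = n0 + ?a + ?bb + ?c"
  proof -
    have "diag_block_mat [1\<^sub>m n0, N_mat \<alpha>, L_mat \<beta>, transpose_mat (L_mat \<gamma>)] \<in> carrier_mat m n"
      unfolding WEV[symmetric] by (rule mult_carrier_mat[OF mult_carrier_mat[OF W(1) EA(1)] V(1)])
    then show "m = n0 + ?a + b + ?g" "n = n0 + ?a + ?bb + ?c"
      using carrier_matD[OF diag_block_mat_4_carrier(1)[OF one_carrier_mat NA LB tLG, of n0]]
      by (simp_all only: carrier_matD add.assoc)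
  qed

  \<comment> \<open>Decoupling of the differential equation\<close>
  have Fc: "W *\<^sub>v f t \<in> carrier_vec m" if "t \<in> ?I" for t
    using f_dim that by (intro mult_mat_vec_carrier[OF W(1)]) auto
  have F: "W *\<^sub>v f t = f0 t @\<^sub>v f1 t @\<^sub>v f2 t @\<^sub>v f3 t" if "t \<in> ?I" for t
    unfolding f0 f1 f2 f3 by (rule subvec_4[OF Fc[OF that, unfolded mn(1)]])
  have fc: "f0 t \<in> carrier_vec n0" "f1 t \<in> carrier_vec ?a" "f2 t \<in> carrier_vec b" "f3 t \<in> carrier_vec ?g" for t
    by (simp_all add: f0 f1 f2 f3)
  \<comment> \<open>A pointwise algebraic statement: the vectors \<open>y\<close> stand for the
    blocks of the transformed derivative. Multiplication by the invertible \<open>W\<close> loses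
    nothing and makes both sides block vectors.\<close>
  have ode_iff: "E *\<^sub>v (V *\<^sub>v (y0 @\<^sub>v y1 @\<^sub>v y2 @\<^sub>v y3)) = A *\<^sub>v (V *\<^sub>v (u0 @\<^sub>v u1 @\<^sub>v u2 @\<^sub>v u3)) + f t \<longleftrightarrow>
      y0 = A0 *\<^sub>v u0 + f0 t \<and> N_mat \<alpha> *\<^sub>v y1 = u1 + f1 t \<and> L_mat \<beta> *\<^sub>v y2 = K_mat \<beta> *\<^sub>v u2 + f2 t \<and>
      transpose_mat (L_mat \<gamma>) *\<^sub>v y3 = transpose_mat (K_mat \<gamma>) *\<^sub>v u3 + f3 t"
    if t: "t \<in> ?I"
      and y: "y0 \<in> carrier_vec n0" "y1 \<in> carrier_vec ?a" "y2 \<in> carrier_vec ?bb" "y3 \<in> carrier_vec ?c"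
      and u: "u0 \<in> carrier_vec n0" "u1 \<in> carrier_vec ?a" "u2 \<in> carrier_vec ?bb" "u3 \<in> carrier_vec ?c"
    for t y0 y1 y2 y3 u0 u1 u2 u3
  proof -
    let ?y = "y0 @\<^sub>v y1 @\<^sub>v y2 @\<^sub>v y3" and ?u = "u0 @\<^sub>v u1 @\<^sub>v u2 @\<^sub>v u3"
    have yc: "?y \<in> carrier_vec n" and uc: "?u \<in> carrier_vec n"
      unfolding mn(2) by (rule append_4_carrier[OF y], rule append_4_carrier[OF u])
    have ft: "f t \<in> carrier_vec m" using f_dim t by blast
    have l: "E *\<^sub>v (V *\<^sub>v ?y) \<in> carrier_vec m" and Au: "A *\<^sub>v (V *\<^sub>v ?u) \<in> carrier_vec m"
      by (intro mult_mat_vec_carrier[OF EA(1)] mult_mat_vec_carrier[OF EA(2)] mult_mat_vec_carrier[OF V(1)] yc uc)+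
    have r: "A *\<^sub>v (V *\<^sub>v ?u) + f t \<in> carrier_vec m" by (rule add_carrier_vec[OF Au ft])
    have "E *\<^sub>v (V *\<^sub>v ?y) = A *\<^sub>v (V *\<^sub>v ?u) + f t \<longleftrightarrow>
        W *\<^sub>v (E *\<^sub>v (V *\<^sub>v ?y)) = W *\<^sub>v (A *\<^sub>v (V *\<^sub>v ?u) + f t)"
      using mult_mat_vec_cancel[OF W(1) Wi(1,3) l] mult_mat_vec_cancel[OF W(1) Wi(1,3) r] by metis
    also have "W *\<^sub>v (E *\<^sub>v (V *\<^sub>v ?y)) =
        y0 @\<^sub>v N_mat \<alpha> *\<^sub>v y1 @\<^sub>v L_mat \<beta> *\<^sub>v y2 @\<^sub>v transpose_mat (L_mat \<gamma>) *\<^sub>v y3"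
      unfolding mat_triple_mult_vec[OF W(1) EA(1) V(1) yc, symmetric] WEV
        diag_block_mat_4_mult_vec[OF one_carrier_mat NA LB tLG y] one_mult_mat_vec[OF y(1)] ..
    also have "W *\<^sub>v (A *\<^sub>v (V *\<^sub>v ?u) + f t) = W *\<^sub>v (A *\<^sub>v (V *\<^sub>v ?u)) + W *\<^sub>v f t"
      by (rule mult_add_distrib_mat_vec[OF W(1) Au ft])
    also have "W *\<^sub>v (A *\<^sub>v (V *\<^sub>v ?u)) =
        A0 *\<^sub>v u0 @\<^sub>v u1 @\<^sub>v K_mat \<beta> *\<^sub>v u2 @\<^sub>v transpose_mat (K_mat \<gamma>) *\<^sub>v u3"
      unfolding mat_triple_mult_vec[OF W(1) EA(2) V(1) uc, symmetric] WAV
        diag_block_mat_4_mult_vec[OF A0 one_carrier_mat KB tKG u] one_mult_mat_vec[OF u(2)] ..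
    finally show ?thesis
      unfolding F[OF t]
        append_4_add[OF mult_mat_vec_carrier[OF A0 u(1)] u(2) mult_mat_vec_carrier[OF KB u(3)]
          mult_mat_vec_carrier[OF tKG u(4)] fc]
        append_4_eq_iff[OF y(1) mult_mat_vec_carrier[OF NA y(2)] mult_mat_vec_carrier[OF LB y(3)]
          mult_mat_vec_carrier[OF tLG y(4)]
          add_carrier_vec[OF mult_mat_vec_carrier[OF A0 u(1)] fc(1)] add_carrier_vec[OF u(2) fc(2)]
          add_carrier_vec[OF mult_mat_vec_carrier[OF KB u(3)] fc(3)]
          add_carrier_vec[OF mult_mat_vec_carrier[OF tKG u(4)] fc(4)]] .
  qed

  \<comment> \<open>Chain solutions and condition (a)\<close>
  interpret c1: chain_data T \<alpha> f1 using T fc reg1 by unfold_locales auto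
  interpret c3: chain_data T \<gamma> f3 using T fc reg3 by unfold_locales auto
  let ?S1 = "chain_sol T \<alpha> f1" and ?S3 = "chain_sol T \<gamma> f3"
  have x1_eq: "x1 = ?S1" by (simp add: x1 chain_sol_def fun_eq_iff)
  have x3_eq: "x3 = (\<lambda>t. K_mat \<gamma> *\<^sub>v ?S3 t)"
    unfolding x3 chain_sol_def
    by (intro ext mult_mat_uminus_vec[OF KG, symmetric]) (simp add: sum_vec_def)
  have x1c: "x1 t \<in> carrier_vec ?a" and x3c: "x3 t \<in> carrier_vec ?c" for t
    unfolding x1_eq x3_eq by (simp, rule mult_mat_vec_carrier[OF KG chain_sol_carrier])
  have cond_a_iff: "cond_a \<longleftrightarrow>
      (\<forall>k<length \<gamma>. \<forall>t\<in>?I. ?S3 t $ (sum_list (take k \<gamma>) + (\<gamma> ! k - 1)) = 0)"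
  proof -
    have "(\<Sum>i=1..\<gamma> ! k. nth_deriv T (\<gamma> ! k - i) (\<lambda>s. block \<gamma> k (f3 s) $ (i - 1)) t) = 0 \<longleftrightarrow>
        ?S3 t $ (sum_list (take k \<gamma>) + (\<gamma> ! k - 1)) = 0" if k: "k < length \<gamma>" and t: "t \<in> ?I" for k t
    proof -
      have "\<gamma> ! k \<ge> 1" using pos(3) k by simp
      from c3.chain_sol_last_entry[OF k this t] show ?thesis by (simp only: neg_equal_0_iff_equal)
    qed
    then show ?thesis unfolding cond_a by blast
  qed

  \<comment> \<open>Uniform solution formula\<close>
  have h_eq: "h \<phi> t = M_mat \<beta> *\<^sub>v \<phi> t +
      integral_vec ?bb 0 t (\<lambda>s. mat_exp ((t - s) \<cdot>\<^sub>m N_mat \<beta>) *\<^sub>v under_input \<beta> f2 \<phi> s)" for \<phi> t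
    by (simp add: h under_input_def)
  have hc: "h \<phi> t \<in> carrier_vec ?bb" for \<phi> t
    unfolding h_eq by (intro add_carrier_vec mult_mat_vec_row_carrier[OF MB] integral_vec_carrier)
  have h0: "h \<phi> 0 = M_mat \<beta> *\<^sub>v \<phi> 0" for \<phi>
    unfolding h_eq using MB by (intro eq_vecI) (auto simp: integral_vec_def)
  have P0c: "P0 \<in> carrier_mat n0 q" and P2c: "P2 \<in> carrier_mat b q"
    unfolding P0 P2 q by (rule append_cols_carrier; simp)+
  have P0v: "P0 *\<^sub>v (u @\<^sub>v w) = u" and P2v: "P2 *\<^sub>v (u @\<^sub>v w) = w"
    if "u \<in> carrier_vec n0" "w \<in> carrier_vec b" for u w
    unfolding P0 P2 append_cols_mult_vec[OF one_carrier_mat zero_carrier_mat that]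
      append_cols_mult_vec[OF zero_carrier_mat one_carrier_mat that]
    using that by (intro eq_vecI; auto)+
  \<comment> \<open>The representation with an arbitrary parameter vector \<open>v\<close> in place
    of \<open>w \<phi> Qg z\<close> and without case distinctions: initial data first, generalized
    inverses only at the very end.\<close>
  define e0 where "e0 v t = mat_exp (t \<cdot>\<^sub>m A0) *\<^sub>v (P0 *\<^sub>v v) +
    integral_vec n0 0 t (\<lambda>s. mat_exp ((t - s) \<cdot>\<^sub>m A0) *\<^sub>v f0 s)" for v t
  define e2 where "e2 \<phi> v t = mat_exp (t \<cdot>\<^sub>m N_mat \<beta>) *\<^sub>v (transpose_mat (L_mat \<beta>) *\<^sub>v (P2 *\<^sub>v v)) + h \<phi> t"
    for \<phi> v t
  define X where "X \<phi> v t = V *\<^sub>v (e0 v t @\<^sub>v x1 t @\<^sub>v e2 \<phi> v t @\<^sub>v x3 t)" for \<phi> v t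
  have e0c: "e0 v t \<in> carrier_vec n0" for v t
    unfolding e0_def
    by (intro add_carrier_vec mult_mat_vec_row_carrier[OF mat_exp_carrier[OF A0]] integral_vec_carrier)
  have e2c: "e2 \<phi> v t \<in> carrier_vec ?bb" for \<phi> v t
    unfolding e2_def by (intro add_carrier_vec mult_mat_vec_row_carrier[OF mat_exp_carrier[OF NB]] hc)
  \<comment> \<open>If all indices of \<open>\<beta>\<close> are 1, then L^T has no columns and the
    third component consists of its free part alone, so the uniform formula reduces to
    \<open>\<phi>\<close>.\<close>
  have degenerate: "M_mat \<beta> = 1\<^sub>m ?bb" "transpose_mat (L_mat \<beta>) *\<^sub>v y = 0\<^sub>v ?bb" "?bb = length \<beta>"
    if "\<not> ?bb > length \<beta>" "y \<in> carrier_vec b" for y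
  proof -
    show eq: "?bb = length \<beta>" using that lenb by simp
    then show "M_mat \<beta> = 1\<^sub>m ?bb" using M_mat_eq_one[OF pos(2)] by simp
    show "transpose_mat (L_mat \<beta>) *\<^sub>v y = 0\<^sub>v ?bb"
      using that tLB b by (intro eq_vecI) (auto simp: scalar_prod_def)
  qed
  have h_degenerate: "h \<phi> t = \<phi> t"
    if nb: "\<not> ?bb > length \<beta>" and \<phi>: "Ck_vec 0 T (length \<beta>) \<phi>" and t: "t \<in> ?I" for \<phi> t
  proof -
    have ui: "under_input \<beta> f2 \<phi> s = 0\<^sub>v ?bb" for s
    proof -
      have "f2 s + Mbar_mat \<beta> *\<^sub>v \<phi> s \<in> carrier_vec b"
        unfolding b
        by (intro add_carrier_vec mult_mat_vec_row_carrier[OF canonical_mat_carrier(4)[OF pos(2)]]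
            fc(3)[unfolded b])
      then show ?thesis unfolding under_input_def by (rule degenerate(2)[OF nb])
    qed
    have \<phi>t: "\<phi> t \<in> carrier_vec ?bb"
      using Ck_vec_carrier[OF \<phi> t] degenerate(3)[OF nb, of "0\<^sub>v b"] by simp
    show ?thesis
      unfolding h_eq ui mult_mat_zero_vec[OF mat_exp_carrier[OF NB]]
        degenerate(1)[OF nb zero_carrier_vec] one_mult_mat_vec[OF \<phi>t]
      using \<phi>t by (intro eq_vecI) (auto simp: integral_vec_def)
  qed
  have x2_eq: "x2 \<phi> Qg z t = e2 \<phi> (w \<phi> Qg z) t"
    if \<phi>: "Ck_vec 0 T (length \<beta>) \<phi>" and t: "t \<in> ?I" and wc: "w \<phi> Qg z \<in> carrier_vec q" for \<phi> Qg z t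
  proof (cases "?bb > length \<beta>")
    case True
    then show ?thesis by (simp add: x2 e2_def)
  next
    case False
    have "e2 \<phi> (w \<phi> Qg z) t = 0\<^sub>v ?bb + h \<phi> t"
      unfolding e2_def degenerate(2)[OF False mult_mat_vec_carrier[OF P2c wc]]
        mult_mat_zero_vec[OF mat_exp_carrier[OF NB]] ..
    also have "\<dots> = \<phi> t"
      using hc[of \<phi> t] h_degenerate[OF False \<phi> t] by simp
    finally show ?thesis using False by (simp add: x2)
  qed
  have xsol_eq: "xsol \<phi> Qg z t = X \<phi> (w \<phi> Qg z) t"
    if \<phi>: "Ck_vec 0 T (length \<beta>) \<phi>" and t: "t \<in> ?I" and wc: "w \<phi> Qg z \<in> carrier_vec q" for \<phi> Qg z t
  proof (cases "?g > length \<gamma>")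
    case True
    then show ?thesis
      unfolding xsol X_def using x2_eq[OF that] by (simp add: x0 e0_def)
  next
    case False
    \<comment> \<open>Here \<open>x3 t\<close> has length 0, so appending it changes
      nothing.\<close>
    then have "x2 \<phi> Qg z t @\<^sub>v x3 t = x2 \<phi> Qg z t"
      using x3c[of t] by (intro eq_vecI) auto
    then show ?thesis
      unfolding xsol X_def using x2_eq[OF that] False by (simp add: x0 e0_def)
  qed

  \<comment> \<open>The boundary condition as a linear system\<close>
  have BVc: "B * V \<in> carrier_mat l (n0 + ?a + ?bb + ?c)" and CVc: "C * V \<in> carrier_mat l (n0 + ?a + ?bb + ?c)"
    using BC V(1) mn by auto
  have Bc: "B0 \<in> carrier_mat l n0" "B1 \<in> carrier_mat l ?a" "B2 \<in> carrier_mat l ?bb" "B3 \<in> carrier_mat l ?c"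
    and Cc: "C0 \<in> carrier_mat l n0" "C1 \<in> carrier_mat l ?a" "C2 \<in> carrier_mat l ?bb" "C3 \<in> carrier_mat l ?c"
    unfolding B0 B1 B2 B3 C0 C1 C2 C3 using BVc CVc by simp_all
  note X0 = mat_exp_carrier[OF A0, of T] and X2 = mat_exp_carrier[OF NB, of T]
  have Q0c: "B0 + C0 * mat_exp (T \<cdot>\<^sub>m A0) \<in> carrier_mat l n0"
    and Q2c': "B2 + C2 * mat_exp (T \<cdot>\<^sub>m N_mat \<beta>) \<in> carrier_mat l ?bb"
    by (intro add_carrier_mat mult_carrier_mat[OF Cc(1) X0] mult_carrier_mat[OF Cc(3) X2])+
  note Q2c = mult_carrier_mat[OF Q2c' tLB]
  have Qc: "Q \<in> carrier_mat l q"
    using append_cols_carrier[OF Q0c Q2c] Q0c b q by (auto simp: Q)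
  \<comment> \<open>Covers both definitions of \<open>Q\<close>: when b = 0 the vector
    \<open>v\<close> is empty and its terms are zero.\<close>
  have Qv: "Q *\<^sub>v (u @\<^sub>v v) = (B0 *\<^sub>v u + C0 *\<^sub>v (mat_exp (T \<cdot>\<^sub>m A0) *\<^sub>v u)) +
      (B2 *\<^sub>v (transpose_mat (L_mat \<beta>) *\<^sub>v v) +
       C2 *\<^sub>v (mat_exp (T \<cdot>\<^sub>m N_mat \<beta>) *\<^sub>v (transpose_mat (L_mat \<beta>) *\<^sub>v v)))"
    if u: "u \<in> carrier_vec n0" and v: "v \<in> carrier_vec b" for u v
  proof -
    have tv: "transpose_mat (L_mat \<beta>) *\<^sub>v v \<in> carrier_vec ?bb" by (rule mult_mat_vec_carrier[OF tLB v])
    have 1: "(B0 + C0 * mat_exp (T \<cdot>\<^sub>m A0)) *\<^sub>v u = B0 *\<^sub>v u + C0 *\<^sub>v (mat_exp (T \<cdot>\<^sub>m A0) *\<^sub>v u)"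
      unfolding add_mult_distrib_mat_vec[OF Bc(1) mult_carrier_mat[OF Cc(1) X0] u]
        assoc_mult_mat_vec[OF Cc(1) X0 u] ..
    have 2: "((B2 + C2 * mat_exp (T \<cdot>\<^sub>m N_mat \<beta>)) * transpose_mat (L_mat \<beta>)) *\<^sub>v v =
      B2 *\<^sub>v (transpose_mat (L_mat \<beta>) *\<^sub>v v) +
       C2 *\<^sub>v (mat_exp (T \<cdot>\<^sub>m N_mat \<beta>) *\<^sub>v (transpose_mat (L_mat \<beta>) *\<^sub>v v))"
      unfolding assoc_mult_mat_vec[OF Q2c' tLB v]
        add_mult_distrib_mat_vec[OF Bc(3) mult_carrier_mat[OF Cc(3) X2] tv]
        assoc_mult_mat_vec[OF Cc(3) X2 tv] ..
    show ?thesis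
    proof (cases "?bb > length \<beta>")
      case True
      then show ?thesis
        unfolding 1[symmetric] 2[symmetric] using append_cols_mult_vec[OF Q0c Q2c u v] by (simp add: Q)
    next
      case False
      have "B2 *\<^sub>v 0\<^sub>v ?bb + C2 *\<^sub>v (mat_exp (T \<cdot>\<^sub>m N_mat \<beta>) *\<^sub>v 0\<^sub>v ?bb) = 0\<^sub>v l"
        unfolding mult_mat_zero_vec[OF X2] mult_mat_zero_vec[OF Bc(3)] mult_mat_zero_vec[OF Cc(3)]
        by simp
      moreover have "u @\<^sub>v v = u" using u v False b by (intro eq_vecI) auto
      ultimately show ?thesis
        unfolding degenerate(2)[OF False v]
        using False 1 mult_mat_vec_carrier[OF Q0c u] by (simp add: Q)
    qed
  qed

  \<comment> \<open>Pulls the boundary matrices out of the sums over derivatives. Used with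
    \<open>B1\<close> and \<open>C1\<close> for \<open>d1\<close>, and with \<open>B3\<close> and
    \<open>C3\<close> multiplied by \<open>K_mat \<gamma>\<close> for \<open>d3\<close>.\<close>
  have chain_bc: "sum_vec l (\<lambda>i. (G * N_mat a ^\<^sub>m i) *\<^sub>v deriv_vec T i g 0 + (H * N_mat a ^\<^sub>m i) *\<^sub>v deriv_vec T i g T) (max_index a)
      = - (G *\<^sub>v chain_sol T a g 0 + H *\<^sub>v chain_sol T a g T)"
    if G: "G \<in> carrier_mat l (sum_list a)" and H: "H \<in> carrier_mat l (sum_list a)"
      and g: "\<And>t. g t \<in> carrier_vec (sum_list a)" for G H a and g :: "real \<Rightarrow> real vec"
  proof -
    have d: "deriv_vec T i g t \<in> carrier_vec (sum_list a)" for i t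
      using carrier_vecD[OF g] by (simp add: deriv_vec_def)
    have Np: "N_mat a ^\<^sub>m i \<in> carrier_mat (sum_list a) (sum_list a)" for i
      using N_mat_carrier by (rule pow_carrier_mat)
    have Nd: "N_mat a ^\<^sub>m i *\<^sub>v deriv_vec T i g t \<in> carrier_vec (sum_list a)" for i t
      by (rule mult_mat_vec_carrier[OF Np d])
    have s: "sum_vec (sum_list a) (\<lambda>i. N_mat a ^\<^sub>m i *\<^sub>v deriv_vec T i g t) (max_index a) = - chain_sol T a g t" for t
      by (simp add: chain_sol_def)
    have "G *\<^sub>v (- chain_sol T a g 0) + H *\<^sub>v (- chain_sol T a g T) =
        - (G *\<^sub>v chain_sol T a g 0 + H *\<^sub>v chain_sol T a g T)"
      using G H carrier_vecD[OF chain_sol_carrier]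
      by (intro eq_vecI) auto
    then show ?thesis
      unfolding assoc_mult_mat_vec[OF G Np d] assoc_mult_mat_vec[OF H Np d]
        sum_vec_add[of _ l, OF mult_mat_vec_carrier[OF G Nd] mult_mat_vec_carrier[OF H Nd]]
        sum_vec_mult[OF G Nd] sum_vec_mult[OF H Nd] s by simp
  qed
  have d1_eq: "d1 = B1 *\<^sub>v x1 0 + C1 *\<^sub>v x1 T"
    unfolding d1 chain_bc[OF Bc(2) Cc(2) fc(2)] x1_eq by simp
  have d3_eq: "d3 = B3 *\<^sub>v x3 0 + C3 *\<^sub>v x3 T"
  proof (cases "?g > length \<gamma>")
    case True
    have "d3 = (B3 * K_mat \<gamma>) *\<^sub>v ?S3 0 + (C3 * K_mat \<gamma>) *\<^sub>v ?S3 T"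
      using True chain_bc[OF mult_carrier_mat[OF Bc(4) KG] mult_carrier_mat[OF Cc(4) KG] fc(4)]
      by (simp add: d3)
    then show ?thesis
      unfolding x3_eq assoc_mult_mat_vec[OF Bc(4) KG chain_sol_carrier]
        assoc_mult_mat_vec[OF Cc(4) KG chain_sol_carrier] .
  next
    case False
    then have "?c = 0" by simp
    then show ?thesis
      using False Bc(4) Cc(4) x3c[of 0] x3c[of T] by (intro eq_vecI) (auto simp: d3 scalar_prod_def)
  qed
  have d2_eq: "d2 \<phi> = B2 *\<^sub>v h \<phi> 0 + C2 *\<^sub>v h \<phi> T" if \<phi>: "Ck_vec 0 T (length \<beta>) \<phi>" for \<phi>
  proof (cases "?bb > length \<beta>")
    case True
    then show ?thesis
      unfolding h0 assoc_mult_mat_vec[OF Bc(3) MB Ck_vec_carrier[OF \<phi> 0], symmetric] by (simp add: d2)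
  next
    case False
    then show ?thesis using h_degenerate[OF False \<phi> 0] h_degenerate[OF False \<phi> TT] by (simp add: d2)
  qed
  have dhatc: "dhat \<phi> \<in> carrier_vec l" for \<phi>
    unfolding dhat d3_eq using carrier_matD(1)[OF Cc(4)] by (intro carrier_vecI) simp

  \<comment> \<open>The two parts of \<open>v\<close> are the initial data of the two differential
    equations; \<open>Q\<close> collects what they contribute at 0 and T, and everything else is
    moved into \<open>dhat\<close>.\<close>
  have boundary: "B *\<^sub>v X \<phi> v 0 + C *\<^sub>v X \<phi> v T = d \<longleftrightarrow> Q *\<^sub>v v = dhat \<phi>"
    if \<phi>: "Ck_vec 0 T (length \<beta>) \<phi>" and v: "v \<in> carrier_vec q" for \<phi> v
  proof -
    define v0 v2 where "v0 = subvec v 0 n0" and "v2 = subvec v n0 b"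
    have v0: "v0 \<in> carrier_vec n0" and v2: "v2 \<in> carrier_vec b" by (simp_all add: v0_def v2_def)
    have vv: "v = v0 @\<^sub>v v2" unfolding v0_def v2_def by (rule subvec_append_self) (use v q in simp)
    let ?Lv = "transpose_mat (L_mat \<beta>) *\<^sub>v v2"
    have Lv: "?Lv \<in> carrier_vec ?bb" by (rule mult_mat_vec_carrier[OF tLB v2])
    have XL: "mat_exp (T \<cdot>\<^sub>m N_mat \<beta>) *\<^sub>v ?Lv \<in> carrier_vec ?bb" by (rule mult_mat_vec_carrier[OF X2 Lv])
    have Xv: "mat_exp (T \<cdot>\<^sub>m A0) *\<^sub>v v0 \<in> carrier_vec n0" by (rule mult_mat_vec_carrier[OF X0 v0])
    have yc: "e0 v t @\<^sub>v x1 t @\<^sub>v e2 \<phi> v t @\<^sub>v x3 t \<in> carrier_vec n" for t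
      unfolding mn(2) by (rule append_4_carrier[OF e0c x1c e2c x3c])
    have expand: "G *\<^sub>v X \<phi> v t = col_block (G * V) 0 n0 *\<^sub>v e0 v t + (col_block (G * V) n0 ?a *\<^sub>v x1 t +
        (col_block (G * V) (n0 + ?a) ?bb *\<^sub>v e2 \<phi> v t + col_block (G * V) (n0 + ?a + ?bb) ?c *\<^sub>v x3 t))"
      if G: "G \<in> carrier_mat l n" for G t
    proof -
      have GV: "G * V \<in> carrier_mat l (n0 + ?a + ?bb + ?c)" using G V(1) mn by auto
      show ?thesis
        unfolding X_def assoc_mult_mat_vec[OF G V(1) yc, symmetric]
        by (rule col_block_4_mult_vec[OF GV e0c x1c e2c x3c])
    qed
    let ?J = "integral_vec n0 0 T (\<lambda>s. mat_exp ((T - s) \<cdot>\<^sub>m A0) *\<^sub>v f0 s)"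
    have e00: "e0 v 0 = v0"
      unfolding e0_def vv P0v[OF v0 v2] mat_exp_zero[OF A0] one_mult_mat_vec[OF v0]
      using v0 by (intro eq_vecI) (auto simp: integral_vec_def)
    have e0T: "C0 *\<^sub>v e0 v T = C0 *\<^sub>v (mat_exp (T \<cdot>\<^sub>m A0) *\<^sub>v v0) + C0 *\<^sub>v ?J"
      unfolding e0_def vv P0v[OF v0 v2]
      by (rule mult_add_distrib_mat_vec[OF Cc(1) Xv integral_vec_carrier])
    have e20: "B2 *\<^sub>v e2 \<phi> v 0 = B2 *\<^sub>v ?Lv + B2 *\<^sub>v h \<phi> 0"
      unfolding e2_def vv P2v[OF v0 v2] mat_exp_zero[OF NB] one_mult_mat_vec[OF Lv]
      by (rule mult_add_distrib_mat_vec[OF Bc(3) Lv hc])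
    have e2T: "C2 *\<^sub>v e2 \<phi> v T = C2 *\<^sub>v (mat_exp (T \<cdot>\<^sub>m N_mat \<beta>) *\<^sub>v ?Lv) + C2 *\<^sub>v h \<phi> T"
      unfolding e2_def vv P2v[OF v0 v2]
      by (rule mult_add_distrib_mat_vec[OF Cc(3) XL hc])
    have "B *\<^sub>v X \<phi> v 0 + C *\<^sub>v X \<phi> v T =
      B0 *\<^sub>v v0 + (B1 *\<^sub>v x1 0 + ((B2 *\<^sub>v ?Lv + B2 *\<^sub>v h \<phi> 0) + B3 *\<^sub>v x3 0)) +
      ((C0 *\<^sub>v (mat_exp (T \<cdot>\<^sub>m A0) *\<^sub>v v0) + C0 *\<^sub>v ?J) + (C1 *\<^sub>v x1 T +
        ((C2 *\<^sub>v (mat_exp (T \<cdot>\<^sub>m N_mat \<beta>) *\<^sub>v ?Lv) + C2 *\<^sub>v h \<phi> T) + C3 *\<^sub>v x3 T)))"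
      unfolding expand[OF BC(1)] expand[OF BC(2)] B0[symmetric] B1[symmetric] B2[symmetric] B3[symmetric]
        C0[symmetric] C1[symmetric] C2[symmetric] C3[symmetric] e00 e0T e20 e2T ..
    moreover have "dhat \<phi> = d - C0 *\<^sub>v ?J - (B1 *\<^sub>v x1 0 + C1 *\<^sub>v x1 T) -
        (B2 *\<^sub>v h \<phi> 0 + C2 *\<^sub>v h \<phi> T) - (B3 *\<^sub>v x3 0 + C3 *\<^sub>v x3 T)"
      unfolding dhat d0 d1_eq d2_eq[OF \<phi>] d3_eq ..
    ultimately show ?thesis
      unfolding vv Qv[OF v0 v2]
      by (simp only: boundary_rearrange[OF mult_mat_vec_carrier[OF Bc(1) v0] mult_mat_vec_carrier[OF Bc(2) x1c]
        mult_mat_vec_carrier[OF Bc(3) Lv] mult_mat_vec_carrier[OF Bc(3) hc] mult_mat_vec_carrier[OF Bc(4) x3c]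
        mult_mat_vec_carrier[OF Cc(1) Xv] mult_mat_vec_carrier[OF Cc(1) integral_vec_carrier]
        mult_mat_vec_carrier[OF Cc(2) x1c] mult_mat_vec_carrier[OF Cc(3) XL]
        mult_mat_vec_carrier[OF Cc(3) hc] mult_mat_vec_carrier[OF Cc(4) x3c] d])
  qed

  \<comment> \<open>The free part of a given function\<close>
  have bvp_def: "bvp_solution E A f B C d T x \<longleftrightarrow> Ck_vec 1 T n x \<and>
      (\<forall>t\<in>{0<..<T}. E *\<^sub>v deriv_vec T 1 x t = A *\<^sub>v x t + f t) \<and> B *\<^sub>v x 0 + C *\<^sub>v x T = d" for x
    using EA(1) by (simp add: bvp_solution_def)

  define part where "part x t = subvec (Vi *\<^sub>v x t) (n0 + ?a) ?bb" for x :: "real \<Rightarrow> real vec" and t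
  \<comment> \<open>Since \<open>V\<close> is invertible, the four components in
    \<open>has_free_part\<close> are determined by \<open>x t\<close>, and the existential statement
    becomes a formula for \<open>\<phi>\<close>.\<close>
  have free_iff: "has_free_part V n0 \<alpha> \<beta> \<gamma> T \<phi> x \<longleftrightarrow>
      (\<forall>t\<in>?I. \<phi> t = transpose_mat (M_mat \<beta>) *\<^sub>v part x t)"
    if xc: "\<And>t. t \<in> ?I \<Longrightarrow> x t \<in> carrier_vec n" for x \<phi>
    unfolding has_free_part_def
  proof (intro ball_cong refl iffI)
    fix t assume t: "t \<in> ?I"
    have u: "Vi *\<^sub>v x t \<in> carrier_vec (n0 + ?a + ?bb + ?c)"
      using mult_mat_vec_carrier[OF Vi(1) xc[OF t]] mn by simp
    {
      assume "\<exists>x0 x1 x2 x3. x0 \<in> carrier_vec n0 \<and> x1 \<in> carrier_vec ?a \<and> x2 \<in> carrier_vec ?bb \<and>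
        x3 \<in> carrier_vec ?c \<and> x t = V *\<^sub>v (x0 @\<^sub>v x1 @\<^sub>v x2 @\<^sub>v x3) \<and> transpose_mat (M_mat \<beta>) *\<^sub>v x2 = \<phi> t"
      then obtain y0 y1 y2 y3 where y: "y0 \<in> carrier_vec n0" "y1 \<in> carrier_vec ?a" "y2 \<in> carrier_vec ?bb"
        "y3 \<in> carrier_vec ?c" and xt: "x t = V *\<^sub>v (y0 @\<^sub>v y1 @\<^sub>v y2 @\<^sub>v y3)"
        and M: "transpose_mat (M_mat \<beta>) *\<^sub>v y2 = \<phi> t" by blast
      have yc: "y0 @\<^sub>v y1 @\<^sub>v y2 @\<^sub>v y3 \<in> carrier_vec n"
        unfolding mn(2) by (rule append_4_carrier[OF y])
      have "part x t = y2"
        unfolding part_def xt mult_mat_vec_cancel[OF V(1) Vi(1,3) yc]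
        using y by (intro eq_vecI) (auto simp: subvec_def)
      then show "\<phi> t = transpose_mat (M_mat \<beta>) *\<^sub>v part x t" using M by simp
    next
      assume "\<phi> t = transpose_mat (M_mat \<beta>) *\<^sub>v part x t"
      moreover have "x t = V *\<^sub>v (Vi *\<^sub>v x t)"
        by (rule mult_mat_vec_cancel[OF Vi(1) V(1) Vi(2) xc[OF t], symmetric])
      ultimately show "\<exists>x0 x1 x2 x3. x0 \<in> carrier_vec n0 \<and> x1 \<in> carrier_vec ?a \<and> x2 \<in> carrier_vec ?bb \<and>
        x3 \<in> carrier_vec ?c \<and> x t = V *\<^sub>v (x0 @\<^sub>v x1 @\<^sub>v x2 @\<^sub>v x3) \<and> transpose_mat (M_mat \<beta>) *\<^sub>v x2 = \<phi> t"
        using subvec_4[OF u] unfolding part_def by (metis subvec_carrier)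
    }
  qed

  have f_cont: "Ck_vec 0 T n0 f0" "Ck_vec 0 T ?a f1" "Ck_vec 0 T b f2" "Ck_vec 0 T ?g f3"
    using reg0 c1.g_cont reg2 c3.g_cont by auto

  \<comment> \<open>Every solution has the stated form\<close>
  have necessary: "Ck_vec 1 T (length \<beta>) \<phi> \<and> cond_a \<and>
      (\<exists>v\<in>carrier_vec q. Q *\<^sub>v v = dhat \<phi> \<and> (\<forall>t\<in>?I. x t = X \<phi> v t))"
    if x: "bvp_solution E A f B C d T x" and free: "\<And>t. t \<in> ?I \<Longrightarrow> \<phi> t = transpose_mat (M_mat \<beta>) *\<^sub>v part x t"
    for x \<phi>
  proof -
    let ?x' = "deriv_vec T 1 x"
    have xC1: "Ck_vec 1 T n x" and ode: "\<And>t. t \<in> {0<..<T} \<Longrightarrow> E *\<^sub>v ?x' t = A *\<^sub>v x t + f t"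
      and bc: "B *\<^sub>v x 0 + C *\<^sub>v x T = d"
      using x unfolding bvp_def by auto
    note xd = Ck_vec_1_deriv[OF xC1]
    define u u' where "u t = Vi *\<^sub>v x t" and "u' t = Vi *\<^sub>v ?x' t" for t
    have u: "vec_deriv T (n0 + ?a + ?bb + ?c) u u'" and u'c: "Ck_vec 0 T (n0 + ?a + ?bb + ?c) u'"
      unfolding u_def u'_def mn(2)[symmetric]
      by (rule vec_deriv_mult[OF Vi(1) xd(1)], rule Ck_vec_0_mult[OF Vi(1) xd(2)])
    define u0 u1 u2 u3 where "u0 t = subvec (u t) 0 n0" and "u1 t = subvec (u t) n0 ?a"
      and "u2 t = subvec (u t) (n0 + ?a) ?bb" and "u3 t = subvec (u t) (n0 + ?a + ?bb) ?c" for t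
    define u0' u1' u2' u3' where "u0' t = subvec (u' t) 0 n0" and "u1' t = subvec (u' t) n0 ?a"
      and "u2' t = subvec (u' t) (n0 + ?a) ?bb" and "u3' t = subvec (u' t) (n0 + ?a + ?bb) ?c" for t
    have ud: "vec_deriv T n0 u0 u0'" "vec_deriv T ?a u1 u1'" "vec_deriv T ?bb u2 u2'" "vec_deriv T ?c u3 u3'"
      unfolding u0_def u1_def u2_def u3_def u0'_def u1'_def u2'_def u3'_def
      by (rule vec_deriv_subvec[OF u]; simp)+
    have uc: "Ck_vec 0 T n0 u0'" "Ck_vec 0 T ?a u1'" "Ck_vec 0 T ?bb u2'" "Ck_vec 0 T ?c u3'"
      unfolding u0'_def u1'_def u2'_def u3'_def
      by (rule Ck_vec_0_subvec[OF u'c]; simp)+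
    have ucarr: "u0 t \<in> carrier_vec n0" "u1 t \<in> carrier_vec ?a" "u2 t \<in> carrier_vec ?bb" "u3 t \<in> carrier_vec ?c"
      "u0' t \<in> carrier_vec n0" "u1' t \<in> carrier_vec ?a" "u2' t \<in> carrier_vec ?bb" "u3' t \<in> carrier_vec ?c" for t
      by (simp_all add: u0_def u1_def u2_def u3_def u0'_def u1'_def u2'_def u3'_def)
    have xu: "x t = V *\<^sub>v (u0 t @\<^sub>v u1 t @\<^sub>v u2 t @\<^sub>v u3 t)"
      and xu': "?x' t = V *\<^sub>v (u0' t @\<^sub>v u1' t @\<^sub>v u2' t @\<^sub>v u3' t)" if t: "t \<in> ?I" for t
    proof -
      have "V *\<^sub>v u t = x t" "V *\<^sub>v u' t = ?x' t"
        unfolding u_def u'_def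
        by (rule mult_mat_vec_cancel[OF Vi(1) V(1) Vi(2) vec_deriv_carrier(1)[OF xd(1) t]],
            rule mult_mat_vec_cancel[OF Vi(1) V(1) Vi(2) vec_deriv_carrier(2)[OF xd(1) t]])
      then show "x t = V *\<^sub>v (u0 t @\<^sub>v u1 t @\<^sub>v u2 t @\<^sub>v u3 t)"
        "?x' t = V *\<^sub>v (u0' t @\<^sub>v u1' t @\<^sub>v u2' t @\<^sub>v u3' t)"
        unfolding u0_def u1_def u2_def u3_def u0'_def u1'_def u2'_def u3'_def
        using subvec_4[OF vec_deriv_carrier(1)[OF u t]] subvec_4[OF vec_deriv_carrier(2)[OF u t]] by metis+
    qed
    have open_eqs: "u0' t = A0 *\<^sub>v u0 t + f0 t" "N_mat \<alpha> *\<^sub>v u1' t = u1 t + f1 t"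
        "L_mat \<beta> *\<^sub>v u2' t = K_mat \<beta> *\<^sub>v u2 t + f2 t"
        "transpose_mat (L_mat \<gamma>) *\<^sub>v u3' t = transpose_mat (K_mat \<gamma>) *\<^sub>v u3 t + f3 t"
      if t: "t \<in> {0<..<T}" for t
    proof -
      have t': "t \<in> ?I" using t by auto
      show "u0' t = A0 *\<^sub>v u0 t + f0 t" "N_mat \<alpha> *\<^sub>v u1' t = u1 t + f1 t"
        "L_mat \<beta> *\<^sub>v u2' t = K_mat \<beta> *\<^sub>v u2 t + f2 t"
        "transpose_mat (L_mat \<gamma>) *\<^sub>v u3' t = transpose_mat (K_mat \<gamma>) *\<^sub>v u3 t + f3 t"
        using ode[OF t] unfolding xu[OF t'] xu'[OF t'] ode_iff[OF t' ucarr(5-8) ucarr(1-4)] by simp_all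
    qed
    \<comment> \<open>Both sides of each block equation are continuous on [0,T] because the solution
      is C^1 up to the ends, so the equations extend to 0 and T.\<close>
    note closure_eq = Ck_vec_0_eq_closure[OF T]
    have eq0: "u0' t = A0 *\<^sub>v u0 t + f0 t" if "t \<in> ?I" for t
      by (rule closure_eq[OF uc(1) Ck_vec_0_add[OF Ck_vec_0_mult[OF A0 vec_deriv_cont[OF ud(1)]] f_cont(1)]
          open_eqs(1) that])
    have eq1: "N_mat \<alpha> *\<^sub>v u1' t = u1 t + f1 t" if "t \<in> ?I" for t
      by (rule closure_eq[OF Ck_vec_0_mult[OF NA uc(2)] Ck_vec_0_add[OF vec_deriv_cont[OF ud(2)] f_cont(2)]
          open_eqs(2) that])
    have eq2: "L_mat \<beta> *\<^sub>v u2' t = K_mat \<beta> *\<^sub>v u2 t + f2 t" if "t \<in> ?I" for t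
      by (rule closure_eq[OF Ck_vec_0_mult[OF LB uc(3)]
          Ck_vec_0_add[OF Ck_vec_0_mult[OF KB vec_deriv_cont[OF ud(3)]] f_cont(3)] open_eqs(3) that])
    have eq3: "transpose_mat (L_mat \<gamma>) *\<^sub>v u3' t = transpose_mat (K_mat \<gamma>) *\<^sub>v u3 t + f3 t" if "t \<in> ?I" for t
      by (rule closure_eq[OF Ck_vec_0_mult[OF tLG uc(4)]
          Ck_vec_0_add[OF Ck_vec_0_mult[OF tKG vec_deriv_cont[OF ud(4)]] f_cont(4)] open_eqs(4) that])
    have \<phi>_u2: "\<phi> t = transpose_mat (M_mat \<beta>) *\<^sub>v u2 t" if "t \<in> ?I" for t
      using free[OF that] by (simp add: part_def u2_def u_def)
    \<comment> \<open>The free part is a constant matrix applied to a C^1 function; this is why C^1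
      regularity of \<open>\<phi>\<close> is a necessary condition.\<close>
    have "Ck_vec 1 T (length \<beta>) (\<lambda>t. transpose_mat (M_mat \<beta>) *\<^sub>v u2 t)"
      by (rule vec_deriv_Ck_vec_1(1)[OF T vec_deriv_mult[OF tMB ud(3)] Ck_vec_0_mult[OF tMB uc(3)]])
    then have \<phi>C1: "Ck_vec 1 T (length \<beta>) \<phi>"
      by (rule Ck_vec_cong[OF T]) (simp only: \<phi>_u2)
    have a: cond_a
      unfolding cond_a_iff using c3.overdetermined_necessary(2)[OF pos(3) ud(4) eq3] by blast
    \<comment> \<open>The data at time 0 that the equations leave open: the regular component, and
      the third component without the leading entries of its blocks.\<close>
    define v where "v = u0 0 @\<^sub>v L_mat \<beta> *\<^sub>v u2 0"
    have Lu: "L_mat \<beta> *\<^sub>v u2 0 \<in> carrier_vec b" by (rule mult_mat_vec_carrier[OF LB ucarr(3)])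
    have v: "v \<in> carrier_vec q" unfolding v_def q by (rule append_carrier_vec[OF ucarr(1) Lu])
    have xX: "x t = X \<phi> v t" if t: "t \<in> ?I" for t
    proof -
      have "u0 t = e0 v t"
        unfolding e0_def v_def P0v[OF ucarr(1) Lu]
        by (rule linear_ode_unique[OF T A0 f_cont(1) vec_deriv_cong[OF ud(1) refl] t]) (simp only: eq0)
      moreover have "u1 t = x1 t"
        unfolding x1_eq by (rule c1.chain_sol_unique[OF ud(2) eq1 t])
      moreover have "u2 t = e2 \<phi> v t"
        unfolding e2_def v_def P2v[OF ucarr(1) Lu] h_eq
        by (rule underdetermined_necessary[OF T pos(2) f_cont(3)[unfolded b] ud(3) eq2 \<phi>_u2 t])
      moreover have "u3 t = x3 t"
        unfolding x3_eq by (rule c3.overdetermined_necessary(1)[OF pos(3) ud(4) eq3 t])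
      ultimately show ?thesis unfolding xu[OF t] X_def by simp
    qed
    have "Q *\<^sub>v v = dhat \<phi>"
      using bc boundary[OF Ck_vec_1_imp_0[OF \<phi>C1] v] xX[OF 0] xX[OF TT] by simp
    then show ?thesis using \<phi>C1 a v xX by blast
  qed

  \<comment> \<open>Every such function is a solution\<close>
  have sufficient: "bvp_solution E A f B C d T x \<and> has_free_part V n0 \<alpha> \<beta> \<gamma> T \<phi> x"
    if \<phi>C1: "Ck_vec 1 T (length \<beta>) \<phi>" and a: cond_a and v: "v \<in> carrier_vec q" and Qd: "Q *\<^sub>v v = dhat \<phi>"
      and xX: "\<And>t. t \<in> ?I \<Longrightarrow> x t = X \<phi> v t" for x \<phi> v
  proof -
    have Pv: "P0 *\<^sub>v v \<in> carrier_vec n0" "P2 *\<^sub>v v \<in> carrier_vec b"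
      by (rule mult_mat_vec_carrier[OF P0c v], rule mult_mat_vec_carrier[OF P2c v])
    let ?e0' = "\<lambda>t. A0 *\<^sub>v e0 v t + f0 t"
    have d0: "vec_deriv T n0 (e0 v) ?e0'"
      unfolding e0_def[abs_def] by (rule variation_of_constants(1)[OF A0 f_cont(1) Pv(1)])
    have c0: "Ck_vec 0 T n0 ?e0'"
      by (intro Ck_vec_0_add Ck_vec_0_mult[OF A0] vec_deriv_cont[OF d0] f_cont)
    note d1 = Ck_vec_1_deriv[OF c1.chain_sol_C1, folded x1_eq]
    obtain e2' where d2: "vec_deriv T ?bb (e2 \<phi> v) e2'" "Ck_vec 0 T ?bb e2'"
      "\<And>t. t \<in> ?I \<Longrightarrow> L_mat \<beta> *\<^sub>v e2' t = K_mat \<beta> *\<^sub>v e2 \<phi> v t + f2 t"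
      "\<And>t. t \<in> ?I \<Longrightarrow> transpose_mat (M_mat \<beta>) *\<^sub>v e2 \<phi> v t = \<phi> t"
      using underdetermined_sufficient[OF T pos(2) f_cont(3)[unfolded b] \<phi>C1 Pv(2)[unfolded b], folded h_eq, folded e2_def]
      by blast
    have last: "?S3 t $ (sum_list (take k \<gamma>) + (\<gamma> ! k - 1)) = 0" if "k < length \<gamma>" "t \<in> ?I" for k t
      using a that unfolding cond_a_iff by blast
    define e3' where "e3' t = K_mat \<gamma> *\<^sub>v deriv_vec T 1 ?S3 t" for t
    have d3: "vec_deriv T ?c x3 e3'" "Ck_vec 0 T ?c e3'"
      unfolding x3_eq e3'_def[abs_def]
      by (rule c3.overdetermined_sufficient(1)[OF pos(3) last], assumption+,
          rule c3.overdetermined_sufficient(2)[OF pos(3) last])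
    have d3': "transpose_mat (L_mat \<gamma>) *\<^sub>v e3' t = transpose_mat (K_mat \<gamma>) *\<^sub>v x3 t + f3 t"
      if "t \<in> ?I" for t
      unfolding x3_eq e3'_def by (rule c3.overdetermined_sufficient(3)[OF pos(3) last]) (use that in auto)
    let ?y = "\<lambda>t. e0 v t @\<^sub>v x1 t @\<^sub>v e2 \<phi> v t @\<^sub>v x3 t"
      and ?y' = "\<lambda>t. ?e0' t @\<^sub>v deriv_vec T 1 x1 t @\<^sub>v e2' t @\<^sub>v e3' t"
    have n': "n0 + (?a + (?bb + ?c)) = n" using mn by simp
    have y: "vec_deriv T n ?y ?y'"
      using vec_deriv_append[OF d0 vec_deriv_append[OF d1(1) vec_deriv_append[OF d2(1) d3(1)]]]
      unfolding n' .
    have y'c: "Ck_vec 0 T n ?y'"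
      using Ck_vec_0_append[OF c0 Ck_vec_0_append[OF d1(2) Ck_vec_0_append[OF d2(2) d3(2)]]]
      unfolding n' .
    have x: "vec_deriv T n x (\<lambda>t. V *\<^sub>v ?y' t)"
      by (rule vec_deriv_cong[OF vec_deriv_mult[OF V(1) y]]) (simp_all only: xX X_def)
    note x' = vec_deriv_Ck_vec_1[OF T x Ck_vec_0_mult[OF V(1) y'c]]
    have "E *\<^sub>v deriv_vec T 1 x t = A *\<^sub>v x t + f t" if "t \<in> {0<..<T}" for t
    proof -
      have t: "t \<in> ?I" using that by auto
      show ?thesis
        unfolding x'(2)[OF t] xX[OF t] X_def
          ode_iff[OF t vec_deriv_carrier(2)[OF d0 t] vec_deriv_carrier(2)[OF d1(1) t]
            vec_deriv_carrier(2)[OF d2(1) t] vec_deriv_carrier(2)[OF d3(1) t] e0c x1c e2c x3c]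
        using c1.chain_sol_eq[OF t] d2(3)[OF t] d3'[OF t] unfolding x1_eq by blast
    qed
    moreover have "B *\<^sub>v x 0 + C *\<^sub>v x T = d"
      using boundary[OF Ck_vec_1_imp_0[OF \<phi>C1] v] Qd xX[OF 0] xX[OF TT] by simp
    moreover have "has_free_part V n0 \<alpha> \<beta> \<gamma> T \<phi> x"
      unfolding has_free_part_def
      using xX d2(4) e0c x1c e2c x3c unfolding X_def by blast
    ultimately show ?thesis unfolding bvp_def using x'(1) by blast
  qed

  \<comment> \<open>Solvability and parametrization of the solutions\<close>
  have free_part_iff: "bvp_solution E A f B C d T x \<Longrightarrow>
      has_free_part V n0 \<alpha> \<beta> \<gamma> T \<phi> x \<longleftrightarrow> (\<forall>t\<in>?I. \<phi> t = transpose_mat (M_mat \<beta>) *\<^sub>v part x t)" for x \<phi>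
    by (rule free_iff) (auto simp: bvp_def dest: Ck_vec_carrier)
  have key: "bvp_solution E A f B C d T x \<and> has_free_part V n0 \<alpha> \<beta> \<gamma> T \<phi> x \<longleftrightarrow>
      Ck_vec 1 T (length \<beta>) \<phi> \<and> cond_a \<and>
      (\<exists>v\<in>carrier_vec q. Q *\<^sub>v v = dhat \<phi> \<and> (\<forall>t\<in>?I. x t = X \<phi> v t))" for x \<phi>
    using necessary[of x \<phi>] sufficient[of \<phi> _ x] free_part_iff[of x \<phi>] by blast
  have cond_b_iff: "cond_b \<phi> \<longleftrightarrow> (\<exists>v\<in>carrier_vec q. Q *\<^sub>v v = dhat \<phi>)" for \<phi>
    unfolding cond_b mat_range_def mem_Collect_eq carrier_matD(2)[OF Qc] by metis
  have solvable: "(\<exists>x. bvp_solution E A f B C d T x \<and> has_free_part V n0 \<alpha> \<beta> \<gamma> T \<phi> x) \<longleftrightarrow>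
      Ck_vec 1 T (length \<beta>) \<phi> \<and> cond_a \<and> cond_b \<phi>" for \<phi>
    unfolding key cond_b_iff by blast
  \<comment> \<open>The parameter vectors \<open>v\<close> with Q v = dhat are exactly the vectors
    \<open>w \<phi> Qg z\<close>, for whichever generalized inverse is chosen.\<close>
  have param: "(\<exists>v\<in>carrier_vec q. Q *\<^sub>v v = dhat \<phi> \<and> (\<forall>t\<in>?I. x t = X \<phi> v t)) \<longleftrightarrow>
      cond_b \<phi> \<and> (\<exists>z\<in>carrier_vec q. \<forall>t\<in>?I. x t = xsol \<phi> Qg z t)"
    if \<phi>: "Ck_vec 0 T (length \<beta>) \<phi>" and Qg: "gen_inverse Q Qg" for x \<phi> Qg
  proof -
    have Qgc: "Qg \<in> carrier_mat q l" using Qg Qc by (simp add: gen_inverse_def)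
    have "w \<phi> Qg z \<in> carrier_vec q" if "z \<in> carrier_vec q" for z
      unfolding w using mult_carrier_mat[OF Qgc Qc]
      by (intro add_carrier_vec mult_mat_vec_row_carrier[OF Qgc] mult_mat_vec_row_carrier[of _ q q]
          minus_carrier_mat)
    then have "(\<forall>t\<in>?I. x t = xsol \<phi> Qg z t) \<longleftrightarrow> (\<forall>t\<in>?I. x t = X \<phi> (w \<phi> Qg z) t)"
      if "z \<in> carrier_vec q" for z
      using xsol_eq[OF \<phi>] that by auto
    then show ?thesis
      using gen_inverse_parametrization[OF Qc Qg dhatc, of \<phi> "\<lambda>v. \<forall>t\<in>?I. x t = X \<phi> v t"]
      unfolding cond_b w by auto
  qed
  \<comment> \<open>By \<open>d2_eq\<close> the free part enters \<open>dhat\<close> only through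
    \<open>h\<close> at 0 and T. The substitute \<open>\<psi>\<close> leaves both values unchanged,
    so (b) passes from \<open>\<phi>\<close> to \<open>\<psi>\<close>, for which a solution
    exists.\<close>
  have smooth: "\<exists>x. bvp_solution E A f B C d T x"
    if \<phi>: "Ck_vec 0 T (length \<beta>) \<phi>" and a: cond_a and b': "cond_b \<phi>" for \<phi>
  proof -
    obtain \<psi> where \<psi>: "Ck_vec 1 T (length \<beta>) \<psi>" "\<psi> 0 = \<phi> 0" "\<psi> T = \<phi> T"
      "integral_vec ?bb 0 T (\<lambda>s. mat_exp ((T - s) \<cdot>\<^sub>m N_mat \<beta>) *\<^sub>v under_input \<beta> f2 \<psi> s) =
       integral_vec ?bb 0 T (\<lambda>s. mat_exp ((T - s) \<cdot>\<^sub>m N_mat \<beta>) *\<^sub>v under_input \<beta> f2 \<phi> s)"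
      using smooth_free_part[OF T pos(2) f_cont(3)[unfolded b] \<phi>] .
    have "h \<psi> T = h \<phi> T" "h \<psi> 0 = h \<phi> 0" unfolding h_eq[of _ T] h0 \<psi>(2-4) by simp_all
    then have "dhat \<psi> = dhat \<phi>"
      unfolding dhat d2_eq[OF \<phi>] d2_eq[OF Ck_vec_1_imp_0[OF \<psi>(1)]] by simp
    then have "cond_b \<psi>" using b' by (simp add: cond_b)
    then show ?thesis using solvable[of \<psi>] \<psi>(1) a by blast
  qed
  show ?thesis
  proof (intro conjI allI impI)
    fix \<phi> assume \<phi>: "Ck_vec 0 T (length \<beta>) \<phi>"
    show "(\<exists>x. bvp_solution E A f B C d T x \<and> has_free_part V n0 \<alpha> \<beta> \<gamma> T \<phi> x) \<longleftrightarrow>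
      Ck_vec 1 T (length \<beta>) \<phi> \<and> cond_a \<and> cond_b \<phi>"
      by (rule solvable)
    show "\<exists>x. bvp_solution E A f B C d T x" if "cond_a \<and> cond_b \<phi>"
      using smooth[OF \<phi>] that by blast
    show "bvp_solution E A f B C d T x \<and> has_free_part V n0 \<alpha> \<beta> \<gamma> T \<phi> x \<longleftrightarrow>
        Ck_vec 1 T (length \<beta>) \<phi> \<and> cond_a \<and> cond_b \<phi> \<and>
        (\<exists>z\<in>carrier_vec q. \<forall>t\<in>?I. x t = xsol \<phi> Qg z t)" if "gen_inverse Q Qg" for Qg x
      unfolding key param[OF \<phi> that] by blast
  next
    fix x assume x: "bvp_solution E A f B C d T x"
    \<comment> \<open>The only possible free part of the given solution.\<close>
    let ?\<phi> = "\<lambda>t. transpose_mat (M_mat \<beta>) *\<^sub>v part x t"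
    have free: "has_free_part V n0 \<alpha> \<beta> \<gamma> T ?\<phi> x" unfolding free_part_iff[OF x] by simp
    then have k: "Ck_vec 1 T (length \<beta>) ?\<phi>" cond_a
      "\<exists>v\<in>carrier_vec q. Q *\<^sub>v v = dhat ?\<phi> \<and> (\<forall>t\<in>?I. x t = X ?\<phi> v t)"
      using key[of x ?\<phi>] x by blast+
    show cond_a by (rule k(2))
    have \<phi>: "Ck_vec 0 T (length \<beta>) ?\<phi>" by (rule Ck_vec_1_imp_0[OF k(1)])
    have "cond_b ?\<phi>" using k(3) unfolding cond_b_iff by blast
    moreover have "\<exists>z\<in>carrier_vec q. \<forall>t\<in>?I. x t = xsol ?\<phi> Qg z t" if "gen_inverse Q Qg" for Qg
      using k(3) unfolding param[OF \<phi> that] by blast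
    ultimately show "\<exists>\<phi>. Ck_vec 0 T (length \<beta>) \<phi> \<and> has_free_part V n0 \<alpha> \<beta> \<gamma> T \<phi> x \<and> cond_b \<phi> \<and>
       (\<forall>Qg. gen_inverse Q Qg \<longrightarrow> (\<exists>z\<in>carrier_vec q. \<forall>t\<in>?I. x t = xsol \<phi> Qg z t))"
      using \<phi> free by blast
  qed
qed

end
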